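(* The Drinfeld realization and the vertex realization of the quantum affine algebra are equivalent. That is, let $U^{Dr}$ be the algebra with generators $e_{i,r},f_{i,r},q^h,h_{i,m},q^{\pm d},q^{\pm c/2}$ and relations (D1)--(D10) of the context, and let $U^{v}$ be the algebra with generators $E_{i,r},F_{i,r},q^h,q^{\pm d},q^{\pm c/2},P_i^{(n)},P_i^{(1^n)},Q_i^{(n)},Q_i^{(1^n)}$ and relations (V1)--(V10) of the context. Then $U^{v}$ and $U^{Dr}$ are equivalent presentations, via the identification that fixes $q^h,q^{\pm d},q^{\pm c/2}$ and is given by $$E_{i,r}=(q^{-c/2})^re_{i,r},\qquad F_{i,r}=(q^{-c/2})^rf_{i,r},$$ $$\sum_{n\ge0}Q_i^{(n)}z^n=\exp\Big(\sum_{n\ge1}\frac{h_{i,n}}{[n]}z^n\Big),\qquad\sum_{n\ge0}(-1)^nQ_i^{(1^n)}z^n=\exp\Big(-\sum_{n\ge1}\frac{h_{i,n}}{[n]}z^n\Big),$$ $$\sum_{n\ge0}P_i^{(n)}z^n=\exp\Big(\sum_{n\ge1}\frac{h_{i,-n}}{[n]}z^n\Big),\qquad\sum_{n\ge0}(-1)^nP_i^{(1^n)}z^n=\exp\Big(-\sum_{n\ge1}\frac{h_{i,-n}}{[n]}z^n\Big).$$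
   Context: **Notation.** $\Bbbk$ is a field of characteristic zero, $q$ an indeterminate, algebras are over $\Bbbk(q)$, $[n]=\frac{q^n-q^{-n}}{q-q^{-1}}$. $I$ is the vertex set of a simply-laced Dynkin diagram of finite type, with $\langle i,j\rangle$ the Cartan matrix entries ($2$ if $i=j$, $-1$ if $i\neq j$ are joined, $0$ otherwise), simple roots $\alpha_i$, weight lattice $X$, dual lattice $X^*=\mathrm{Hom}(X,\mathbb Z)$, and $h_i\in X^*$ the simple coroots, $h_i(\alpha_j)=\langle i,j\rangle$. Indices: $i,j\in I$, $r\in\mathbb Z$, $m\in\mathbb Z\setminus\{0\}$ for $h_{i,m}$, $n\in\mathbb N$ for $P,Q$, $h\in X^*$. **Drinfeld realization $U^{Dr}$.** Let $x_i^+(z)=\sum_{n\in\mathbb Z}e_{i,n}z^{-n}$, $x_i^-(z)=\sum_{n\in\mathbb Z}f_{i,n}z^{-n}$, $\delta(z)=\sum_{n\in\mathbb Z}z^n$, $\psi_i^\pm(z)=\sum_{n\ge0}\psi_i^\pm(\pm n)z^{\mp n}=q^{\pm h_i}\exp\big(\pm(q-q^{-1})\sum_{n>0}h_{i,\pm n}z^{\mp n}\big)$. Relations: (D1) $q^{\pm c/2}$ is central. (D2) $q^0=1$, $q^hq^{h'}=q^{h+h'}$, $[q^h,h_{i,m}]=0$, $q^dq^{-d}=1$, $q^{c/2}q^{-c/2}=1$. (D3) $\psi_i^\pm(z)\psi_j^\pm(w)=\psi_j^\pm(w)\psi_i^\pm(z)$. (D4) $\psi_i^-(z)\psi_j^+(w)=\frac{(z-q^{-\langle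 i,j\rangle}q^cw)(z-q^{\langle i,j\rangle}q^{-c}w)}{(z-q^{\langle i,j\rangle}q^cw)(z-q^{-\langle i,j\rangle}q^{-c}w)}\psi_j^+(w)\psi_i^-(z)$ (expanded in nonnegative powers of $z/w$). (D5) $[q^d,q^h]=0$, $q^dh_{i,m}q^{-d}=q^mh_{i,m}$, $q^de_{i,r}q^{-d}=q^re_{i,r}$, $q^df_{i,r}q^{-d}=q^rf_{i,r}$. (D6) $(q^{\pm sc/2}z-q^{\pm\langle i,j\rangle}w)\psi_j^s(z)x_i^\pm(w)=(q^{\pm\langle i,j\rangle}q^{\pm sc/2}z-w)x_i^\pm(w)\psi_j^s(z)$, $s=\pm$. (D7) $[x_i^+(z),x_j^-(w)]=\delta_{ij}\frac1{q-q^{-1}}\big(\delta(q^cwz^{-1})\psi_i^+(q^{c/2}w)-\delta(q^czw^{-1})\psi_i^-(q^{c/2}z)\big)$. (D8) $(z-q^{\pm2}w)x_i^\pm(z)x_i^\pm(w)=(q^{\pm2}z-w)x_i^\pm(w)x_i^\pm(z)$. (D9) $(z-q^{\mp1}w)x_i^\pm(z)x_j^\pm(w)=x_j^\pm(w)x_i^\pm(z)(q^{\mp1}z-w)$ if $\langle i,j\rangle=-1$. (D10) If $\langle i,j\rangle\le0$ and $N=1-\langle i,j\rangle$: $\sum_{\sigma\in S_N}\sum_{s=0}^N(-1)^s\begin{bmatrix}N\\ s\end{bmatrix}x_i^\pm(z_{\sigma(1)})\cdots x_i^\pm(z_{\sigma(s)})x_j^\pm(w)x_i^\pm(z_{\sigma(s+1)})\cdots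 x_i^\pm(z_{\sigma(N)})=0$ (quantum binomials). **Vertex realization $U^v$.** Conventions: $P_i^{(0)}=P_i^{(1^0)}=Q_i^{(0)}=Q_i^{(1^0)}=1$, symbols with negative index vanish, and $\sum_nP_i^{(n)}z^n$ is inverse to $\sum_n(-1)^nP_i^{(1^n)}z^n$, likewise for $Q$. For $n\ge1$ put $Q_i^{[1^n]}=\sum_{m=0}^n(-q)^m[m]Q_i^{(1^{n-m})}Q_i^{(m)}$ and $P_i^{[1^n]}=\sum_{m=0}^n(-q)^{-m}[m]P_i^{(1^{n-m})}P_i^{(m)}$. The central elements $\mathrm{Sym}^k(f)$, $\Lambda^k(f)$ for $f=[c]$ or $f=[2][c]$ are defined by $\sum_k\mathrm{Sym}^k(f)z^k=\exp\big(\sum_{n\ge1}p_n(f)\frac{z^n}n\big)$ and $\sum_k\Lambda^k(f)z^k=\exp\big(\sum_{n\ge1}(-1)^{n-1}p_n(f)\frac{z^n}n\big)$, where $p_n([c])=\frac{q^{nc}-q^{-nc}}{q^n-q^{-n}}$ and $p_n([2][c])=(q^n+q^{-n})p_n([c])$ (for $c\in\mathbb N$ these are the graded dimensions of the $k$-th symmetric and exterior powers of a graded vector space of graded dimension $f$). Relations: (V1) $q^{\pm c/2}$ is central. (V2) $q^0=1$, $q^hq^{h'}=q^{h+h'}$, $q^h$ commutes with all $P$'s and $Q$'s, $q^dq^{-d}=1$, $q^{c/2}q^{-c/2}=1$, and $q^hE_{i,r}q^{-h}=q^{h(\alpha_i)}E_{i,r}$, $q^hF_{i,r}q^{-h}=q^{-h(\alpha_i)}F_{i,r}$.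 (V3) All $P_i^{(n)},P_i^{(1^n)}$ ($i\in I$) commute among each other; all $Q_i^{(n)},Q_i^{(1^n)}$ ($i\in I$) commute among each other. (V4) $Q_j^{(n)}P_i^{(m)}$ equals $\sum_{k\ge0}\mathrm{Sym}^k([2][c])P_i^{(m-k)}Q_i^{(n-k)}$ if $i=j$; $\sum_{k\ge0}(-1)^k\Lambda^k([c])P_i^{(m-k)}Q_j^{(n-k)}$ if $\langle i,j\rangle=-1$; $P_i^{(m)}Q_j^{(n)}$ if $\langle i,j\rangle=0$. $Q_j^{(1^n)}P_i^{(m)}$ equals $\sum_{k\ge0}\Lambda^k([2][c])P_i^{(m-k)}Q_i^{(1^{n-k})}$ if $i=j$; $\sum_{k\ge0}(-1)^k\mathrm{Sym}^k([c])P_i^{(m-k)}Q_j^{(1^{n-k})}$ if $\langle i,j\rangle=-1$; $P_i^{(m)}Q_j^{(1^n)}$ if $\langle i,j\rangle=0$. Likewise with $(a)$ and $(1^a)$ exchanged everywhere. (V5) $[q^d,q^h]=0$, $q^dQ_i^{(m)}q^{-d}=q^mQ_i^{(m)}$, $q^dP_i^{(m)}q^{-d}=q^{-m}P_i^{(m)}$, $q^dE_{i,r}q^{-d}=q^rE_{i,r}$, $q^dF_{i,r}q^{-d}=q^rF_{i,r}$. (V6) For $a>0$ and $b\in\mathbb Z$: $q^c[Q_i^{[1^{a+1}]},E_{i,b}]=q^2Q_i^{[1^a]}E_{i,b+1}-q^{-2}E_{i,b+1}Q_i^{[1^a]}$, $[Q_i^{[1^{a+1}]},F_{i,b}]=q^{-2}Q_i^{[1^a]}F_{i,b+1}-q^2F_{i,b+1}Q_i^{[1^a]}$,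 $[P_i^{[1^{a+1}]},E_{i,b+1}]=q^2E_{i,b}P_i^{[1^a]}-q^{-2}P_i^{[1^a]}E_{i,b}$, $q^{-c}[P_i^{[1^{a+1}]},F_{i,b+1}]=q^{-2}F_{i,b}P_i^{[1^a]}-q^2P_i^{[1^a]}F_{i,b}$; while $q^c[Q_i^{[1]},E_{i,b}]=[2]E_{i,b+1}$, $[Q_i^{[1]},F_{i,b}]=-[2]F_{i,b+1}$, $[P_i^{[1]},E_{i,b+1}]=[2]E_{i,b}$, $q^{-c}[P_i^{[1]},F_{i,b+1}]=-[2]F_{i,b}$. If $\langle i,j\rangle=-1$, for $a>0$: $q^c[Q_j^{[1^{a+1}]},E_{i,b}]=-qE_{i,b+1}Q_j^{[1^a]}+q^{-1}Q_j^{[1^a]}E_{i,b+1}$, $[Q_j^{[1^{a+1}]},F_{i,b}]=-q^{-1}F_{i,b+1}Q_j^{[1^a]}+qQ_j^{[1^a]}F_{i,b+1}$, $[P_j^{[1^{a+1}]},E_{i,b+1}]=-q^{-1}E_{i,b}P_j^{[1^a]}+qP_j^{[1^a]}E_{i,b}$, $q^{-c}[P_j^{[1^{a+1}]},F_{i,b+1}]=-qF_{i,b}P_j^{[1^a]}+q^{-1}P_j^{[1^a]}F_{i,b}$; while $q^c[Q_j^{[1]},E_{i,b}]=-E_{i,b+1}$, $[Q_j^{[1]},F_{i,b}]=F_{i,b+1}$, $[P_j^{[1]},E_{i,b+1}]=-E_{i,b}$, $q^{-c}[P_j^{[1]},F_{i,b+1}]=F_{i,b}$. If $\langle i,j\rangle=0$,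 all $P_j^{[1^a]},Q_j^{[1^a]}$ commute with all $E_{i,b},F_{i,b}$. (V7) $[E_{i,a},F_{i,b}]$ equals $q^{ac}q^{h_i}Q_i^{[1^{a+b}]}$ if $a+b>0$; $q^{bc}q^{-h_i}P_i^{[1^{-a-b}]}$ if $a+b<0$; $\frac{q^{ac}q^{h_i}-q^{-ac}q^{-h_i}}{q-q^{-1}}$ if $a+b=0$. If $i\ne j$, $[E_{i,a},F_{j,b}]=0$. (V8) For all $m,n\in\mathbb Z$: $E_{i,m}E_{i,n-1}+E_{i,n}E_{i,m-1}=q^2(E_{i,m-1}E_{i,n}+E_{i,n-1}E_{i,m})$ and $F_{i,n-1}F_{i,m}+F_{i,m-1}F_{i,n}=q^2(F_{i,n}F_{i,m-1}+F_{i,m}F_{i,n-1})$. (V9) For all $m,n\in\mathbb Z$: if $\langle i,j\rangle=-1$, $E_{i,m}E_{j,n-1}+E_{j,n}E_{i,m-1}=q^{-1}(E_{j,n-1}E_{i,m}+E_{i,m-1}E_{j,n})$ and $F_{i,m-1}F_{j,n}+F_{j,n-1}F_{i,m}=q^{-1}(F_{j,n}F_{i,m-1}+F_{i,m}F_{j,n-1})$; if $\langle i,j\rangle=0$, $E_{i,m}E_{j,n}=E_{j,n}E_{i,m}$ and $F_{i,m}F_{j,n}=F_{j,n}F_{i,m}$. (V10) If $\langle i,j\rangle=-1$, for all $n,m_1,m_2\in\mathbb Z$: $\sum_{\sigma\in S_2}\big(E_{j,n}E_{i,m_{\sigma(1)}}E_{i,m_{\sigma(2)}}+E_{i,m_{\sigma(1)}}E_{i,m_{\sigma(2)}}E_{j,n}\big)=\sum_{\sigma\in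 S_2}[2]E_{i,m_{\sigma(1)}}E_{j,n}E_{i,m_{\sigma(2)}}$, and the same with $E$'s replaced by $F$'s.
   Formalization: Proved with E_{i,r}=(-q q^{c/2})^r e_{i,r}, F_{i,r}=(-q q^{c/2})^r f_{i,r} in place of (q^{-c/2})^r, and with the right-hand sides of the two i=j, a>0 P-relations in (V6) negated; as printed the claim is false. Also q^{-d}q^d=1 is imposed in both algebras. *)

theory Defs
  imports
    "HOL-Combinatorics.Permutations"
    "HOL-Computational_Algebra.Polynomial"
    "HOL-Computational_Algebra.Fraction_Field"
    "HOL-Computational_Algebra.Formal_Power_Series"
    "HOL-Library.Poly_Mapping"
    "HOL-Algebra.QuotRing"
begin

unbundle fps_syntax

section \<open>The base field and quantum integers\<close>

definition qq :: "'k::field_char_0 poly fract" where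
  "qq = Fract [:0, 1:] 1"

definition qint :: "int \<Rightarrow> 'k::field_char_0 poly fract" where
  "qint n = (qq powi n - qq powi (- n)) / (qq - inverse qq)"

definition qfactorial :: "nat \<Rightarrow> 'k::field_char_0 poly fract" where
  "qfactorial n = (\<Prod>k=1..n. qint (int k))"

definition qbinomial :: "nat \<Rightarrow> nat \<Rightarrow> 'k::field_char_0 poly fract" where
  "qbinomial n s = qfactorial n / (qfactorial s * qfactorial (n - s))"

section \<open>Simply-laced Dynkin diagrams of finite type\<close>

definition cartan :: "('i \<Rightarrow> 'i \<Rightarrow> bool) \<Rightarrow> 'i \<Rightarrow> 'i \<Rightarrow> int" where
  "cartan adj i j = (if i = j then 2 else if adj i j then -1 else 0)"

text \<open>Finite type means that the (symmetric) Cartan matrix is positive definite.\<close>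

definition simply_laced_finite_type :: "('i::finite \<Rightarrow> 'i \<Rightarrow> bool) \<Rightarrow> bool" where
  "simply_laced_finite_type adj \<longleftrightarrow>
     (\<forall>i. \<not> adj i i) \<and> (\<forall>i j. adj i j \<longrightarrow> adj j i) \<and>
     (\<forall>x :: 'i \<Rightarrow> real. (\<exists>i. x i \<noteq> 0) \<longrightarrow>
        (\<Sum>i\<in>UNIV. \<Sum>j\<in>UNIV. x i * of_int (cartan adj i j) * x j) > 0)"

text \<open>
  The weight lattice \<open>X\<close> has the fundamental weights as a basis, so the dual lattice
  \<open>X\<^sup>* = Hom(X, \<int>)\<close> has the simple coroots \<open>h\<^sub>i\<close> as a basis. Elements of \<open>X\<^sup>*\<close> are given by their
  coordinates in that basis: \<open>h\<close> stands for the sum of the \<open>h i \<cdot> h\<^sub>i\<close>.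
\<close>

type_synonym 'i coweight = "'i \<Rightarrow> int"

definition coroot :: "'i \<Rightarrow> 'i coweight" where
  "coroot i = (\<lambda>j. if j = i then 1 else 0)"

definition eval_root :: "('i::finite \<Rightarrow> 'i \<Rightarrow> bool) \<Rightarrow> 'i coweight \<Rightarrow> 'i \<Rightarrow> int" where
  \<comment> \<open>\<open>h(\<alpha>\<^sub>i)\<close>\<close>
  "eval_root adj h i = (\<Sum>j\<in>UNIV. h j * cartan adj j i)"

section \<open>Algebras given by generators and relations\<close>

datatype 'g fword = FWord (letters: "'g list")

instantiation fword :: (type) monoid_add
begin
definition zero_fword :: "'a fword" where "zero_fword = FWord []"
definition plus_fword :: "'a fword \<Rightarrow> 'a fword \<Rightarrow> 'a fword" where
  "plus_fword u v = FWord (letters u @ letters v)"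
instance
  by standard (simp_all add: zero_fword_def plus_fword_def)
end

text \<open>The free algebra is the monoid algebra of the free monoid.\<close>

type_synonym ('g, 'k) falg = "'g fword \<Rightarrow>\<^sub>0 'k poly fract"

definition scal :: "'k::field_char_0 poly fract \<Rightarrow> ('g, 'k) falg" where
  "scal a = Poly_Mapping.single 0 a"

definition gen :: "'g \<Rightarrow> ('g, 'k::field_char_0) falg" where
  "gen g = Poly_Mapping.single (FWord [g]) 1"

definition falg_ring :: "('g, 'k::field_char_0) falg ring" where
  "falg_ring = \<lparr>carrier = UNIV, mult = (*), one = 1, zero = 0, add = (+)\<rparr>"

definition rel_ideal ::
    "(('g, 'k::field_char_0) falg \<Rightarrow> ('g, 'k) falg \<Rightarrow> bool) \<Rightarrow> ('g, 'k) falg set" where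
  "rel_ideal R = genideal falg_ring {l - r | l r. R l r}"

definition presented_algebra ::
    "(('g, 'k::field_char_0) falg \<Rightarrow> ('g, 'k) falg \<Rightarrow> bool) \<Rightarrow> ('g, 'k) falg set ring" where
  "presented_algebra R = falg_ring Quot rel_ideal R"

definition cls ::
    "(('g, 'k::field_char_0) falg \<Rightarrow> ('g, 'k) falg \<Rightarrow> bool) \<Rightarrow> ('g, 'k) falg \<Rightarrow> ('g, 'k) falg set" where
  "cls R x = rel_ideal R +>\<^bsub>falg_ring\<^esub> x"

definition commutator :: "'a::ring \<Rightarrow> 'a \<Rightarrow> 'a" where
  "commutator x y = x * y - y * x"

text \<open>
  Exponential of a power series with zero constant term. The coefficients need not commute: they only
  do so after passing to the quotients below.
\<close>

definition fexp :: "('g, 'k::field_char_0) falg fps \<Rightarrow> ('g, 'k) falg fps" where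
  "fexp A = Abs_fps (\<lambda>n. \<Sum>k\<le>n. scal (inverse (of_nat (fact k))) * (A ^ k) $ n)"

definition pos_series :: "(nat \<Rightarrow> 'a::zero) \<Rightarrow> 'a fps" where
  "pos_series a = Abs_fps (\<lambda>n. if n = 0 then 0 else a n)"

definition geom :: "'a::semiring_1 \<Rightarrow> 'a fps" where
  \<comment> \<open>\<open>1 / (1 - a u)\<close>\<close>
  "geom a = Abs_fps (\<lambda>n. a ^ n)"

datatype sign = Pos | Neg

fun sg :: "sign \<Rightarrow> int" where
  "sg Pos = 1"
| "sg Neg = -1"

section \<open>The Drinfeld realization\<close>

typedef nonzero_int = "{m :: int. m \<noteq> 0}"
  by (rule exI[of _ 1]) simp

datatype 'i dr_gen =
    DX sign 'i int  \<comment> \<open>\<open>e\<^bsub>i,r\<^esub>\<close> for \<open>Pos\<close> and \<open>f\<^bsub>i,r\<^esub>\<close> for \<open>Neg\<close>\<close>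
  | DK "'i coweight"
  | DH 'i nonzero_int
  | DD sign
  | DC sign  \<comment> \<open>\<open>q\<^bsup>c/2\<^esup>\<close> and \<open>q\<^bsup>-c/2\<^esup>\<close>\<close>

abbreviation d_e :: "'i \<Rightarrow> int \<Rightarrow> ('i dr_gen, 'k::field_char_0) falg" where
  "d_e i r \<equiv> gen (DX Pos i r)"

abbreviation d_f :: "'i \<Rightarrow> int \<Rightarrow> ('i dr_gen, 'k::field_char_0) falg" where
  "d_f i r \<equiv> gen (DX Neg i r)"

abbreviation d_q :: "'i coweight \<Rightarrow> ('i dr_gen, 'k::field_char_0) falg" where
  "d_q h \<equiv> gen (DK h)"

abbreviation d_d :: "sign \<Rightarrow> ('i dr_gen, 'k::field_char_0) falg" where
  "d_d s \<equiv> gen (DD s)"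

definition d_h :: "'i \<Rightarrow> int \<Rightarrow> ('i dr_gen, 'k::field_char_0) falg" where
  \<comment> \<open>only meaningful for \<open>m \<noteq> 0\<close>\<close>
  "d_h i m = gen (DH i (Abs_nonzero_int m))"

definition d_c :: "int \<Rightarrow> ('i dr_gen, 'k::field_char_0) falg" where
  \<comment> \<open>\<open>q\<^bsup>kc/2\<^esup>\<close>; in particular \<open>d_c 2\<close> is \<open>q\<^sup>c\<close>\<close>
  "d_c k = (if 0 \<le> k then gen (DC Pos) ^ nat k else gen (DC Neg) ^ nat (- k))"

text \<open>
  \<open>d_psi s i\<close> is \<open>\<psi>\<^sub>i\<^sup>s\<close> as a power series in \<open>z\<^sup>-\<^sup>1\<close> (for \<open>s = +\<close>) or in \<open>z\<close> (for \<open>s = -\<close>), so that its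
  \<open>n\<close>-th coefficient is \<open>\<psi>\<^sub>i\<^sup>s(s n)\<close>.
\<close>

definition d_psi :: "sign \<Rightarrow> 'i \<Rightarrow> ('i dr_gen, 'k::field_char_0) falg fps" where
  "d_psi s i =
     fps_const (d_q (\<lambda>j. sg s * coroot i j)) *
     fexp (pos_series (\<lambda>n. scal (of_int (sg s) * (qq - inverse qq)) * d_h i (sg s * int n)))"

text \<open>
  Formal distributions are handled through their coefficients: an identity of distributions is the
  family of identities between the coefficients of all monomials. The coefficients of \<open>z\<^sup>k\<close> in
  \<open>x\<^sub>i\<^sup>s(z)\<close> and in \<open>\<psi>\<^sub>i\<^sup>s(z)\<close> are \<open>xc s i k\<close> and \<open>psic s i k\<close>. For \<open>G(z,w)\<close> with coefficients \<open>G k l\<close>,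
  the coefficients of \<open>(a z - b w) G(z,w)\<close> are \<open>lin2 a b G k l\<close>.
\<close>

definition xc :: "sign \<Rightarrow> 'i \<Rightarrow> int \<Rightarrow> ('i dr_gen, 'k::field_char_0) falg" where
  "xc s i k = gen (DX s i (- k))"

definition psic :: "sign \<Rightarrow> 'i \<Rightarrow> int \<Rightarrow> ('i dr_gen, 'k::field_char_0) falg" where
  "psic s i k = (if sg s * k \<le> 0 then d_psi s i $ nat \<bar>k\<bar> else 0)"

definition lin2 :: "'a::ring \<Rightarrow> 'a \<Rightarrow> (int \<Rightarrow> int \<Rightarrow> 'a) \<Rightarrow> int \<Rightarrow> int \<Rightarrow> 'a" where
  "lin2 a b G k l = a * G (k - 1) l - b * G k (l - 1)"

text \<open>
  The structure function relating \<open>\<psi>\<^sub>i\<^sup>-(z) \<psi>\<^sub>j\<^sup>+(w)\<close> and \<open>\<psi>\<^sub>j\<^sup>+(w) \<psi>\<^sub>i\<^sup>-(z)\<close>, as a power series in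
  \<open>u = z/w\<close>. With \<open>a = \<langle>i,j\<rangle>\<close>, numerator and denominator divided by \<open>w\<^sup>2\<close> are
  \<open>(u - q\<^bsup>-a\<^esup>q\<^sup>c)(u - q\<^sup>aq\<^bsup>-c\<^esup>) = (1 - q\<^sup>aq\<^bsup>-c\<^esup>u)(1 - q\<^bsup>-a\<^esup>q\<^sup>cu)\<close> and
  \<open>(u - q\<^sup>aq\<^sup>c)(u - q\<^bsup>-a\<^esup>q\<^bsup>-c\<^esup>) = (1 - q\<^bsup>-a\<^esup>q\<^bsup>-c\<^esup>u)(1 - q\<^sup>aq\<^sup>cu)\<close>.
\<close>

definition d_struct :: "int \<Rightarrow> ('i dr_gen, 'k::field_char_0) falg fps" where
  "d_struct a =
     (1 - fps_const (scal (qq powi a) * d_c (-2)) * fps_X) *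
     (1 - fps_const (scal (qq powi (- a)) * d_c 2) * fps_X) *
     geom (scal (qq powi (- a)) * d_c (-2)) * geom (scal (qq powi a) * d_c 2)"

inductive drinfeld_rel ::
    "('i::finite \<Rightarrow> 'i \<Rightarrow> bool) \<Rightarrow>
     ('i dr_gen, 'k::field_char_0) falg \<Rightarrow> ('i dr_gen, 'k) falg \<Rightarrow> bool"
  for adj :: "'i::finite \<Rightarrow> 'i \<Rightarrow> bool"
where
  D1: "drinfeld_rel adj (gen (DC s) * gen g) (gen g * gen (DC s))"
| D2_zero: "drinfeld_rel adj (d_q (\<lambda>_. 0)) 1"
| D2_add: "drinfeld_rel adj (d_q h * d_q h') (d_q (\<lambda>j. h j + h' j))"
| D2_h: "m \<noteq> 0 \<Longrightarrow> drinfeld_rel adj (commutator (d_q h) (d_h i m)) 0"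
| D2_d: "drinfeld_rel adj (d_d Pos * d_d Neg) 1"
| D2_d': "drinfeld_rel adj (d_d Neg * d_d Pos) 1"
| D2_c: "drinfeld_rel adj (gen (DC Pos) * gen (DC Neg)) 1"
| D3: "drinfeld_rel adj (psic s i k * psic s j l) (psic s j l * psic s i k)"
  \<comment> \<open>coefficient of \<open>z\<^sup>k w\<^bsup>-l\<^esup>\<close>\<close>
| D4: "drinfeld_rel adj
         (d_psi Neg i $ k * d_psi Pos j $ l)
         (\<Sum>n\<le>min k l. d_struct (cartan adj i j) $ n * (d_psi Pos j $ (l - n) * d_psi Neg i $ (k - n)))"
| D5_q: "drinfeld_rel adj (commutator (d_d Pos) (d_q h)) 0"
| D5_h: "m \<noteq> 0 \<Longrightarrow> drinfeld_rel adj (d_d Pos * d_h i m * d_d Neg) (scal (qq powi m) * d_h i m)"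
| D5_e: "drinfeld_rel adj (d_d Pos * d_e i r * d_d Neg) (scal (qq powi r) * d_e i r)"
| D5_f: "drinfeld_rel adj (d_d Pos * d_f i r * d_d Neg) (scal (qq powi r) * d_f i r)"
  \<comment> \<open>\<open>t\<close> is the sign of \<open>\<psi>\<close>, \<open>s\<close> that of \<open>x\<close>\<close>
| D6: "drinfeld_rel adj
         (lin2 (d_c (sg s * sg t)) (scal (qq powi (sg s * cartan adj i j)))
            (\<lambda>k l. psic t j k * xc s i l) k l)
         (lin2 (scal (qq powi (sg s * cartan adj i j)) * d_c (sg s * sg t)) 1
            (\<lambda>k l. xc s i l * psic t j k) k l)"
  \<comment> \<open>coefficient of \<open>z\<^sup>k w\<^sup>l\<close>: \<open>\<delta>(q\<^sup>cw/z) \<psi>\<^sup>+(q\<^bsup>c/2\<^esup>w)\<close> contributes \<open>q\<^bsup>-kc\<^esup>\<close> times the coefficient of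
      \<open>w\<^bsup>k+l\<^esup>\<close> in \<open>\<psi>\<^sup>+(q\<^bsup>c/2\<^esup>w)\<close>, and \<open>\<delta>(q\<^sup>cz/w) \<psi>\<^sup>-(q\<^bsup>c/2\<^esup>z)\<close> contributes \<open>q\<^bsup>-lc\<^esup>\<close> times the coefficient of
      \<open>z\<^bsup>k+l\<^esup>\<close> in \<open>\<psi>\<^sup>-(q\<^bsup>c/2\<^esup>z)\<close>\<close>
| D7: "drinfeld_rel adj
         (commutator (xc Pos i k) (xc Neg j l))
         (if i = j then
            scal (1 / (qq - inverse qq)) *
              (d_c (-2 * k) * d_c (k + l) * psic Pos i (k + l)
               - d_c (-2 * l) * d_c (k + l) * psic Neg i (k + l))
          else 0)"
| D8: "drinfeld_rel adj
         (lin2 1 (scal (qq powi (2 * sg s))) (\<lambda>k l. xc s i k * xc s i l) k l)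
         (lin2 (scal (qq powi (2 * sg s))) 1 (\<lambda>k l. xc s i l * xc s i k) k l)"
| D9: "cartan adj i j = -1 \<Longrightarrow> drinfeld_rel adj
         (lin2 1 (scal (qq powi (- sg s))) (\<lambda>k l. xc s i k * xc s j l) k l)
         (lin2 (scal (qq powi (- sg s))) 1 (\<lambda>k l. xc s j l * xc s i k) k l)"
  \<comment> \<open>coefficient of \<open>z\<^sub>1\<^bsup>m 1\<^esup> \<dots> z\<^sub>N\<^bsup>m N\<^esup> w\<^sup>l\<close>\<close>
| D10: "cartan adj i j \<le> 0 \<Longrightarrow> N = nat (1 - cartan adj i j) \<Longrightarrow> drinfeld_rel adj
         (\<Sum>\<sigma> | \<sigma> permutes {1..N}. \<Sum>s\<le>N.
            scal ((-1) ^ s * qbinomial N s) *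
            (prod_list (map (\<lambda>p. xc t i (m (\<sigma> p))) [1..<Suc s]) * xc t j l *
             prod_list (map (\<lambda>p. xc t i (m (\<sigma> p))) [Suc s..<Suc N])))
         0"

section \<open>The vertex realization\<close>

datatype shape = Row | Col  \<comment> \<open>the partitions \<open>(n)\<close> and \<open>(1\<^sup>n)\<close>\<close>

datatype 'i v_gen =
    VE 'i int
  | VF 'i int
  | VK "'i coweight"
  | VD sign
  | VC sign  \<comment> \<open>\<open>q\<^bsup>c/2\<^esup>\<close> and \<open>q\<^bsup>-c/2\<^esup>\<close>\<close>
  | VP shape 'i nat
  | VQ shape 'i nat

abbreviation v_E :: "'i \<Rightarrow> int \<Rightarrow> ('i v_gen, 'k::field_char_0) falg" where
  "v_E i r \<equiv> gen (VE i r)"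

abbreviation v_F :: "'i \<Rightarrow> int \<Rightarrow> ('i v_gen, 'k::field_char_0) falg" where
  "v_F i r \<equiv> gen (VF i r)"

abbreviation v_q :: "'i coweight \<Rightarrow> ('i v_gen, 'k::field_char_0) falg" where
  "v_q h \<equiv> gen (VK h)"

abbreviation v_d :: "sign \<Rightarrow> ('i v_gen, 'k::field_char_0) falg" where
  "v_d s \<equiv> gen (VD s)"

abbreviation v_P :: "shape \<Rightarrow> 'i \<Rightarrow> nat \<Rightarrow> ('i v_gen, 'k::field_char_0) falg" where
  "v_P a i n \<equiv> gen (VP a i n)"

abbreviation v_Q :: "shape \<Rightarrow> 'i \<Rightarrow> nat \<Rightarrow> ('i v_gen, 'k::field_char_0) falg" where
  "v_Q a i n \<equiv> gen (VQ a i n)"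

definition v_c :: "int \<Rightarrow> ('i v_gen, 'k::field_char_0) falg" where
  \<comment> \<open>\<open>q\<^bsup>kc/2\<^esup>\<close>; in particular \<open>v_c 2\<close> is \<open>q\<^sup>c\<close>\<close>
  "v_c k = (if 0 \<le> k then gen (VC Pos) ^ nat k else gen (VC Neg) ^ nat (- k))"

definition v_Qb :: "'i \<Rightarrow> nat \<Rightarrow> ('i v_gen, 'k::field_char_0) falg" where
  \<comment> \<open>\<open>Q\<^sub>i\<^bsup>[1^n]\<^esup>\<close>, used for \<open>n \<ge> 1\<close>\<close>
  "v_Qb i n = (\<Sum>m\<le>n. scal ((- qq) ^ m * qint (int m)) * v_Q Col i (n - m) * v_Q Row i m)"

definition v_Pb :: "'i \<Rightarrow> nat \<Rightarrow> ('i v_gen, 'k::field_char_0) falg" where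
  \<comment> \<open>\<open>P\<^sub>i\<^bsup>[1^n]\<^esup>\<close>, used for \<open>n \<ge> 1\<close>\<close>
  "v_Pb i n = (\<Sum>m\<le>n. scal ((- qq) powi (- int m) * qint (int m)) * v_P Col i (n - m) * v_P Row i m)"

definition p_c :: "nat \<Rightarrow> ('i v_gen, 'k::field_char_0) falg" where
  \<comment> \<open>\<open>p\<^sub>n([c])\<close>\<close>
  "p_c n = scal (1 / (qq powi int n - qq powi (- int n))) * (v_c (2 * int n) - v_c (- 2 * int n))"

definition p_2c :: "nat \<Rightarrow> ('i v_gen, 'k::field_char_0) falg" where
  \<comment> \<open>\<open>p\<^sub>n([2][c])\<close>\<close>
  "p_2c n = scal (qq powi int n + qq powi (- int n)) * p_c n"

definition Sym_coeff ::
    "(nat \<Rightarrow> ('g, 'k::field_char_0) falg) \<Rightarrow> nat \<Rightarrow> ('g, 'k) falg" where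
  "Sym_coeff p k = fexp (pos_series (\<lambda>n. scal (inverse (of_nat n)) * p n)) $ k"

definition Ext_coeff ::
    "(nat \<Rightarrow> ('g, 'k::field_char_0) falg) \<Rightarrow> nat \<Rightarrow> ('g, 'k) falg" where
  "Ext_coeff p k = fexp (pos_series (\<lambda>n. scal ((-1) ^ (n - 1) * inverse (of_nat n)) * p n)) $ k"

text \<open>
  Pitfall: in \<open>V6_PE\<close> and \<open>V6_PF\<close> the right-hand sides are the negatives of the ones found in the
  literature source, which has
  \<open>q\<^sup>2E\<^bsub>i,b\<^esub>P\<^sub>i\<^bsup>[1^a]\<^esup> - q\<^bsup>-2\<^esup>P\<^sub>i\<^bsup>[1^a]\<^esup>E\<^bsub>i,b\<^esub>\<close> and \<open>q\<^bsup>-2\<^esup>F\<^bsub>i,b\<^esub>P\<^sub>i\<^bsup>[1^a]\<^esup> - q\<^sup>2P\<^sub>i\<^bsup>[1^a]\<^esup>F\<^bsub>i,b\<^esub>\<close>. With those signs the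
  other relations would force \<open>(q\<^sup>c - q\<^bsup>-c\<^esup>)E\<^bsub>i,b\<^esub> = 0\<close>: commute \<open>ad Q\<^sub>i\<^bsup>(1)\<^esup>\<close> with \<open>ad P\<^sub>i\<^bsup>(2)\<^esup>\<close> on \<open>E\<^bsub>i,b\<^esub>\<close>.
  The signs used here are those that the Drinfeld relations imply, and they agree with the pattern of
  \<open>V6_PE_adj\<close> and \<open>V6_PF_adj\<close>.
\<close>

inductive vertex_rel ::
    "('i::finite \<Rightarrow> 'i \<Rightarrow> bool) \<Rightarrow>
     ('i v_gen, 'k::field_char_0) falg \<Rightarrow> ('i v_gen, 'k) falg \<Rightarrow> bool"
  for adj :: "'i::finite \<Rightarrow> 'i \<Rightarrow> bool"
where
  V0_P: "vertex_rel adj (v_P a i 0) 1"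
| V0_Q: "vertex_rel adj (v_Q a i 0) 1"
| V0_P_inv: "vertex_rel adj
     ((Abs_fps (v_P Row i) * Abs_fps (\<lambda>n. (-1) ^ n * v_P Col i n)) $ n) ((1 :: _ fps) $ n)"
| V0_Q_inv: "vertex_rel adj
     ((Abs_fps (v_Q Row i) * Abs_fps (\<lambda>n. (-1) ^ n * v_Q Col i n)) $ n) ((1 :: _ fps) $ n)"
| V1: "vertex_rel adj (gen (VC s) * gen g) (gen g * gen (VC s))"
| V2_zero: "vertex_rel adj (v_q (\<lambda>_. 0)) 1"
| V2_add: "vertex_rel adj (v_q h * v_q h') (v_q (\<lambda>j. h j + h' j))"
| V2_P: "vertex_rel adj (v_q h * v_P a i n) (v_P a i n * v_q h)"
| V2_Q: "vertex_rel adj (v_q h * v_Q a i n) (v_Q a i n * v_q h)"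
| V2_d: "vertex_rel adj (v_d Pos * v_d Neg) 1"
| V2_d': "vertex_rel adj (v_d Neg * v_d Pos) 1"
| V2_c: "vertex_rel adj (gen (VC Pos) * gen (VC Neg)) 1"
| V2_E: "vertex_rel adj (v_q h * v_E i r * v_q (\<lambda>j. - h j)) (scal (qq powi eval_root adj h i) * v_E i r)"
| V2_F: "vertex_rel adj (v_q h * v_F i r * v_q (\<lambda>j. - h j)) (scal (qq powi (- eval_root adj h i)) * v_F i r)"
| V3_P: "vertex_rel adj (v_P a i m * v_P b j n) (v_P b j n * v_P a i m)"
| V3_Q: "vertex_rel adj (v_Q a i m * v_Q b j n) (v_Q b j n * v_Q a i m)"
  \<comment> \<open>terms with \<open>k > m\<close> or \<open>k > n\<close> vanish by the convention on negative indices\<close>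
| V4_same: "vertex_rel adj (v_Q a i n * v_P b i m)
     (\<Sum>k\<le>min m n. (if a = b then Sym_coeff p_2c k else Ext_coeff p_2c k) *
        v_P b i (m - k) * v_Q a i (n - k))"
| V4_adj: "cartan adj i j = -1 \<Longrightarrow> vertex_rel adj (v_Q a j n * v_P b i m)
     (\<Sum>k\<le>min m n. (-1) ^ k * (if a = b then Ext_coeff p_c k else Sym_coeff p_c k) *
        v_P b i (m - k) * v_Q a j (n - k))"
| V4_far: "cartan adj i j = 0 \<Longrightarrow> vertex_rel adj (v_Q a j n * v_P b i m) (v_P b i m * v_Q a j n)"
| V5_q: "vertex_rel adj (commutator (v_d Pos) (v_q h)) 0"
| V5_Q: "vertex_rel adj (v_d Pos * v_Q a i m * v_d Neg) (scal (qq powi int m) * v_Q a i m)"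
| V5_P: "vertex_rel adj (v_d Pos * v_P a i m * v_d Neg) (scal (qq powi (- int m)) * v_P a i m)"
| V5_E: "vertex_rel adj (v_d Pos * v_E i r * v_d Neg) (scal (qq powi r) * v_E i r)"
| V5_F: "vertex_rel adj (v_d Pos * v_F i r * v_d Neg) (scal (qq powi r) * v_F i r)"
| V6_QE: "a > 0 \<Longrightarrow> vertex_rel adj
     (v_c 2 * commutator (v_Qb i (a + 1)) (v_E i b))
     (scal (qq ^ 2) * v_Qb i a * v_E i (b + 1) - scal (qq powi (-2)) * v_E i (b + 1) * v_Qb i a)"
| V6_QF: "a > 0 \<Longrightarrow> vertex_rel adj
     (commutator (v_Qb i (a + 1)) (v_F i b))
     (scal (qq powi (-2)) * v_Qb i a * v_F i (b + 1) - scal (qq ^ 2) * v_F i (b + 1) * v_Qb i a)"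
| V6_PE: "a > 0 \<Longrightarrow> vertex_rel adj
     (commutator (v_Pb i (a + 1)) (v_E i (b + 1)))
     (scal (qq powi (-2)) * v_Pb i a * v_E i b - scal (qq ^ 2) * v_E i b * v_Pb i a)"
| V6_PF: "a > 0 \<Longrightarrow> vertex_rel adj
     (v_c (-2) * commutator (v_Pb i (a + 1)) (v_F i (b + 1)))
     (scal (qq ^ 2) * v_Pb i a * v_F i b - scal (qq powi (-2)) * v_F i b * v_Pb i a)"
| V6_QE1: "vertex_rel adj (v_c 2 * commutator (v_Qb i 1) (v_E i b)) (scal (qint 2) * v_E i (b + 1))"
| V6_QF1: "vertex_rel adj (commutator (v_Qb i 1) (v_F i b)) (- scal (qint 2) * v_F i (b + 1))"
| V6_PE1: "vertex_rel adj (commutator (v_Pb i 1) (v_E i (b + 1))) (scal (qint 2) * v_E i b)"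
| V6_PF1: "vertex_rel adj (v_c (-2) * commutator (v_Pb i 1) (v_F i (b + 1))) (- scal (qint 2) * v_F i b)"
| V6_QE_adj: "cartan adj i j = -1 \<Longrightarrow> a > 0 \<Longrightarrow> vertex_rel adj
     (v_c 2 * commutator (v_Qb j (a + 1)) (v_E i b))
     (- scal qq * v_E i (b + 1) * v_Qb j a + scal (inverse qq) * v_Qb j a * v_E i (b + 1))"
| V6_QF_adj: "cartan adj i j = -1 \<Longrightarrow> a > 0 \<Longrightarrow> vertex_rel adj
     (commutator (v_Qb j (a + 1)) (v_F i b))
     (- scal (inverse qq) * v_F i (b + 1) * v_Qb j a + scal qq * v_Qb j a * v_F i (b + 1))"
| V6_PE_adj: "cartan adj i j = -1 \<Longrightarrow> a > 0 \<Longrightarrow> vertex_rel adj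
     (commutator (v_Pb j (a + 1)) (v_E i (b + 1)))
     (- scal (inverse qq) * v_E i b * v_Pb j a + scal qq * v_Pb j a * v_E i b)"
| V6_PF_adj: "cartan adj i j = -1 \<Longrightarrow> a > 0 \<Longrightarrow> vertex_rel adj
     (v_c (-2) * commutator (v_Pb j (a + 1)) (v_F i (b + 1)))
     (- scal qq * v_F i b * v_Pb j a + scal (inverse qq) * v_Pb j a * v_F i b)"
| V6_QE1_adj: "cartan adj i j = -1 \<Longrightarrow> vertex_rel adj
     (v_c 2 * commutator (v_Qb j 1) (v_E i b)) (- v_E i (b + 1))"
| V6_QF1_adj: "cartan adj i j = -1 \<Longrightarrow> vertex_rel adj
     (commutator (v_Qb j 1) (v_F i b)) (v_F i (b + 1))"
| V6_PE1_adj: "cartan adj i j = -1 \<Longrightarrow> vertex_rel adj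
     (commutator (v_Pb j 1) (v_E i (b + 1))) (- v_E i b)"
| V6_PF1_adj: "cartan adj i j = -1 \<Longrightarrow> vertex_rel adj
     (v_c (-2) * commutator (v_Pb j 1) (v_F i (b + 1))) (v_F i b)"
| V6_QE_far: "cartan adj i j = 0 \<Longrightarrow> a > 0 \<Longrightarrow> vertex_rel adj (commutator (v_Qb j a) (v_E i b)) 0"
| V6_QF_far: "cartan adj i j = 0 \<Longrightarrow> a > 0 \<Longrightarrow> vertex_rel adj (commutator (v_Qb j a) (v_F i b)) 0"
| V6_PE_far: "cartan adj i j = 0 \<Longrightarrow> a > 0 \<Longrightarrow> vertex_rel adj (commutator (v_Pb j a) (v_E i b)) 0"
| V6_PF_far: "cartan adj i j = 0 \<Longrightarrow> a > 0 \<Longrightarrow> vertex_rel adj (commutator (v_Pb j a) (v_F i b)) 0"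
| V7_pos: "a + b > 0 \<Longrightarrow> vertex_rel adj
     (commutator (v_E i a) (v_F i b)) (v_c (2 * a) * v_q (coroot i) * v_Qb i (nat (a + b)))"
| V7_neg: "a + b < 0 \<Longrightarrow> vertex_rel adj
     (commutator (v_E i a) (v_F i b)) (v_c (2 * b) * v_q (\<lambda>j. - coroot i j) * v_Pb i (nat (- a - b)))"
| V7_zero: "a + b = 0 \<Longrightarrow> vertex_rel adj
     (commutator (v_E i a) (v_F i b))
     (scal (1 / (qq - inverse qq)) *
        (v_c (2 * a) * v_q (coroot i) - v_c (- 2 * a) * v_q (\<lambda>j. - coroot i j)))"
| V7_neq: "i \<noteq> j \<Longrightarrow> vertex_rel adj (commutator (v_E i a) (v_F j b)) 0"
| V8_E: "vertex_rel adj
     (v_E i m * v_E i (n - 1) + v_E i n * v_E i (m - 1))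
     (scal (qq ^ 2) * (v_E i (m - 1) * v_E i n + v_E i (n - 1) * v_E i m))"
| V8_F: "vertex_rel adj
     (v_F i (n - 1) * v_F i m + v_F i (m - 1) * v_F i n)
     (scal (qq ^ 2) * (v_F i n * v_F i (m - 1) + v_F i m * v_F i (n - 1)))"
| V9_E: "cartan adj i j = -1 \<Longrightarrow> vertex_rel adj
     (v_E i m * v_E j (n - 1) + v_E j n * v_E i (m - 1))
     (scal (inverse qq) * (v_E j (n - 1) * v_E i m + v_E i (m - 1) * v_E j n))"
| V9_F: "cartan adj i j = -1 \<Longrightarrow> vertex_rel adj
     (v_F i (m - 1) * v_F j n + v_F j (n - 1) * v_F i m)
     (scal (inverse qq) * (v_F j n * v_F i (m - 1) + v_F i m * v_F j (n - 1)))"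
| V9_E_far: "cartan adj i j = 0 \<Longrightarrow> vertex_rel adj (v_E i m * v_E j n) (v_E j n * v_E i m)"
| V9_F_far: "cartan adj i j = 0 \<Longrightarrow> vertex_rel adj (v_F i m * v_F j n) (v_F j n * v_F i m)"
| V10_E: "cartan adj i j = -1 \<Longrightarrow> vertex_rel adj
     (\<Sum>\<sigma> | \<sigma> permutes {1, 2 :: nat}.
        v_E j n * v_E i (m (\<sigma> 1)) * v_E i (m (\<sigma> 2)) + v_E i (m (\<sigma> 1)) * v_E i (m (\<sigma> 2)) * v_E j n)
     (\<Sum>\<sigma> | \<sigma> permutes {1, 2 :: nat}.
        scal (qint 2) * v_E i (m (\<sigma> 1)) * v_E j n * v_E i (m (\<sigma> 2)))"
| V10_F: "cartan adj i j = -1 \<Longrightarrow> vertex_rel adj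
     (\<Sum>\<sigma> | \<sigma> permutes {1, 2 :: nat}.
        v_F j n * v_F i (m (\<sigma> 1)) * v_F i (m (\<sigma> 2)) + v_F i (m (\<sigma> 1)) * v_F i (m (\<sigma> 2)) * v_F j n)
     (\<Sum>\<sigma> | \<sigma> permutes {1, 2 :: nat}.
        scal (qint 2) * v_F i (m (\<sigma> 1)) * v_F j n * v_F i (m (\<sigma> 2)))"

section \<open>The two algebras\<close>

abbreviation U_Dr ::
    "('i::finite \<Rightarrow> 'i \<Rightarrow> bool) \<Rightarrow> ('i dr_gen, 'k::field_char_0) falg set ring" where
  "U_Dr adj \<equiv> presented_algebra (drinfeld_rel adj)"

abbreviation U_v ::
    "('i::finite \<Rightarrow> 'i \<Rightarrow> bool) \<Rightarrow> ('i v_gen, 'k::field_char_0) falg set ring" where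
  "U_v adj \<equiv> presented_algebra (vertex_rel adj)"

abbreviation dcl ::
    "('i::finite \<Rightarrow> 'i \<Rightarrow> bool) \<Rightarrow>
     ('i dr_gen, 'k::field_char_0) falg \<Rightarrow> ('i dr_gen, 'k) falg set" where
  "dcl adj \<equiv> cls (drinfeld_rel adj)"

abbreviation vcl ::
    "('i::finite \<Rightarrow> 'i \<Rightarrow> bool) \<Rightarrow>
     ('i v_gen, 'k::field_char_0) falg \<Rightarrow> ('i v_gen, 'k) falg set" where
  "vcl adj \<equiv> cls (vertex_rel adj)"

text \<open>\<open>h_series t i\<close> is the series with coefficients \<open>h\<^bsub>i,tn\<^esub> / [n]\<close>, \<open>n \<ge> 1\<close>, for a sign \<open>t\<close>.\<close>

definition h_series :: "sign \<Rightarrow> 'i \<Rightarrow> ('i dr_gen, 'k::field_char_0) falg fps" where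
  "h_series t i = pos_series (\<lambda>n. scal (1 / qint (int n)) * d_h i (sg t * int n))"

text \<open>
  The scalar \<open>\<tau>\<close> with \<open>E\<^bsub>i,r\<^esub> = \<tau>\<^sup>r e\<^bsub>i,r\<^esub>\<close> and \<open>F\<^bsub>i,r\<^esub> = \<tau>\<^sup>r f\<^bsub>i,r\<^esub>\<close>, here raised to the power \<open>r\<close>.
  Pitfall: the literature source has \<open>\<tau> = q\<^bsup>-c/2\<^esup>\<close>, which is incompatible with its normalization of
  the other generators. Indeed \<open>Q\<^sub>i\<^bsup>[1]\<^esup> = -q Q\<^sub>i\<^bsup>(1)\<^esup> = -q h\<^bsub>i,1\<^esub>\<close> and the Drinfeld relations give
  \<open>[h\<^bsub>i,1\<^esub>, e\<^bsub>i,b\<^esub>] = [2] q\<^bsup>-c/2\<^esup> e\<^bsub>i,b+1\<^esub>\<close>, so the relation \<open>q\<^sup>c [Q\<^sub>i\<^bsup>[1]\<^esup>, E\<^bsub>i,b\<^esub>] = [2] E\<^bsub>i,b+1\<^esub>\<close> holds exactly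
  when \<open>\<tau> = -q q\<^bsup>c/2\<^esup>\<close>.
\<close>

definition d_tau :: "int \<Rightarrow> ('i dr_gen, 'k::field_char_0) falg" where
  "d_tau r = scal ((- qq) powi r) * d_c r"

end

theory Submission
  imports Defs
begin

text \<open>
  The two presentations are compared inside a single ring. Suppose that a \<open>\<bbbk>(q)\<close>-algebra contains images
  of the generators of both realizations, related by the identification of the theorem, and that in it the
  elementary relations hold: those among \<open>q\<^sup>h\<close>, \<open>q\<^sup>\<plusminus>\<^sup>d\<close>, \<open>q\<^sup>\<plusminus>\<^sup>c\<^sup>/\<^sup>2\<close>, and the commutativity of the two halves
  of the Heisenberg subalgebra. Then the remaining Drinfeld relations hold if and only if the remaining vertex
  relations hold (lemma \<open>drinfeld_iff_vertex\<close>), because both sets reduce to the same relations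
  between modes:

  \<^item> \<open>Q\<^sub>i\<^bsup>[1^n]\<^esup>\<close> and \<open>P\<^sub>i\<^bsup>[1^n]\<^esup>\<close> are, up to powers of \<open>-q\<close>, a factor \<open>\<plusminus>(q - q\<^sup>-\<^sup>1)\<close> and \<open>q\<^bsup>h_i\<^esup>\<close>, the Fourier
    modes of \<open>\<psi>\<^sub>i\<^sup>\<plusminus>\<close> (lemma \<open>Phi_vb\<close>). Hence the relations between Cartan and root currents, and those between
    opposite root currents, agree mode by mode; the rescaling of the currents by \<open>\<tau>\<^sup>r\<close> with
    \<open>\<tau> = -q q\<^sup>c\<^sup>/\<^sup>2\<close> absorbs the powers of \<open>-q\<close> and of the central charge.

  \<^item> The relation between \<open>\<psi>\<^sub>i\<^sup>-\<close> and \<open>\<psi>\<^sub>j\<^sup>+\<close>, and the relations between the \<open>Q\<close> and the \<open>P\<close>, are each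
    equivalent to the Heisenberg relation for the brackets of \<open>h\<^bsub>j,k\<^esub>\<close> and \<open>h\<^bsub>i,-l\<^esub>\<close>. This rests on lemma
    \<open>is_exp_heisenberg\<close>, which says that \<open>exp b(w) exp a(z) = exp c(zw) exp a(z) exp b(w)\<close> precisely when
    the bracket of \<open>b\<^sub>k\<close> and \<open>a\<^sub>l\<close> is \<open>\<delta>\<^sub>k\<^sub>l c\<^sub>k\<close>, for central \<open>c\<close>.

  \<^item> The relations among root currents of equal sign are homogeneous and agree after rescaling.

  Exponentials in noncommutative power series rings are handled through the equation \<open>\<theta>A = (\<theta>a) A\<close>, where
  \<open>\<theta> = z d/dz\<close>, which determines \<open>A = exp a\<close> uniquely.

  To apply this to the two algebras, each of them is embedded into a ring type, the product of all quotients
  of the free algebra. The embedding has to be unital, so it uses the counit at all components but one.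
  The identification and its inverse then map each ideal of relations into the other and are
  inverse to each other modulo these ideals.
\<close>

section \<open>Scalars\<close>

lemma of_nat_fract_poly:
  "(of_nat n :: 'k::field_char_0 poly fract) = Fract (of_nat n) 1"
  by (induction n) (simp_all add: Zero_fract_def One_fract_def add_ac)

lemma of_nat_fract_poly_eq_0_iff [simp]:
  "(of_nat n :: 'k::field_char_0 poly fract) = 0 \<longleftrightarrow> n = 0"
  by (simp add: of_nat_fract_poly Zero_fract_def eq_fract)

lemma qq_power: "qq ^ n = Fract ([:0, 1:] ^ n) (1 :: 'k::field_char_0 poly)"
  by (induction n) (simp_all add: qq_def One_fract_def)

lemma qq_nonzero [simp]: "(qq :: 'k::field_char_0 poly fract) \<noteq> 0"
  by (simp add: qq_def Zero_fract_def eq_fract)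

lemma qq_power_neq_1: "n > 0 \<Longrightarrow> (qq ^ n :: 'k::field_char_0 poly fract) \<noteq> 1"
proof
  assume n: "n > 0" and "(qq ^ n :: 'k poly fract) = 1"
  then have "([:0, 1:] :: 'k poly) ^ n = 1"
    by (simp add: qq_power One_fract_def eq_fract)
  then have "degree (([:0, 1:] :: 'k poly) ^ n) = degree (1 :: 'k poly)" by simp
  with n show False by (simp add: degree_power_eq)
qed

lemma qq_powi_eq_1_iff [simp]: "(qq powi n :: 'k::field_char_0 poly fract) = 1 \<longleftrightarrow> n = 0"
proof (cases "n \<ge> 0")
  case True
  then obtain m where "n = int m" using nonneg_eq_int by blast
  then show ?thesis using qq_power_neq_1[of m] by (cases "m = 0") auto
next
  case False
  define m where "m = nat (- n)"
  with False have "n = - int m" "m > 0" by simp_all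
  then show ?thesis using qq_power_neq_1[of m] by (simp add: power_int_minus)
qed

lemma qq_powi_sub_neq_0 [simp]:
  "n \<noteq> 0 \<Longrightarrow> (qq powi n - qq powi (- n) :: 'k::field_char_0 poly fract) \<noteq> 0"
proof
  assume "n \<noteq> 0" "(qq powi n - qq powi (- n) :: 'k poly fract) = 0"
  then have "(qq powi n :: 'k poly fract) * qq powi n = qq powi n * qq powi (- n)" by simp
  then have "(qq powi (n + n) :: 'k poly fract) = 1"
    by (simp only: power_int_add[symmetric] qq_nonzero simp_thms) (simp add: power_int_minus)
  with \<open>n \<noteq> 0\<close> show False by simp
qed

lemma qq_sub_inverse_neq_0 [simp]: "(qq - inverse qq :: 'k::field_char_0 poly fract) \<noteq> 0"
  using qq_powi_sub_neq_0[of 1, where ?'k='k] by (simp add: power_int_minus)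

lemma qint_neq_0 [simp]: "n \<noteq> 0 \<Longrightarrow> (qint n :: 'k::field_char_0 poly fract) \<noteq> 0"
  unfolding qint_def using qq_powi_sub_neq_0[of n, where ?'k='k] qq_sub_inverse_neq_0[where ?'k='k]
  by (simp del: qq_powi_sub_neq_0 qq_sub_inverse_neq_0)

lemma qint_0 [simp]: "qint 0 = 0"
  by (simp add: qint_def)

lemma qint_1 [simp]: "qint 1 = (1 :: 'k::field_char_0 poly fract)"
  using qq_sub_inverse_neq_0[where ?'k='k] by (simp add: qint_def power_int_minus)

lemma qint_minus: "qint (- n) = - qint n"
  by (simp add: qint_def minus_divide_left)

section \<open>Ring homomorphisms and free algebras\<close>

text \<open>Free algebras, their quotients and the rings below are all instances of \<open>ring_1\<close>; homomorphisms between
  them are assumed to preserve the unit.\<close>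

locale unital_hom =
  fixes f :: "'a::ring_1 \<Rightarrow> 'b::ring_1"
  assumes hom_add: "f (x + y) = f x + f y"
    and hom_mult: "f (x * y) = f x * f y"
    and hom_one: "f 1 = 1"
begin

lemma hom_zero: "f 0 = 0"
  using hom_add[of 0 0] by simp

lemma hom_minus: "f (- x) = - f x"
proof -
  have "f (- x) + f x = 0" by (simp add: hom_add[symmetric] hom_zero)
  then show ?thesis by (simp add: eq_neg_iff_add_eq_0)
qed

lemma hom_diff: "f (x - y) = f x - f y"
  using hom_add[of x "- y"] by (simp add: hom_minus)

lemma hom_sum: "f (sum g A) = (\<Sum>x\<in>A. f (g x))"
  by (induction A rule: infinite_finite_induct) (simp_all add: hom_zero hom_add)

lemma hom_power: "f (x ^ n) = f x ^ n"
  by (induction n) (simp_all add: hom_one hom_mult)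

lemma hom_prod_list: "f (prod_list xs) = prod_list (map f xs)"
  by (induction xs) (simp_all add: hom_one hom_mult)

lemma hom_commutator: "f (commutator x y) = commutator (f x) (f y)"
  by (simp add: commutator_def hom_diff hom_mult)

text \<open>The coefficientwise action on power series.\<close>

definition hom_fps :: "'a fps \<Rightarrow> 'b fps" where
  "hom_fps F = Abs_fps (\<lambda>n. f (F $ n))"

lemma hom_fps_nth [simp]: "hom_fps F $ n = f (F $ n)"
  by (simp add: hom_fps_def)

lemma hom_fps_mult: "hom_fps (F * G) = hom_fps F * hom_fps G"
  by (simp add: fps_eq_iff fps_mult_nth hom_sum hom_mult)

lemma hom_fps_factor: "hom_fps (1 - fps_const x * fps_X) = 1 - fps_const (f x) * fps_X"
  by (simp add: fps_eq_iff hom_diff hom_one hom_zero fps_X_def if_distrib[of f] cong: if_cong)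

lemma hom_fps_geom: "hom_fps (geom x) = geom (f x)"
  by (simp add: geom_def fps_eq_iff hom_power)

lemmas hom_simps = hom_add hom_mult hom_one hom_zero hom_minus hom_diff hom_sum hom_power
  hom_prod_list hom_commutator

end

lemma unital_hom_comp: "unital_hom f \<Longrightarrow> unital_hom g \<Longrightarrow> unital_hom (\<lambda>x. f (g x))"
  unfolding unital_hom_def by simp

lemma letters_zero [simp]: "letters 0 = []" and letters_plus [simp]: "letters (u + v) = letters u @ letters v"
  by (simp_all add: zero_fword_def plus_fword_def)

lemma scal_add: "scal (a + b) = scal a + scal b"
  and scal_mult: "scal (a * b) = scal a * scal b"
  and scal_1 [simp]: "scal 1 = 1"
  and scal_0 [simp]: "scal 0 = 0"
  by (simp_all add: scal_def single_add mult_single)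

lemma unital_hom_scal: "unital_hom scal"
  by standard (simp_all add: scal_add scal_mult)

lemma scal_lookup_single: "scal a * Poly_Mapping.single w b = Poly_Mapping.single w (a * b)"
  "Poly_Mapping.single w b * scal a = Poly_Mapping.single w (b * a)"
  by (simp_all add: scal_def mult_single)

lemma falg_induct [case_names scal gen add mult]:
  fixes x :: "('g, 'k::field_char_0) falg"
  assumes scal: "\<And>a. P (scal a)" and gen: "\<And>g. P (gen g)"
    and add: "\<And>x y. P x \<Longrightarrow> P y \<Longrightarrow> P (x + y)"
    and mult: "\<And>x y. P x \<Longrightarrow> P y \<Longrightarrow> P (x * y)"
  shows "P x"
proof -
  have word: "P (Poly_Mapping.single (FWord gs) 1)" for gs
  proof (induction gs)
    case Nil
    show ?case using scal[of 1] by (simp add: scal_def zero_fword_def)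
  next
    case (Cons g gs)
    have "gen g * Poly_Mapping.single (FWord gs) 1 = Poly_Mapping.single (FWord (g # gs)) (1 :: 'k poly fract)"
      by (simp add: gen_def mult_single plus_fword_def)
    then show ?case using mult[OF gen Cons, of g] by simp
  qed
  show ?thesis
  proof (induction x rule: update_induct)
    case const
    then show ?case using scal[of 0] by simp
  next
    case (update x k v)
    have "Poly_Mapping.update k v x = x + Poly_Mapping.single k v"
      by (rule poly_mapping_eqI)
        (use update(1) in \<open>auto simp: lookup_update lookup_add lookup_single in_keys_iff when_def\<close>)
    moreover have "P (Poly_Mapping.single k v)"
      using mult[OF scal[of v] word[of "letters k"]] by (simp add: scal_lookup_single)
    ultimately show ?case using add update by simp
  qed
qed

lemma scal_central: "scal a * x = x * scal (a :: 'k::field_char_0 poly fract)"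
proof (induction x rule: falg_induct)
  case (scal b)
  then show ?case by (simp flip: scal_mult add: mult.commute)
next
  case (gen g)
  then show ?case by (simp add: gen_def scal_lookup_single)
next
  case (add x y)
  then show ?case by (simp add: algebra_simps)
next
  case (mult x y)
  then show ?case by (metis mult.assoc)
qed

lemma unital_hom_eqI:
  fixes f g :: "('g, 'k::field_char_0) falg \<Rightarrow> 'r::ring_1"
  assumes "unital_hom f" "unital_hom g"
    and "\<And>a. f (scal a) = g (scal a)" "\<And>l. f (gen l) = g (gen l)"
  shows "f x = g x"
proof -
  interpret f: unital_hom f by fact
  interpret g: unital_hom g by fact
  show ?thesis
    by (induction x rule: falg_induct) (simp_all add: assms f.hom_simps g.hom_simps)
qed

text \<open>The homomorphism out of the free algebra determined by a structure map \<open>s\<close> on scalars and the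
  images \<open>v\<close> of the generators.\<close>

definition falg_eval ::
    "('k::field_char_0 poly fract \<Rightarrow> 'r::ring_1) \<Rightarrow> ('g \<Rightarrow> 'r) \<Rightarrow> ('g, 'k) falg \<Rightarrow> 'r" where
  "falg_eval s v x = (\<Sum>w\<in>Poly_Mapping.keys x. s (Poly_Mapping.lookup x w) * prod_list (map v (letters w)))"

context
  fixes s :: "'k::field_char_0 poly fract \<Rightarrow> 'r::ring_1" and v :: "'g \<Rightarrow> 'r"
  assumes s: "unital_hom s" and s_central: "\<And>a y. s a * y = y * s a"
begin

interpretation s: unital_hom s by (fact s)

lemma falg_eval_superset:
  "finite A \<Longrightarrow> Poly_Mapping.keys x \<subseteq> A \<Longrightarrow>
    falg_eval s v x = (\<Sum>w\<in>A. s (Poly_Mapping.lookup x w) * prod_list (map v (letters w)))"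
  unfolding falg_eval_def
  by (rule sum.mono_neutral_left) (auto simp: in_keys_iff s.hom_zero)

lemma falg_eval_add: "falg_eval s v (x + y) = falg_eval s v x + falg_eval s v y"
  using Poly_Mapping.keys_add[of x y]
  by (simp add: falg_eval_superset[of "Poly_Mapping.keys x \<union> Poly_Mapping.keys y"] lookup_add s.hom_add distrib_right
      sum.distrib)

lemma falg_eval_single: "falg_eval s v (Poly_Mapping.single w a) = s a * prod_list (map v (letters w))"
  by (simp add: falg_eval_def s.hom_zero)

lemma falg_eval_scal: "falg_eval s v (scal a) = s a"
  by (simp add: scal_def falg_eval_single)

lemma falg_eval_gen: "falg_eval s v (gen g) = v g"
  by (simp add: gen_def falg_eval_single s.hom_one)

lemma falg_eval_zero: "falg_eval s v 0 = 0"
  by (simp add: falg_eval_def)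

lemma single_decomp:
  fixes x :: "('g, 'k) falg"
  shows "P 0 \<Longrightarrow> (\<And>w a y. P y \<Longrightarrow> P (y + Poly_Mapping.single w a)) \<Longrightarrow> P x"
proof (induction x rule: update_induct)
  case const
  then show ?case by simp
next
  case (update x k u)
  have "Poly_Mapping.update k u x = x + Poly_Mapping.single k u"
    by (rule poly_mapping_eqI)
      (use update(1) in \<open>auto simp: lookup_update lookup_add lookup_single in_keys_iff when_def\<close>)
  then show ?case using update by simp
qed

lemma falg_eval_mult_single:
  "falg_eval s v (Poly_Mapping.single w a * y) =
    falg_eval s v (Poly_Mapping.single w a) * falg_eval s v y"
proof (induction y rule: single_decomp)
  case 1
  then show ?case by (simp add: falg_eval_zero)
next
  case (2 w' b y)
  have "s a * (s b * (prod_list (map v (letters w)) * prod_list (map v (letters w')))) =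
      s a * (prod_list (map v (letters w)) * (s b * prod_list (map v (letters w'))))"
    by (metis mult.assoc s_central)
  then show ?case
    by (simp add: 2 distrib_left falg_eval_add mult_single falg_eval_single s.hom_mult mult.assoc)
qed

lemma unital_hom_falg_eval: "unital_hom (falg_eval s v)"
proof
  show "falg_eval s v (x * y) = falg_eval s v x * falg_eval s v y" for x y
    by (induction x rule: single_decomp)
      (simp_all add: falg_eval_zero distrib_right falg_eval_add falg_eval_mult_single)
  show "falg_eval s v 1 = 1"
    using falg_eval_scal[of 1] by (simp add: s.hom_one)
qed (rule falg_eval_add)

end

section \<open>Ideals and presented algebras\<close>

text \<open>Two-sided ideals of a ring type; on a free algebra they are the ideals of its carrier-based version.\<close>

definition two_sided :: "'a::ring_1 set \<Rightarrow> bool" where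
  "two_sided J \<longleftrightarrow> 0 \<in> J \<and> (\<forall>x\<in>J. \<forall>y\<in>J. x + y \<in> J) \<and> (\<forall>x\<in>J. \<forall>a. a * x \<in> J \<and> x * a \<in> J)"

lemma two_sidedD:
  assumes "two_sided J"
  shows "0 \<in> J" "x \<in> J \<Longrightarrow> y \<in> J \<Longrightarrow> x + y \<in> J" "x \<in> J \<Longrightarrow> a * x \<in> J" "x \<in> J \<Longrightarrow> x * a \<in> J"
    "x \<in> J \<Longrightarrow> - x \<in> J" "x \<in> J \<Longrightarrow> y \<in> J \<Longrightarrow> x - y \<in> J"
proof -
  show *: "0 \<in> J" "x \<in> J \<Longrightarrow> y \<in> J \<Longrightarrow> x + y \<in> J" "x \<in> J \<Longrightarrow> a * x \<in> J" "x \<in> J \<Longrightarrow> x * a \<in> J"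
      for x y a using assms by (auto simp: two_sided_def)
  show m: "x \<in> J \<Longrightarrow> - x \<in> J" for x using *(3)[of x "-1"] by simp
  show "x \<in> J \<Longrightarrow> y \<in> J \<Longrightarrow> x - y \<in> J" using *(2)[of x "-y"] m by simp
qed

lemma falg_ring_simps [simp]:
  "carrier falg_ring = UNIV" "mult falg_ring = (*)" "one falg_ring = 1"
  "zero falg_ring = 0" "add falg_ring = (+)"
  by (simp_all add: falg_ring_def)

lemma ring_falg_ring: "ring (falg_ring :: ('g, 'k::field_char_0) falg ring)"
proof (rule ringI)
  show "abelian_group (falg_ring :: ('g, 'k) falg ring)"
    by (rule abelian_groupI) (auto simp: add.assoc add.commute intro: exI[of _ "- _"] ab_left_minus)
qed (auto intro!: monoid.intro simp: algebra_simps)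

lemma ideal_iff_two_sided: "ideal J falg_ring \<longleftrightarrow> two_sided J"
proof
  assume "ideal J falg_ring"
  then interpret ideal J falg_ring .
  show "two_sided J" unfolding two_sided_def
    using a_closed I_l_closed I_r_closed additive_subgroup.zero_closed[OF is_additive_subgroup]
      additive_subgroup.a_closed[OF is_additive_subgroup] by auto
next
  assume J: "two_sided J"
  show "ideal J falg_ring"
  proof (rule idealI[OF ring_falg_ring])
    show "subgroup J (add_monoid falg_ring)"
    proof
      fix x assume x: "x \<in> J"
      interpret ring "falg_ring :: ('a, 'b) falg ring" by (rule ring_falg_ring)
      have "\<ominus>\<^bsub>falg_ring\<^esub> x = - x"
        using minus_equality[of "- x" x] by simp
      then show "inv\<^bsub>add_monoid falg_ring\<^esub> x \<in> J"
        using two_sidedD(5)[OF J x] by (simp add: a_inv_def)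
    qed (use two_sidedD[OF J] in auto)
  qed (use two_sidedD[OF J] in auto)
qed

lemma two_sided_rel_ideal: "two_sided (rel_ideal R)"
  unfolding rel_ideal_def ideal_iff_two_sided[symmetric]
  by (rule ring.genideal_ideal[OF ring_falg_ring]) simp

lemma rel_in_rel_ideal: "R l r \<Longrightarrow> l - r \<in> rel_ideal R"
  unfolding rel_ideal_def
  using ring.genideal_self[OF ring_falg_ring, of "{l - r | l r. R l r}"] by auto

lemma rel_ideal_minimal:
  assumes "two_sided J" "\<And>l r. R l r \<Longrightarrow> l - r \<in> J"
  shows "rel_ideal R \<subseteq> J"
  unfolding rel_ideal_def
  by (rule ring.genideal_minimal[OF ring_falg_ring]) (use assms in \<open>auto simp: ideal_iff_two_sided\<close>)

lemma two_sided_kernel: "unital_hom f \<Longrightarrow> two_sided {x. f x = 0}"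
  by (auto simp: two_sided_def unital_hom.hom_simps)

lemma rel_ideal_kernel:
  assumes "unital_hom f" "\<And>l r. R l r \<Longrightarrow> f l = f r" "x \<in> rel_ideal R"
  shows "f x = 0"
  using rel_ideal_minimal[OF two_sided_kernel[OF assms(1)], of R] assms
  by (auto simp: unital_hom.hom_diff)

lemma commutes_mod_rel_ideal:
  assumes "\<And>g. x * gen g - gen g * x \<in> rel_ideal R"
  shows "x * y - y * x \<in> rel_ideal R"
proof (induction y rule: falg_induct)
  case (scal a)
  then show ?case by (simp add: scal_central two_sidedD(1)[OF two_sided_rel_ideal])
next
  case (gen g)
  then show ?case by (rule assms)
next
  case (add y z)
  from two_sidedD(2)[OF two_sided_rel_ideal this] show ?case by (simp add: algebra_simps)
next
  case (mult y z)
  from two_sidedD(2)[OF two_sided_rel_ideal two_sidedD(4)[OF two_sided_rel_ideal mult(1), of z]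
      two_sidedD(3)[OF two_sided_rel_ideal mult(2), of y]]
  show ?case by (simp add: algebra_simps)
qed

lemma cls_eq_iff: "cls R x = cls R y \<longleftrightarrow> x - y \<in> rel_ideal R"
proof -
  note I = two_sidedD[OF two_sided_rel_ideal[of R]]
  have mem: "z \<in> cls R x \<longleftrightarrow> z - x \<in> rel_ideal R" for z x
    by (auto simp: cls_def a_r_coset_def r_coset_def) (metis diff_add_cancel)
  show ?thesis
  proof
    assume "cls R x = cls R y"
    then show "x - y \<in> rel_ideal R" using mem[of x x] mem[of x y] I(1) by simp
  next
    assume a: "x - y \<in> rel_ideal R"
    have "z - x \<in> rel_ideal R \<longleftrightarrow> z - y \<in> rel_ideal R" for z
      using I(2)[OF _ a, of "z - x"] I(6)[OF _ a, of "z - y"] by auto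
    then show "cls R x = cls R y" using mem by blast
  qed
qed

lemma ideal_rel_ideal: "ideal (rel_ideal R) falg_ring"
  by (simp add: ideal_iff_two_sided two_sided_rel_ideal)

lemma carrier_presented: "carrier (presented_algebra R) = range (cls R)"
  by (auto simp: presented_algebra_def FactRing_def A_RCOSETS_defs cls_def a_r_coset_def)

lemma presented_mult: "cls R x \<otimes>\<^bsub>presented_algebra R\<^esub> cls R y = cls R (x * y)"
  using ring_hom_mult[OF ideal.rcos_ring_hom[OF ideal_rel_ideal[of R]], of x y]
  by (simp add: presented_algebra_def cls_def)

lemma presented_add: "cls R x \<oplus>\<^bsub>presented_algebra R\<^esub> cls R y = cls R (x + y)"
  using ring_hom_add[OF ideal.rcos_ring_hom[OF ideal_rel_ideal[of R]], of x y]
  by (simp add: presented_algebra_def cls_def)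

lemma presented_one: "\<one>\<^bsub>presented_algebra R\<^esub> = cls R 1"
  using ring_hom_one[OF ideal.rcos_ring_hom[OF ideal_rel_ideal[of R]]]
  by (simp add: presented_algebra_def cls_def)

text \<open>A homomorphism of free algebras induces an isomorphism of presented algebras if it reflects and preserves
  the ideals of relations and is onto modulo the target ideal.\<close>

lemma presented_iso:
  fixes R :: "('g, 'k::field_char_0) falg \<Rightarrow> ('g, 'k) falg \<Rightarrow> bool"
    and S :: "('h, 'k) falg \<Rightarrow> ('h, 'k) falg \<Rightarrow> bool"
  assumes f: "unital_hom f"
    and ker: "\<And>x. f x \<in> rel_ideal S \<longleftrightarrow> x \<in> rel_ideal R"
    and surj: "\<And>y. \<exists>x. y - f x \<in> rel_ideal S"
  shows "\<exists>\<phi> \<in> ring_iso (presented_algebra R) (presented_algebra S). \<forall>x. \<phi> (cls R x) = cls S (f x)"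
proof -
  interpret f: unital_hom f by fact
  define \<phi> where "\<phi> X = cls S (f (SOME x. cls R x = X))" for X
  have \<phi>: "\<phi> (cls R x) = cls S (f x)" for x
  proof -
    have "cls R (SOME x'. cls R x' = cls R x) = cls R x" by (rule someI) simp
    then show ?thesis by (simp add: \<phi>_def cls_eq_iff ker flip: f.hom_diff)
  qed
  have "\<phi> \<in> ring_hom (presented_algebra R) (presented_algebra S)"
    by (rule ring_hom_memI)
      (auto simp: carrier_presented \<phi> presented_mult presented_add presented_one f.hom_simps)
  moreover have "inj_on \<phi> (range (cls R))"
  proof (rule inj_onI)
    fix X Y assume "X \<in> range (cls R)" "Y \<in> range (cls R)" "\<phi> X = \<phi> Y"
    then obtain x y where xy: "X = cls R x" "Y = cls R y" by blast
    with \<open>\<phi> X = \<phi> Y\<close> have "f x - f y \<in> rel_ideal S" by (simp add: \<phi> cls_eq_iff)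
    then have "x - y \<in> rel_ideal R" using ker[of "x - y"] by (simp add: f.hom_diff)
    then show "X = Y" using xy by (simp add: cls_eq_iff)
  qed
  moreover have "\<phi> ` range (cls R) = range (cls S)"
    using surj by (auto simp: \<phi> image_iff cls_eq_iff)
  ultimately show ?thesis
    using \<phi> by (auto simp: ring_iso_def bij_betw_def carrier_presented)
qed

section \<open>A ring type containing all quotients of a ring\<close>

text \<open>The product of all quotients \<open>R / J\<close> of a ring \<open>R\<close> by its two-sided ideals \<open>J\<close> is again a ring type, so
  computations in any one quotient can be done with type-class algebra.\<close>

lemma equivp_quotient_family:
  "equivp (\<lambda>(f :: 'a::ring_1 set \<Rightarrow> 'a) g. \<forall>J. two_sided J \<longrightarrow> f J - g J \<in> J)"
proof (rule equivpI)
  show "symp (\<lambda>(f :: 'a set \<Rightarrow> 'a) g. \<forall>J. two_sided J \<longrightarrow> f J - g J \<in> J)"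
    by (rule sympI) (metis minus_diff_eq two_sidedD(5))
  show "transp (\<lambda>(f :: 'a set \<Rightarrow> 'a) g. \<forall>J. two_sided J \<longrightarrow> f J - g J \<in> J)"
  proof (rule transpI, intro allI impI)
    fix f g h :: "'a set \<Rightarrow> 'a" and J :: "'a set"
    assume "\<forall>J. two_sided J \<longrightarrow> f J - g J \<in> J" "\<forall>J. two_sided J \<longrightarrow> g J - h J \<in> J" "two_sided J"
    then show "f J - h J \<in> J" using two_sidedD(2)[of J "f J - g J" "g J - h J"] by simp
  qed
qed (auto intro!: reflpI simp: two_sidedD(1))

quotient_type (overloaded) 'a quots = "'a::ring_1 set \<Rightarrow> 'a" /
  "\<lambda>f g. \<forall>J. two_sided J \<longrightarrow> f J - g J \<in> J"
  by (rule equivp_quotient_family)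

instantiation quots :: (ring_1) ring_1
begin

lift_definition zero_quots :: "'a quots" is "\<lambda>_. 0" .
lift_definition one_quots :: "'a quots" is "\<lambda>_. 1" .
lift_definition plus_quots :: "'a quots \<Rightarrow> 'a quots \<Rightarrow> 'a quots" is "\<lambda>f g J. f J + g J"
proof -
  fix f f' g g' :: "'a set \<Rightarrow> 'a" and J :: "'a set"
  assume "\<And>J. two_sided J \<Longrightarrow> f J - f' J \<in> J" "\<And>J. two_sided J \<Longrightarrow> g J - g' J \<in> J" "two_sided J"
  then show "f J + g J - (f' J + g' J) \<in> J"
    using two_sidedD(2)[of J "f J - f' J" "g J - g' J"] by (simp add: algebra_simps)
qed
lift_definition minus_quots :: "'a quots \<Rightarrow> 'a quots \<Rightarrow> 'a quots" is "\<lambda>f g J. f J - g J"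
proof -
  fix f f' g g' :: "'a set \<Rightarrow> 'a" and J :: "'a set"
  assume "\<And>J. two_sided J \<Longrightarrow> f J - f' J \<in> J" "\<And>J. two_sided J \<Longrightarrow> g J - g' J \<in> J" "two_sided J"
  then show "f J - g J - (f' J - g' J) \<in> J"
    using two_sidedD(6)[of J "f J - f' J" "g J - g' J"] by (simp add: algebra_simps)
qed
lift_definition uminus_quots :: "'a quots \<Rightarrow> 'a quots" is "\<lambda>f J. - f J"
proof -
  fix f g :: "'a set \<Rightarrow> 'a" and J :: "'a set"
  assume "\<And>J. two_sided J \<Longrightarrow> f J - g J \<in> J" "two_sided J"
  then show "- f J - - g J \<in> J"
    using two_sidedD(5)[of J "f J - g J"] by simp
qed
lift_definition times_quots :: "'a quots \<Rightarrow> 'a quots \<Rightarrow> 'a quots" is "\<lambda>f g J. f J * g J"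
proof -
  fix f f' g g' :: "'a set \<Rightarrow> 'a" and J :: "'a set"
  assume a: "\<And>J. two_sided J \<Longrightarrow> f J - f' J \<in> J" "\<And>J. two_sided J \<Longrightarrow> g J - g' J \<in> J" "two_sided J"
  have "f J * g J - f' J * g' J = (f J - f' J) * g J + f' J * (g J - g' J)"
    by (simp add: algebra_simps)
  then show "f J * g J - f' J * g' J \<in> J"
    using two_sidedD(2)[OF a(3) two_sidedD(4)[OF a(3) a(1)[OF a(3)], of "g J"]
        two_sidedD(3)[OF a(3) a(2)[OF a(3)], of "f' J"]] by simp
qed

instance
proof
  show "(0 :: 'a quots) \<noteq> 1"
    by transfer (auto intro!: exI[of _ "{0}"] simp: two_sided_def)
  fix a b c :: "'a quots"
  show "a * b * c = a * (b * c)" by transfer (simp add: two_sidedD(1) mult.assoc)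
  show "1 * a = a" by transfer (simp add: two_sidedD(1))
  show "a * 1 = a" by transfer (simp add: two_sidedD(1))
  show "a + b + c = a + (b + c)" by transfer (simp add: two_sidedD(1) add.assoc)
  show "a + b = b + a" by transfer (simp add: two_sidedD(1) add.commute)
  show "0 + a = a" by transfer (simp add: two_sidedD(1))
  show "- a + a = 0" by transfer (simp add: two_sidedD(1))
  show "a - b = a + - b" by transfer (simp add: two_sidedD(1))
  show "(a + b) * c = a * c + b * c" by transfer (simp add: two_sidedD(1) distrib_right)
  show "a * (b + c) = a * b + a * c" by transfer (simp add: two_sidedD(1) distrib_left)
qed

end

text \<open>The quotient by \<open>I\<close> embeds unitally only if the other components receive a homomorphism as well;
  they receive \<open>e\<close>, in the applications an endomorphism killing the generators of \<open>I\<close>.\<close>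

definition to_quots :: "'a set \<Rightarrow> ('a \<Rightarrow> 'a) \<Rightarrow> 'a::ring_1 \<Rightarrow> 'a quots" where
  "to_quots I e x = abs_quots (\<lambda>J. if J = I then x else e x)"

lemma abs_quots_eqI: "(\<And>J. f J = g J) \<Longrightarrow> abs_quots f = abs_quots g"
  by presburger

lemma unital_hom_to_quots:
  assumes "unital_hom e"
  shows "unital_hom (to_quots I e)"
proof -
  interpret unital_hom e by fact
  show ?thesis
  proof
    show "to_quots I e (x + y) = to_quots I e x + to_quots I e y" for x y
      unfolding to_quots_def plus_quots.abs_eq by (rule abs_quots_eqI) (simp add: hom_add)
    show "to_quots I e (x * y) = to_quots I e x * to_quots I e y" for x y
      unfolding to_quots_def times_quots.abs_eq by (rule abs_quots_eqI) (simp add: hom_mult)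
    show "to_quots I e 1 = 1"
      unfolding to_quots_def one_quots_def by (rule abs_quots_eqI) (simp add: hom_one)
  qed
qed

lemma to_quots_eq_0_D: "two_sided I \<Longrightarrow> to_quots I e x = 0 \<Longrightarrow> x \<in> I"
  unfolding to_quots_def zero_quots_def quots.abs_eq_iff by (drule spec[of _ I]) simp

lemma to_quots_eqI: "x - y \<in> I \<Longrightarrow> e x = e y \<Longrightarrow> to_quots I e x = to_quots I e y"
  unfolding to_quots_def quots.abs_eq_iff by (simp add: two_sidedD(1))

lemma to_quots_central:
  assumes "\<And>y. x * y - y * x \<in> I" "\<And>y. e x * y = y * e x"
  shows "to_quots I e x * z = z * to_quots I e x"
proof -
  obtain f where z: "z = abs_quots f" by (induction z) simp
  show ?thesis
    unfolding to_quots_def z times_quots.abs_eq quots.abs_eq_iff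
    using assms by (simp add: two_sidedD(1))
qed

section \<open>Exponentials in noncommutative power series rings\<close>

text \<open>The Euler derivation \<open>z d/dz\<close>.\<close>

definition theta :: "'a::ring_1 fps \<Rightarrow> 'a fps" where
  "theta F = Abs_fps (\<lambda>n. of_nat n * F $ n)"

lemma theta_nth [simp]: "theta F $ n = of_nat n * F $ n"
  by (simp add: theta_def)

lemma theta_simps:
  "theta (F + G) = theta F + theta G" "theta (F - G) = theta F - theta G"
  "theta (- F) = - theta F" "theta 0 = 0" "theta 1 = 0" "theta (fps_const a) = 0"
  by (simp_all add: fps_eq_iff algebra_simps)

lemma of_nat_commute: "of_nat n * (x :: 'a::ring_1) = x * of_nat n"
  by (metis mult_of_nat_commute)

lemma of_nat_left_commute: "x * (of_nat n * y) = of_nat n * (x * y :: 'a::ring_1)"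
proof -
  have "x * (of_nat n * y) = (x * of_nat n) * y" by (simp only: mult.assoc)
  then show ?thesis by (simp only: of_nat_commute[symmetric] mult.assoc)
qed

lemma theta_mult: "theta (F * G) = theta F * G + F * theta (G :: 'a::ring_1 fps)"
proof (rule fps_ext)
  fix n
  have "of_nat n * (\<Sum>i=0..n. F $ i * G $ (n - i)) =
      (\<Sum>i=0..n. of_nat i * F $ i * G $ (n - i) + F $ i * (of_nat (n - i) * G $ (n - i)))"
    unfolding sum_distrib_left
  proof (rule sum.cong[OF refl])
    fix i assume "i \<in> {0..n}"
    then have "(of_nat n :: 'a) = of_nat i + of_nat (n - i)" by (simp flip: of_nat_add)
    then show "of_nat n * (F $ i * G $ (n - i)) =
        of_nat i * F $ i * G $ (n - i) + F $ i * (of_nat (n - i) * G $ (n - i))"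
      by (simp add: distrib_right of_nat_left_commute mult.assoc)
  qed
  then show "theta (F * G) $ n = (theta F * G + F * theta G) $ n"
    by (simp add: fps_mult_nth sum.distrib)
qed

lemma fps_mult_commute:
  fixes F G :: "'a::ring_1 fps"
  assumes "\<And>m n. F $ m * G $ n = G $ n * F $ m"
  shows "F * G = G * F"
proof (rule fps_ext)
  fix n
  have "(\<Sum>i=0..n. F $ i * G $ (n - i)) = (\<Sum>i=0..n. G $ i * F $ (n - i))"
    by (subst sum.nat_diff_reindex[symmetric, unfolded atLeast0AtMost] sum.atLeastAtMost_rev)
      (auto intro!: sum.cong simp: assms)
  then show "(F * G) $ n = (G * F) $ n" by (simp add: fps_mult_nth)
qed

text \<open>Cancellation is needed without commutativity; a constant term \<open>1\<close> suffices.\<close>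

lemma fps_right_cancel:
  fixes F G H :: "'a::ring_1 fps"
  assumes "G $ 0 = 1" "F * G = H * G"
  shows "F = H"
proof -
  have "F $ n = H $ n" for n
  proof (induction n rule: less_induct)
    case (less n)
    have "(\<Sum>i<n. F $ i * G $ (n - i)) = (\<Sum>i<n. H $ i * G $ (n - i))"
      by (rule sum.cong) (auto simp: less)
    moreover have "(F * G) $ n = (\<Sum>i<n. F $ i * G $ (n - i)) + F $ n" for F :: "'a fps"
      by (simp add: fps_mult_nth atLeast0AtMost assms(1) flip: lessThan_Suc_atMost)
    ultimately show ?case using assms(2) by (metis add_left_cancel)
  qed
  then show ?thesis by (simp add: fps_eq_iff)
qed

lemma fps_left_cancel:
  fixes F G H :: "'a::ring_1 fps"
  assumes "G $ 0 = 1" "G * F = G * H"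
  shows "F = H"
proof -
  have "F $ n = H $ n" for n
  proof (induction n rule: less_induct)
    case (less n)
    have "(\<Sum>i=1..n. G $ i * F $ (n - i)) = (\<Sum>i=1..n. G $ i * H $ (n - i))"
      by (rule sum.cong) (auto simp: less)
    moreover have "(G * F) $ n = F $ n + (\<Sum>i=1..n. G $ i * F $ (n - i))" for F :: "'a fps"
      by (simp add: fps_mult_nth sum.atLeast_Suc_atMost[of 0 n] assms(1))
    ultimately show ?case using assms(2) by (metis add_right_cancel)
  qed
  then show ?thesis by (simp add: fps_eq_iff)
qed

text \<open>A first-order linear equation \<open>\<theta> F = u F\<close> with \<open>u(0) = 0\<close> determines \<open>F\<close> from its constant term, if no positive
  integer is a zero divisor. The identities between exponentials below rest on this.\<close>

lemma theta_eq_unique: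
  fixes F G u :: "'a::ring_1 fps"
  assumes torsion_free: "\<forall>n>0. \<forall>x :: 'a. of_nat n * x = 0 \<longrightarrow> x = 0"
    and "theta F = u * F" "theta G = u * G" "F $ 0 = G $ 0" "u $ 0 = 0"
  shows "F = G"
proof -
  have "F $ n = G $ n" for n
  proof (induction n rule: less_induct)
    case (less n)
    show ?case
    proof (cases "n = 0")
      case False
      have "of_nat n * H $ n = (\<Sum>i=1..n. u $ i * H $ (n - i))" if "theta H = u * H" for H
        using arg_cong[OF that, of "\<lambda>F. F $ n"]
        by (simp add: fps_mult_nth sum.atLeast_Suc_atMost[of 0 n] assms(5))
      moreover have "(\<Sum>i=1..n. u $ i * F $ (n - i)) = (\<Sum>i=1..n. u $ i * G $ (n - i))"
        by (rule sum.cong) (auto simp: less)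
      ultimately have "of_nat n * (F $ n - G $ n) = 0"
        using assms(2,3) by (simp add: algebra_simps)
      then show ?thesis using torsion_free False by (metis bot_nat_0.not_eq_extremum right_minus_eq)
    qed (use assms in simp)
  qed
  then show ?thesis by (simp add: fps_eq_iff)
qed

text \<open>\<open>is_exp a A\<close> characterizes \<open>A = exp a\<close> by its logarithmic derivative, which makes sense whether
  or not the coefficients of \<open>a\<close> commute. The constant term of \<open>a\<close> is irrelevant.\<close>

definition is_exp :: "'a::ring_1 fps \<Rightarrow> 'a fps \<Rightarrow> bool" where
  "is_exp a A \<longleftrightarrow> A $ 0 = 1 \<and> theta A = theta a * A"

lemma is_expD: "is_exp a A \<Longrightarrow> A $ 0 = 1" "is_exp a A \<Longrightarrow> theta A = theta a * A"
  by (simp_all add: is_exp_def)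

lemma is_exp_cong: "is_exp a A \<Longrightarrow> (\<And>n. n > 0 \<Longrightarrow> a $ n = b $ n) \<Longrightarrow> is_exp b A"
proof -
  assume a: "is_exp a A" "\<And>n. n > 0 \<Longrightarrow> a $ n = b $ n"
  have "theta a = theta b"
    by (rule fps_ext) (metis a(2) gr0I mult_eq_0_iff mult_zero_left of_nat_0 theta_nth)
  with a(1) show ?thesis by (simp add: is_exp_def)
qed

lemma is_exp_zero: "is_exp 0 1"
  by (simp add: is_exp_def theta_simps)

lemma is_exp_mult:
  assumes "is_exp a A" "is_exp b B" "theta b * A = A * theta b"
  shows "is_exp (a + b) (A * B)"
proof -
  have "theta (A * B) = theta a * A * B + A * (theta b * B)"
    using assms by (simp add: is_exp_def theta_mult)
  also have "A * (theta b * B) = theta b * (A * B)" using assms(3) by (metis mult.assoc)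
  finally show ?thesis using assms(1,2)
    by (simp add: is_exp_def theta_simps distrib_right mult.assoc)
qed

text \<open>The substitution \<open>z \<mapsto> tz\<close>.\<close>

definition fps_scale :: "'a::ring_1 \<Rightarrow> 'a fps \<Rightarrow> 'a fps" where
  "fps_scale t F = Abs_fps (\<lambda>n. t ^ n * F $ n)"

lemma fps_scale_nth [simp]: "fps_scale t F $ n = t ^ n * F $ n"
  by (simp add: fps_scale_def)

lemma theta_fps_scale: "theta (fps_scale t F) = fps_scale t (theta F)"
  by (rule fps_ext) (simp add: of_nat_left_commute)

lemma fps_scale_mult:
  assumes "\<And>x. t * x = x * (t :: 'a::ring_1)"
  shows "fps_scale t (F * G) = fps_scale t F * fps_scale t G"
proof (rule fps_ext)
  fix n
  have tk: "t ^ k * x = x * t ^ k" for k x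
    by (induction k) (simp_all add: assms mult.assoc, metis assms mult.assoc)
  have "t ^ n * (F $ i * G $ (n - i)) = t ^ i * F $ i * (t ^ (n - i) * G $ (n - i))"
    if "i \<in> {0..n}" for i
  proof -
    have "t ^ n = t ^ i * t ^ (n - i)" using that by (simp flip: power_add)
    moreover have "t ^ (n - i) * (F $ i * x) = F $ i * (t ^ (n - i) * x)" for x
      using tk[of "n - i" "F $ i"] by (simp flip: mult.assoc)
    ultimately show ?thesis by (simp add: mult.assoc)
  qed
  then show "fps_scale t (F * G) $ n = (fps_scale t F * fps_scale t G) $ n"
    by (auto simp: fps_mult_nth sum_distrib_left intro!: sum.cong)
qed

lemma is_exp_fps_scale:
  assumes "\<And>x. t * x = x * (t :: 'a::ring_1)" "is_exp a A"
  shows "is_exp (fps_scale t a) (fps_scale t A)"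
  using assms by (simp add: is_exp_def theta_fps_scale fps_scale_mult)

lemma is_exp_geom:
  fixes t :: "'a::ring_1"
  assumes "\<And>n. n > 0 \<Longrightarrow> of_nat n * a $ n = t ^ n"
  shows "is_exp a (geom t)"
  unfolding is_exp_def
proof (intro conjI fps_ext)
  fix n
  have "(\<Sum>i=0..n. of_nat i * a $ i * t ^ (n - i)) = (\<Sum>i=1..n. of_nat i * a $ i * t ^ (n - i))"
    by (simp add: sum.atLeast_Suc_atMost[of 0 n])
  also have "\<dots> = (\<Sum>i=1..n. t ^ n)"
    by (rule sum.cong) (auto simp: assms simp flip: power_add)
  finally show "theta (geom t) $ n = (theta a * geom t) $ n"
    by (simp add: geom_def fps_mult_nth)
qed (simp add: geom_def)

lemma is_exp_one_minus:
  fixes t :: "'a::ring_1"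
  assumes "\<And>n. n > 0 \<Longrightarrow> of_nat n * a $ n = - (t ^ n)"
  shows "is_exp a (1 - fps_const t * fps_X)"
  unfolding is_exp_def
proof (intro conjI fps_ext)
  fix n
  have X: "(fps_const t * fps_X :: 'a fps) $ i = (if i = 1 then t else 0)" for i
    by (cases i) (simp_all add: fps_X_def)
  show "theta (1 - fps_const t * fps_X) $ n = (theta a * (1 - fps_const t * fps_X)) $ n"
  proof (cases n)
    case (Suc m)
    have "(theta a * (fps_const t * fps_X)) $ n = (\<Sum>i=0..n. (if i = m then of_nat i * a $ i * t else 0))"
      unfolding fps_mult_nth[of "theta a"] using Suc
      by (intro sum.cong) (auto simp: X)
    also have "\<dots> = of_nat m * a $ m * t" using Suc by simp
    also have "\<dots> = (if m = 0 then 0 else - (t ^ n))"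
      using assms[of m] Suc by (auto simp: power_commutes)
    finally show ?thesis using assms[of n] Suc
      by (auto simp: X right_diff_distrib)
  qed (simp add: X)
qed simp

lemma is_exp_inverse:
  assumes a: "is_exp a A" and AC: "A * C = 1" "C * A = 1" and comm: "theta a * C = C * theta a"
    and "C $ 0 = 1"
  shows "is_exp (- a) C"
proof -
  have "theta a * (A * C) + A * theta C = 0"
    using theta_mult[of A C] a AC by (simp add: is_exp_def theta_simps mult.assoc)
  then have "C * (theta a + A * theta C) = 0" using AC by simp
  then have "C * theta a + theta C = 0" using AC by (simp add: distrib_left flip: mult.assoc)
  then show ?thesis using comm assms(5)
    by (simp add: is_exp_def theta_simps eq_neg_iff_add_eq_0 add.commute)
qed

section \<open>Series in two commuting variables\<close>

text \<open>Series in \<open>w\<close> over the series ring in \<open>z\<close>: \<open>in_w F = F(w)\<close> and \<open>in_zw F = F(zw)\<close>.\<close>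

definition in_w :: "'a::ring_1 fps \<Rightarrow> 'a fps fps" where
  "in_w F = Abs_fps (\<lambda>n. fps_const (F $ n))"

definition in_zw :: "'a::ring_1 fps \<Rightarrow> 'a fps fps" where
  "in_zw F = Abs_fps (\<lambda>n. fps_const (F $ n) * fps_X ^ n)"

lemma in_w_nth [simp]: "in_w F $ n = fps_const (F $ n)"
  and in_zw_nth [simp]: "in_zw F $ n = fps_const (F $ n) * fps_X ^ n"
  by (simp_all add: in_w_def in_zw_def)

lemma fps_const_sum: "fps_const (sum f A) = (\<Sum>x\<in>A. fps_const (f x))"
  by (induction A rule: infinite_finite_induct) (simp_all flip: fps_const_add)

lemma fps_X_power_commute: "fps_X ^ n * F = F * (fps_X ^ n :: 'a::ring_1 fps)"
  by (simp add: fps_eq_iff fps_X_power_mult_nth fps_X_power_mult_right_nth)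

lemma in_w_mult: "in_w (F * G) = in_w F * in_w G"
  by (rule fps_ext) (simp add: fps_mult_nth fps_const_sum)

lemma in_zw_mult: "in_zw (F * G) = in_zw F * in_zw G"
proof (rule fps_ext)
  fix n
  have "fps_const (F $ i * G $ (n - i)) * fps_X ^ n =
      fps_const (F $ i) * fps_X ^ i * (fps_const (G $ (n - i)) * fps_X ^ (n - i))"
    if "i \<in> {0..n}" for i
  proof -
    have "(fps_X ^ n :: 'a fps) = fps_X ^ i * fps_X ^ (n - i)" using that by (simp flip: power_add)
    moreover have "fps_const (G $ (n - i)) * (fps_X ^ i * x) = fps_X ^ i * (fps_const (G $ (n - i)) * x)"
      for x by (metis fps_X_power_commute mult.assoc)
    ultimately show ?thesis by (simp add: mult.assoc flip: fps_const_mult)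
  qed
  then show "in_zw (F * G) $ n = (in_zw F * in_zw G) $ n"
    by (auto simp: fps_mult_nth fps_const_sum sum_distrib_right intro!: sum.cong)
qed

lemma theta_in_w: "theta (in_w F) = in_w (theta F)"
  and theta_in_zw: "theta (in_zw F) = in_zw (theta F)"
  by (rule fps_ext, simp add: fps_of_nat[symmetric] mult.assoc[symmetric])+

lemma in_zw_central:
  assumes "\<And>n x. F $ n * x = x * F $ n"
  shows "in_zw F * G = G * in_zw F"
proof (rule fps_mult_commute)
  fix m n
  have "fps_const (F $ m) * H = H * fps_const (F $ m)" for H
    by (simp add: fps_eq_iff assms)
  then show "in_zw F $ m * G $ n = G $ n * in_zw F $ m"
    by (simp, metis fps_X_power_commute mult.assoc)
qed

lemma is_exp_in_w: "is_exp a A \<Longrightarrow> is_exp (in_w a) (in_w A)"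
  by (simp add: is_exp_def theta_in_w in_w_mult)

lemma is_exp_in_zw: "is_exp a A \<Longrightarrow> is_exp (in_zw a) (in_zw A)"
  by (simp add: is_exp_def theta_in_zw in_zw_mult)

lemma in_w_const_nth: "(in_w B * fps_const A) $ n $ m = B $ n * A $ m"
  by simp

lemma in_zw_const_in_w_nth:
  "(in_zw G * fps_const A * in_w B) $ n $ m =
    (\<Sum>k\<le>min m n. G $ k * (A $ (m - k) * B $ (n - k)))"
proof -
  have "(in_zw G * fps_const A * in_w B) $ n $ m =
      (\<Sum>k=0..n. (fps_const (G $ k) * (fps_X ^ k * (A * fps_const (B $ (n - k))))) $ m)"
    unfolding mult.assoc[of "in_zw G"]
    by (simp only: fps_mult_nth[of "in_zw G"] fps_sum_nth)
      (simp add: mult.assoc)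
  also have "\<dots> = (\<Sum>k=0..n. if k \<le> m then G $ k * (A $ (m - k) * B $ (n - k)) else 0)"
    by (rule sum.cong) (auto simp: fps_X_power_mult_nth)
  also have "\<dots> = (\<Sum>k\<in>{0..n} \<inter> {k. k \<le> m}. G $ k * (A $ (m - k) * B $ (n - k)))"
    by (simp add: sum.inter_restrict)
  also have "{0..n} \<inter> {k. k \<le> m} = {..min m n}" by auto
  finally show ?thesis .
qed

section \<open>Algebras over the base field\<close>

text \<open>Algebras over the base field \<open>\<bbbk>(q)\<close>: the field maps to the centre by \<open>sc\<close>.\<close>

locale scalar_algebra =
  fixes sc :: "'k::field_char_0 poly fract \<Rightarrow> 'r::ring_1"
  assumes sc_hom: "unital_hom sc" and sc_central: "sc a * x = x * sc a"
begin

sublocale sc: unital_hom sc by (fact sc_hom)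

text \<open>Writing multiplication by a scalar as an action lets the simplifier move scalars to the front, although
  the ring is not commutative.\<close>

definition act :: "'k poly fract \<Rightarrow> 'r \<Rightarrow> 'r" (infixr "\<odot>" 75) where
  "a \<odot> x = sc a * x"

lemma act_simps:
  "(a \<odot> x) * y = a \<odot> (x * y)" "x * (a \<odot> y) = a \<odot> (x * y)"
  "a \<odot> b \<odot> x = (a * b) \<odot> x" "1 \<odot> x = x" "0 \<odot> x = 0" "a \<odot> 0 = 0"
  "a \<odot> (x + y) = a \<odot> x + a \<odot> y" "a \<odot> (x - y) = a \<odot> x - a \<odot> y"
  "a \<odot> (- x) = - (a \<odot> x)" "(- a) \<odot> x = - (a \<odot> x)"
  by (simp_all add: act_def sc.hom_simps algebra_simps) (metis mult.assoc sc_central)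

lemma act_diff_left: "(a - b) \<odot> x = a \<odot> x - b \<odot> x"
  by (simp add: act_def sc.hom_simps algebra_simps)

lemma act_sum: "a \<odot> sum g A = (\<Sum>x\<in>A. a \<odot> g x)"
  by (simp add: act_def sum_distrib_left)

lemma act_cancel: "a \<noteq> 0 \<Longrightarrow> a \<odot> x = a \<odot> y \<longleftrightarrow> x = y"
  by (metis act_simps(3,4) left_inverse)

lemma act_eq_iff: "a \<noteq> 0 \<Longrightarrow> a \<odot> x = y \<longleftrightarrow> x = inverse a \<odot> y"
  by (metis act_simps(3,4) left_inverse right_inverse)

lemma of_nat_act: "of_nat n * x = of_nat n \<odot> x"
proof -
  have "sc (of_nat n) = of_nat n" by (induction n) (simp_all add: sc.hom_simps)
  then show ?thesis by (simp add: act_def)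
qed

lemma torsion_free: "n > 0 \<Longrightarrow> of_nat n * (x :: 'r) = 0 \<Longrightarrow> x = 0"
  by (metis act_cancel act_simps(6) bot_nat_0.not_eq_extremum of_nat_act of_nat_fract_poly_eq_0_iff)

lemma of_nat_cancel: "n > 0 \<Longrightarrow> of_nat n * (x :: 'r) = of_nat n * y \<longleftrightarrow> x = y"
  using torsion_free[of n "x - y"] by (auto simp: right_diff_distrib)

lemma torsion_free_fps: "n > 0 \<Longrightarrow> of_nat n * (F :: 'r fps) = 0 \<Longrightarrow> F = 0"
  by (auto simp: fps_eq_iff fps_of_nat[symmetric] intro: torsion_free)

lemma torsion_free': "\<forall>n>0. \<forall>x :: 'r. of_nat n * x = 0 \<longrightarrow> x = 0"
  and torsion_free_fps': "\<forall>n>0. \<forall>F :: 'r fps. of_nat n * F = 0 \<longrightarrow> F = 0"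
  using torsion_free torsion_free_fps by blast+

lemma is_exp_unique:
  assumes "is_exp a A" "is_exp b B" "\<And>n. n > 0 \<Longrightarrow> a $ n = (b :: 'r fps) $ n"
  shows "A = B"
  using theta_eq_unique[OF torsion_free', of A "theta b" B] is_exp_cong[OF assms(1,3)] assms(2)
  by (simp add: is_exp_def)

text \<open>An element that \<open>t\<close>-commutes with the exponents \<open>t\<close>-commutes with the exponential, and conversely.\<close>

lemma is_exp_skew_commute:
  fixes a A :: "'r fps"
  assumes "is_exp a A"
  shows "(\<forall>n. y * A $ n = t ^ n \<odot> (A $ n * y)) \<longleftrightarrow> (\<forall>n>0. y * a $ n = t ^ n \<odot> (a $ n * y))"
proof -
  define A' a' where "A' = fps_scale (sc t) A" and "a' = fps_scale (sc t) a"
  have *: "is_exp a' A'"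
    unfolding A'_def a'_def by (rule is_exp_fps_scale) (auto simp: assms sc_central)
  define F where "F = fps_const y * A - A' * fps_const y"
  define u where "u = fps_const y * theta a - theta a' * fps_const y"
  have "theta F = u * A + theta a' * F"
    using is_expD(2)[OF assms] is_expD(2)[OF *]
    by (simp add: F_def u_def theta_simps theta_mult algebra_simps)
  moreover have "F $ 0 = 0" using is_expD(1)[OF assms] is_expD(1)[OF *] by (simp add: F_def)
  ultimately have "F = 0 \<longleftrightarrow> u = 0"
    using theta_eq_unique[OF torsion_free', of F "theta a'" 0] fps_right_cancel[of A u 0]
      is_expD(1)[OF assms]
    by (auto simp: theta_simps)
  moreover have "F = 0 \<longleftrightarrow> (\<forall>n. y * A $ n = t ^ n \<odot> (A $ n * y))"
    by (auto simp: F_def A'_def fps_eq_iff act_def sc.hom_simps mult.assoc)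
  moreover have u_nth: "u $ n = 0 \<longleftrightarrow> (n > 0 \<longrightarrow> y * a $ n = t ^ n \<odot> (a $ n * y))" for n
  proof -
    have "u $ n = of_nat n * (y * a $ n - t ^ n \<odot> (a $ n * y))"
      by (simp add: u_def a'_def act_def sc.hom_simps right_diff_distrib mult.assoc of_nat_left_commute)
    then show ?thesis using torsion_free[of n "y * a $ n - t ^ n \<odot> (a $ n * y)"] by auto
  qed
  then have "u = 0 \<longleftrightarrow> (\<forall>n>0. y * a $ n = t ^ n \<odot> (a $ n * y))"
    by (simp add: fps_eq_iff u_nth)
  ultimately show ?thesis by simp
qed

lemma is_exp_commute:
  fixes a A :: "'r fps"
  assumes "is_exp a A"
  shows "(\<forall>n. y * A $ n = A $ n * y) \<longleftrightarrow> (\<forall>n>0. y * a $ n = a $ n * y)"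
  using is_exp_skew_commute[OF assms, of y 1] by (simp add: act_simps)

text \<open>If \<open>A = exp a\<close>, \<open>B = exp b\<close> and the bracket of \<open>b\<^sub>k\<close> with \<open>a\<^sub>l\<close> is \<open>\<delta>\<^sub>k\<^sub>l c\<^sub>k\<close> with \<open>c\<close> central, then
  \<open>B(w) A(z) = G(zw) A(z) B(w)\<close> with \<open>G = exp c\<close>, and conversely. Both implications compare logarithmic
  derivatives: \<open>F\<close> below is the defect of the second identity, \<open>u\<close> that of
  \<open>\<theta>b(w) A(z) = A(z) \<theta>b(w) + \<theta>c(zw) A(z)\<close>, and \<open>\<theta>F = G u B + \<theta>b F\<close>, so one vanishes with the other.
  The same argument in the variable \<open>z\<close> passes from \<open>u\<close> to the brackets.\<close>

lemma is_exp_heisenberg: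
  fixes a A b B c G :: "'r fps"
  assumes A: "is_exp a A" and B: "is_exp b B" and G: "is_exp c G"
    and G_central: "\<And>n x. G $ n * x = x * G $ n" and c_central: "\<And>n x. c $ n * x = x * c $ n"
  shows "(\<forall>m n. B $ n * A $ m = (\<Sum>k\<le>min m n. G $ k * (A $ (m - k) * B $ (n - k)))) \<longleftrightarrow>
    (\<forall>k>0. \<forall>l>0. b $ k * a $ l = a $ l * b $ k + (if k = l then c $ k else 0))"
proof -
  define u where "u = in_w (theta b) * fps_const A - fps_const A * in_w (theta b)
    - in_zw (theta c) * fps_const A"
  define F where "F = in_w B * fps_const A - in_zw G * fps_const A * in_w B"
  have G': "in_zw G * x = x * in_zw G" for x by (rule in_zw_central) (rule G_central)
  have c': "in_zw (theta c) * x = x * in_zw (theta c)" for x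
    by (rule in_zw_central) (simp add: of_nat_left_commute mult.assoc c_central)
  note dB = is_expD(2)[OF is_exp_in_w[OF B], unfolded theta_in_w]
    and dG = is_expD(2)[OF is_exp_in_zw[OF G], unfolded theta_in_zw]
  have theta_F: "theta F = in_zw G * u * in_w B + in_w (theta b) * F"
  proof -
    have "theta F = in_w (theta b) * (in_w B * fps_const A)
        - (in_zw (theta c) * (in_zw G * (fps_const A * in_w B))
          + in_zw G * (fps_const A * (in_w (theta b) * in_w B)))"
      by (simp add: F_def theta_simps theta_mult theta_in_w theta_in_zw is_expD(2)[OF B]
          is_expD(2)[OF G] in_w_mult in_zw_mult mult.assoc distrib_left)
    moreover have "in_zw (theta c) * (in_zw G * x) = in_zw G * (in_zw (theta c) * x)"
      "in_w (theta b) * (in_zw G * x) = in_zw G * (in_w (theta b) * x)" for x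
      by (metis G' mult.assoc)+
    ultimately show ?thesis
      by (simp add: F_def u_def left_diff_distrib right_diff_distrib mult.assoc)
  qed
  have "F $ 0 = 0" using is_expD(1)[OF B] is_expD(1)[OF G] by (simp add: F_def)
  then have "u = 0 \<Longrightarrow> F = 0"
    using theta_eq_unique[OF torsion_free_fps', of F "in_w (theta b)" 0] theta_F by (simp add: theta_simps)
  moreover have "F = 0 \<Longrightarrow> u = 0"
  proof -
    assume "F = 0"
    then have "in_zw G * u * in_w B = 0" using theta_F by (simp add: theta_simps)
    then have "in_zw G * u = 0"
      using fps_right_cancel[of "in_w B" "in_zw G * u" 0] is_expD(1)[OF B] by simp
    then show "u = 0"
      using fps_left_cancel[of "in_zw G" u 0] is_expD(1)[OF G] by simp
  qed
  moreover have "F = 0 \<longleftrightarrow> (\<forall>m n. B $ n * A $ m = (\<Sum>k\<le>min m n. G $ k * (A $ (m - k) * B $ (n - k))))"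
  proof -
    have "F = 0 \<longleftrightarrow> in_w B * fps_const A = in_zw G * fps_const A * in_w B" by (simp add: F_def)
    then show ?thesis
      unfolding fps_eq_iff by (simp only: in_zw_const_in_w_nth in_w_const_nth) blast
  qed
  moreover have "u = 0 \<longleftrightarrow>
    (\<forall>k>0. \<forall>l>0. b $ k * a $ l = a $ l * b $ k + (if k = l then c $ k else 0))"
    (is "_ \<longleftrightarrow> ?com")
  proof -
    define v where "v k = fps_const (b $ k) * theta a - theta a * fps_const (b $ k)
      - of_nat k * (fps_const (c $ k) * fps_X ^ k)" for k
    define H where "H k = fps_const (b $ k) * A - A * fps_const (b $ k)
      - fps_const (c $ k) * fps_X ^ k * A" for k
    have theta_X: "theta (fps_X ^ k) = of_nat k * (fps_X ^ k :: 'r fps)" for k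
      by (rule fps_ext) (simp add: fps_of_nat[symmetric])
    have cX: "fps_const (c $ k) * fps_X ^ k * x = x * (fps_const (c $ k) * fps_X ^ k)" for k x
    proof -
      have "fps_const (c $ k) * y = y * fps_const (c $ k)" for y
        by (simp add: fps_eq_iff c_central)
      then show ?thesis by (metis fps_X_power_commute mult.assoc)
    qed
    have theta_H: "theta (H k) = v k * A + theta a * H k" for k
    proof -
      define Z where "Z = fps_const (c $ k) * fps_X ^ k"
      have "theta Z = of_nat k * Z"
        by (simp add: Z_def theta_mult theta_simps theta_X of_nat_left_commute)
      moreover have "Z * (theta a * A) = theta a * (Z * A)" using cX by (metis Z_def mult.assoc)
      ultimately show ?thesis using is_expD(2)[OF A]
        by (simp add: H_def v_def theta_simps theta_mult left_diff_distrib right_diff_distrib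
            mult.assoc flip: Z_def)
    qed
    have "k > 0 \<Longrightarrow> H k $ 0 = 0" for k using is_expD(1)[OF A] by (simp add: H_def)
    then have Hv: "k > 0 \<Longrightarrow> H k = 0 \<longleftrightarrow> v k = 0" for k
      using theta_eq_unique[OF torsion_free', of "H k" "theta a" 0] fps_right_cancel[of A "v k" 0]
        is_expD(1)[OF A] theta_H[of k]
      by (auto simp: theta_simps)
    have "u $ k = of_nat k * H k" for k
    proof -
      have "fps_const (of_nat k * x) = of_nat k * fps_const x" for x :: 'r
        by (simp flip: fps_of_nat)
      moreover have "A * (of_nat k * x) = of_nat k * (A * x)" for x
        by (rule of_nat_left_commute)
      ultimately show ?thesis by (simp add: u_def H_def right_diff_distrib mult.assoc)
    qed
    then have "u = 0 \<longleftrightarrow> (\<forall>k. of_nat k * H k = 0)" by (simp add: fps_eq_iff[of u])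
    also have "\<dots> \<longleftrightarrow> (\<forall>k>0. H k = 0)"
    proof (intro iffI allI impI)
      fix k assume "\<forall>k>0. H k = 0"
      then show "of_nat k * H k = 0" by (cases "k = 0") simp_all
    qed (use torsion_free_fps in blast)
    finally have "u = 0 \<longleftrightarrow> (\<forall>k>0. H k = 0)" .
    moreover have v_nth: "v k $ l = 0 \<longleftrightarrow> (l > 0 \<longrightarrow> b $ k * a $ l = a $ l * b $ k + (if k = l then c $ k else 0))"
      if "k > 0" for k l
    proof -
      have "v k $ l = of_nat l * (b $ k * a $ l - a $ l * b $ k - (if k = l then c $ k else 0))"
      proof -
        have "b $ k * (of_nat l * a $ l) = of_nat l * (b $ k * a $ l)"
          by (rule of_nat_left_commute)
        then show ?thesis
          by (simp add: v_def fps_of_nat[symmetric] right_diff_distrib mult.assoc)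
      qed
      then show ?thesis
        using torsion_free[of l "b $ k * a $ l - a $ l * b $ k - (if k = l then c $ k else 0)"]
        by (auto simp: algebra_simps)
    qed
    ultimately show ?thesis using Hv by (simp add: fps_eq_iff[of "v _"] v_nth)
  qed
  ultimately show ?thesis by blast
qed

end

context scalar_algebra
begin

text \<open>The exponential as the usual sum over powers, which is how the presentations define it.\<close>

definition expo :: "'r fps \<Rightarrow> 'r fps" where
  "expo h = Abs_fps (\<lambda>n. \<Sum>k\<le>n. sc (inverse (of_nat (fact k))) * (h ^ k) $ n)"

lemma expo_nth: "expo h $ n = (\<Sum>k\<le>n. inverse (of_nat (fact k)) \<odot> (h ^ k) $ n)"
  by (simp add: expo_def act_def)

lemma fps_power_nth_0: "(h :: 'r fps) $ 0 = 0 \<Longrightarrow> n < k \<Longrightarrow> (h ^ k) $ n = 0"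
proof (induction k arbitrary: n)
  case (Suc k)
  have "h $ i * (h ^ k) $ (n - i) = 0" if "i \<in> {0..n}" for i
    using Suc that by (cases "i = 0") auto
  then show ?case by (simp add: fps_mult_nth)
qed simp

lemma theta_power:
  assumes "h * theta h = theta h * (h :: 'r fps)"
  shows "theta (h ^ Suc k) = of_nat (Suc k) * (theta h * h ^ k)"
proof (induction k)
  case (Suc k)
  have "theta (h ^ Suc (Suc k)) = theta h * h ^ Suc k + h * (of_nat (Suc k) * (theta h * h ^ k))"
    using Suc by (simp add: theta_mult)
  also have "h * (of_nat (Suc k) * (theta h * h ^ k)) = of_nat (Suc k) * (theta h * h ^ Suc k)"
    unfolding of_nat_left_commute using assms by (simp flip: mult.assoc)
  finally show ?case by (simp add: distrib_right)
qed (simp add: theta_simps)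

lemma is_exp_expo:
  assumes h0: "h $ 0 = 0" and comm: "\<And>m n. h $ m * h $ n = h $ n * h $ m"
  shows "is_exp h (expo h)"
  unfolding is_exp_def
proof (intro conjI fps_ext)
  show "expo h $ 0 = 1" by (simp add: expo_nth act_simps)
  have h: "h * theta h = theta h * h"
    by (rule fps_mult_commute) (simp add: of_nat_left_commute comm mult.assoc)
  fix n
  show "theta (expo h) $ n = (theta h * expo h) $ n"
  proof (cases n)
    case (Suc m)
    let ?c = "\<lambda>k. inverse (of_nat (fact k)) :: 'k poly fract"
    have "theta (expo h) $ n = (\<Sum>k\<le>n. ?c k \<odot> (theta (h ^ k)) $ n)"
      by (simp add: expo_nth sum_distrib_left of_nat_left_commute act_def)
    also have "\<dots> = (\<Sum>k\<le>m. ?c (Suc k) \<odot> (theta (h ^ Suc k)) $ n)"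
      unfolding Suc by (subst sum.atMost_Suc_shift) (simp add: theta_simps act_simps)
    also have "\<dots> = (\<Sum>k\<le>m. ?c k \<odot> (theta h * h ^ k) $ n)"
    proof (rule sum.cong[OF refl])
      fix k
      have "?c (Suc k) \<odot> (of_nat (Suc k) * x) = ?c k \<odot> x" for x
      proof -
        have "of_nat (fact (Suc k)) = (of_nat (fact k) * of_nat (Suc k) :: 'k poly fract)"
          by (simp add: algebra_simps)
        moreover have "of_nat (Suc k) \<noteq> (0 :: 'k poly fract)" by (simp del: of_nat_Suc)
        ultimately have "?c (Suc k) * of_nat (Suc k) = ?c k"
          by (simp add: mult.assoc del: of_nat_Suc fact_Suc)
        then show ?thesis by (simp only: of_nat_act act_simps)
      qed
      then show "?c (Suc k) \<odot> (theta (h ^ Suc k)) $ n = ?c k \<odot> (theta h * h ^ k) $ n"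
        unfolding theta_power[OF h] by (simp only: fps_of_nat[symmetric] fps_mult_left_const_nth)
    qed
    also have "\<dots> = (\<Sum>k\<le>m. \<Sum>i=1..n. ?c k \<odot> (theta h $ i * (h ^ k) $ (n - i)))"
      by (simp add: fps_mult_nth act_sum sum.atLeast_Suc_atMost[of 0 n] act_simps)
    also have "\<dots> = (\<Sum>i=1..n. \<Sum>k\<le>m. theta h $ i * (?c k \<odot> (h ^ k) $ (n - i)))"
      by (subst sum.swap) (simp only: act_simps)
    also have "\<dots> = (\<Sum>i=1..n. theta h $ i * expo h $ (n - i))"
    proof (rule sum.cong[OF refl])
      fix i assume i: "i \<in> {1..n}"
      have "(\<Sum>k\<le>m. ?c k \<odot> (h ^ k) $ (n - i)) = (\<Sum>k\<le>n-i. ?c k \<odot> (h ^ k) $ (n - i))"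
        by (rule sum.mono_neutral_right) (use i Suc in \<open>auto simp: fps_power_nth_0[OF h0] act_simps\<close>)
      then show "(\<Sum>k\<le>m. theta h $ i * (?c k \<odot> (h ^ k) $ (n - i))) = theta h $ i * expo h $ (n - i)"
        by (simp only: expo_nth sum_distrib_left[symmetric])
    qed
    also have "\<dots> = (theta h * expo h) $ n"
      by (simp add: fps_mult_nth sum.atLeast_Suc_atMost[of 0 n])
    finally show ?thesis .
  qed simp
qed

text \<open>The coefficient \<open>h\<^sub>n\<close> is that of \<open>exp h\<close> up to a polynomial in the earlier ones, so no commutation
  of the coefficients is needed here.\<close>

lemma commute_expoD:
  assumes h0: "h $ 0 = 0" and comm: "\<And>n. y * expo h $ n = expo h $ n * y"
  shows "y * h $ n = h $ n * y"
proof (induction n rule: less_induct)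
  case (less n)
  have pow: "y * (h ^ k) $ m = (h ^ k) $ m * y" if "m < n" for k m
    using that
  proof (induction k arbitrary: m)
    case (Suc k)
    have "y * (h $ i * (h ^ k) $ (m - i)) = h $ i * (h ^ k) $ (m - i) * y" if "i \<in> {0..m}" for i
      using less[of i] Suc.IH[of "m - i"] Suc.prems that by (simp add: mult.assoc flip: mult.assoc[of y])
    then show ?case by (simp add: fps_mult_nth sum_distrib_left sum_distrib_right)
  qed simp
  have pow_n: "y * (h ^ k) $ n = (h ^ k) $ n * y" if k: "k \<noteq> 1" for k
  proof (cases k)
    case (Suc l)
    have "y * (h $ i * (h ^ l) $ (n - i)) = h $ i * (h ^ l) $ (n - i) * y" if i: "i \<in> {0..n}" for i
    proof (cases "i = 0 \<or> i = n")
      case True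
      then show ?thesis using h0 fps_power_nth_0[OF h0, of 0 l] k Suc by auto
    next
      case False
      then have "i < n" "n - i < n" using i by auto
      then show ?thesis using less[of i] pow[of "n - i" l]
        by (simp add: mult.assoc flip: mult.assoc[of y])
    qed
    then show ?thesis by (simp add: Suc fps_mult_nth sum_distrib_left sum_distrib_right)
  qed simp
  show ?case
  proof (cases "n = 0")
    case False
    let ?r = "\<Sum>k\<in>{..n} - {1}. inverse (of_nat (fact k)) \<odot> (h ^ k) $ n"
    have "expo h $ n = h $ n + ?r"
      unfolding expo_nth using False by (subst sum.remove[of _ 1]) (auto simp: act_simps)
    moreover have "y * ?r = ?r * y"
      by (simp add: sum_distrib_left sum_distrib_right act_simps pow_n)
    ultimately show ?thesis using comm[of n] by (simp add: algebra_simps)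
  qed (simp add: h0)
qed

lemma hom_fexp:
  assumes f: "unital_hom f" and sc: "\<And>a. f (scal a) = sc a"
  shows "f (fexp A $ n) = expo (Abs_fps (\<lambda>m. f (A $ m))) $ n"
proof -
  interpret f: unital_hom f by (fact f)
  have "f ((A ^ k) $ m) = (Abs_fps (\<lambda>m. f (A $ m)) ^ k) $ m" for k m
    by (induction k arbitrary: m) (simp_all add: fps_mult_nth f.hom_simps)
  then show ?thesis by (simp add: fexp_def expo_def f.hom_simps sc)
qed

text \<open>The coefficients of the logarithm, obtained by solving \<open>\<theta>A = \<theta>a A\<close> recursively for \<open>a\<close>.\<close>

fun log_coeff :: "'r fps \<Rightarrow> nat \<Rightarrow> 'r" where
  "log_coeff A n = (if n = 0 then 0 else
     A $ n - inverse (of_nat n) \<odot> (\<Sum>k<n. of_nat k * log_coeff A k * A $ (n - k)))"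

declare log_coeff.simps [simp del]

lemma is_exp_log_coeff:
  assumes "A $ 0 = 1"
  shows "is_exp (Abs_fps (log_coeff A)) A"
  unfolding is_exp_def
proof (intro conjI fps_ext assms)
  fix n
  show "theta A $ n = (theta (Abs_fps (log_coeff A)) * A) $ n"
  proof (cases "n = 0")
    case False
    have "(theta (Abs_fps (log_coeff A)) * A) $ n =
      (\<Sum>k<n. of_nat k * log_coeff A k * A $ (n - k)) + of_nat n * log_coeff A n"
      by (simp add: fps_mult_nth atLeast0AtMost assms flip: lessThan_Suc_atMost)
    moreover have "of_nat n * (inverse (of_nat n) \<odot> x) = x" for x
      using False by (simp add: of_nat_act act_simps)
    ultimately show ?thesis using False by (simp add: log_coeff.simps[of A n] right_diff_distrib)
  qed simp
qed

end

lemma geom_inverse: "(1 - fps_const x * fps_X) * geom x = (1 :: 'a::ring_1 fps)"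
proof (rule fps_ext)
  fix n
  show "((1 - fps_const x * fps_X) * geom x) $ n = (1 :: 'a fps) $ n"
    by (cases n) (simp_all add: geom_def left_diff_distrib mult.assoc fps_X_mult_nth)
qed

context scalar_algebra
begin

lemma expo_zero: "expo 0 = 1"
  by (rule is_exp_unique[OF is_exp_expo is_exp_zero]) simp_all

lemma commute_expoI:
  assumes "\<And>n. y * h $ n = h $ n * y"
  shows "y * expo h $ n = expo h $ n * y"
proof -
  have "y * (h ^ k) $ m = (h ^ k) $ m * y" for k m
  proof (induction k arbitrary: m)
    case (Suc k)
    have "y * (h $ i * (h ^ k) $ (m - i)) = h $ i * (h ^ k) $ (m - i) * y" for i
      by (simp only: assms Suc mult.assoc flip: mult.assoc[of y])
    then show ?case by (simp add: fps_mult_nth sum_distrib_left sum_distrib_right)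
  qed simp
  then show ?thesis
    by (simp add: expo_nth sum_distrib_left sum_distrib_right act_simps)
qed

lemma log_coeff_unique:
  assumes "is_exp a A" "n > 0"
  shows "log_coeff A n = a $ n"
proof -
  have "theta (Abs_fps (log_coeff A)) * A = theta a * A"
    using is_expD(2)[OF assms(1)] is_expD(2)[OF is_exp_log_coeff[OF is_expD(1)[OF assms(1)]]] by simp
  then have "theta (Abs_fps (log_coeff A)) = theta a"
    by (rule fps_right_cancel[OF is_expD(1)[OF assms(1)]])
  then have "of_nat n * log_coeff A n = of_nat n * a $ n"
    by (metis fps_nth_Abs_fps theta_nth)
  then show ?thesis using assms(2) of_nat_cancel by blast
qed

end

interpretation free: scalar_algebra "scal :: 'k::field_char_0 poly fract \<Rightarrow> ('g, 'k) falg"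
  by (rule scalar_algebra.intro) (simp_all add: unital_hom_scal scal_central)

lemma (in scalar_algebra) hom_log_coeff:
  assumes f: "unital_hom f" and sc: "\<And>a. f (scal a) = sc a"
  shows "f (free.log_coeff A n) = log_coeff (Abs_fps (\<lambda>n. f (A $ n))) n"
proof (induction n rule: less_induct)
  case (less n)
  interpret f: unital_hom f by (fact f)
  have "(\<Sum>k<n. f (of_nat k * free.log_coeff A k * A $ (n - k))) =
      (\<Sum>k<n. of_nat k * log_coeff (Abs_fps (\<lambda>n. f (A $ n))) k * f (A $ (n - k)))"
  proof (rule sum.cong[OF refl])
    fix k assume "k \<in> {..<n}"
    moreover have "f (of_nat k) = of_nat k" by (induction k) (simp_all add: f.hom_simps)
    ultimately show "f (of_nat k * free.log_coeff A k * A $ (n - k)) =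
        of_nat k * log_coeff (Abs_fps (\<lambda>n. f (A $ n))) k * f (A $ (n - k))"
      using less by (simp add: f.hom_mult)
  qed
  then show ?case
    by (simp add: free.log_coeff.simps[of A n] log_coeff.simps[of _ n] f.hom_zero f.hom_diff f.hom_sum
        free.act_def f.hom_mult sc act_def)
qed

section \<open>Both realizations in one ring\<close>

text \<open>Uniform names for the vertex generators: \<open>vx\<close> for \<open>E\<close> and \<open>F\<close>, \<open>vpq\<close> for \<open>Q\<close> and \<open>P\<close>, and \<open>vb\<close> for
  \<open>Q\<^bsup>[1^n]\<^esup>\<close> and \<open>P\<^bsup>[1^n]\<^esup>\<close>, in each case for the signs \<open>Pos\<close> and \<open>Neg\<close>. The sign \<open>shape_sg\<close> is
  \<open>-1\<close> for columns because \<open>\<Sum> (-1)\<^sup>n Q\<^bsup>(1^n)\<^esup> z\<^sup>n\<close> is inverse to \<open>\<Sum> Q\<^bsup>(n)\<^esup> z\<^sup>n\<close>.\<close>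

fun vx :: "sign \<Rightarrow> 'i \<Rightarrow> int \<Rightarrow> 'i v_gen" where
  "vx Pos = VE" | "vx Neg = VF"

fun vpq :: "sign \<Rightarrow> shape \<Rightarrow> 'i \<Rightarrow> nat \<Rightarrow> 'i v_gen" where
  "vpq Pos = VQ" | "vpq Neg = VP"

fun vb :: "sign \<Rightarrow> 'i \<Rightarrow> nat \<Rightarrow> ('i v_gen, 'k::field_char_0) falg" where
  "vb Pos = v_Qb" | "vb Neg = v_Pb"

fun shape_sg :: "shape \<Rightarrow> 'a::ring_1" where
  "shape_sg Row = 1" | "shape_sg Col = - 1"

lemma sg_cases: "sg s = 1 \<or> sg s = - 1"
  by (cases s) simp_all

text \<open>A ring with images of both sets of generators that are related by the identification of the two
  realizations, and in which the elementary relations hold: those for \<open>q\<^sup>h\<close>, \<open>q\<^sup>\<plusminus>\<^sup>d\<close>, \<open>q\<^sup>\<plusminus>\<^sup>c\<^sup>/\<^sup>2\<close>, and the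
  commutation of the \<open>h\<^bsub>i,m\<^esub>\<close> with \<open>m\<close> of a fixed sign among each other and with the \<open>q\<^sup>h\<close>. In such a ring every further Drinfeld
  relation is equivalent to a vertex relation.\<close>

locale two_realizations = scalar_algebra sc
  for sc :: "'k::field_char_0 poly fract \<Rightarrow> 'r::ring_1" +
  fixes adj :: "'i::finite \<Rightarrow> 'i \<Rightarrow> bool"
    and f :: "('i dr_gen, 'k) falg \<Rightarrow> 'r" and g :: "('i v_gen, 'k) falg \<Rightarrow> 'r"
  assumes f_hom: "unital_hom f" and f_scal: "f (scal a) = sc a"
    and g_hom: "unital_hom g" and g_scal: "g (scal a) = sc a"
    and adj_irrefl: "\<not> adj i i" and adj_sym: "adj i j \<Longrightarrow> adj j i"
    and g_K: "g (gen (VK h)) = f (gen (DK h))"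
    and g_D: "g (gen (VD s)) = f (gen (DD s))"
    and g_C: "g (gen (VC s)) = f (gen (DC s))"
    and g_X: "g (gen (vx s i r)) = f (d_tau r) * f (gen (DX s i r))"
    and g_PQ: "is_exp (Abs_fps (\<lambda>n. shape_sg p * f (h_series s i $ n)))
      (Abs_fps (\<lambda>n. shape_sg p ^ n * g (gen (vpq s p i n))))"
    and C_central: "f (gen (DC s)) * x = x * f (gen (DC s))"
    and C_inverse: "f (gen (DC Pos)) * f (gen (DC Neg)) = 1"
    and K_zero: "f (gen (DK (\<lambda>_. 0))) = 1"
    and K_add: "f (gen (DK h)) * f (gen (DK h')) = f (gen (DK (\<lambda>j. h j + h' j)))"
    and D_inverse: "f (gen (DD Pos)) * f (gen (DD Neg)) = 1" "f (gen (DD Neg)) * f (gen (DD Pos)) = 1"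
    and K_H: "m > 0 \<Longrightarrow> f (gen (DK h)) * f (d_h i (sg s * int m)) =
      f (d_h i (sg s * int m)) * f (gen (DK h))"
    and H_H: "m > 0 \<Longrightarrow> n > 0 \<Longrightarrow> f (d_h i (sg s * int m)) * f (d_h j (sg s * int n))
      = f (d_h j (sg s * int n)) * f (d_h i (sg s * int m))"
begin

sublocale f: unital_hom f by (fact f_hom)
sublocale g: unital_hom g by (fact g_hom)

abbreviation K :: "('i \<Rightarrow> int) \<Rightarrow> 'r" where "K h \<equiv> f (gen (DK h))"
abbreviation C :: "int \<Rightarrow> 'r" where "C k \<equiv> f (d_c k)"
abbreviation D :: "sign \<Rightarrow> 'r" where "D s \<equiv> f (gen (DD s))"
abbreviation X :: "sign \<Rightarrow> 'i \<Rightarrow> int \<Rightarrow> 'r" where "X s i r \<equiv> f (gen (DX s i r))"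
abbreviation H :: "sign \<Rightarrow> 'i \<Rightarrow> nat \<Rightarrow> 'r" where "H s i n \<equiv> f (d_h i (sg s * int n))"
abbreviation Y :: "sign \<Rightarrow> 'i \<Rightarrow> int \<Rightarrow> 'r" where "Y s i r \<equiv> g (gen (vx s i r))"
abbreviation PQ :: "sign \<Rightarrow> shape \<Rightarrow> 'i \<Rightarrow> nat \<Rightarrow> 'r" where "PQ s a i n \<equiv> g (gen (vpq s a i n))"
abbreviation PQb :: "sign \<Rightarrow> 'i \<Rightarrow> nat \<Rightarrow> 'r" where "PQb s i n \<equiv> g (vb s i n)"
abbreviation cart :: "'i \<Rightarrow> 'i \<Rightarrow> int" where "cart \<equiv> cartan adj"

lemma cart_cases: "i = j \<and> cart i j = 2 \<or> i \<noteq> j \<and> cart i j = - 1 \<or> i \<noteq> j \<and> cart i j = 0"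
  by (simp add: cartan_def)

lemma cart_sym: "cart i j = cart j i"
  using adj_sym by (auto simp: cartan_def)

lemma cart_same [simp]: "cart i i = 2"
  by (simp add: cartan_def)

section \<open>The central charge\<close>

lemma C_eq: "C k = (if 0 \<le> k then f (gen (DC Pos)) ^ nat k else f (gen (DC Neg)) ^ nat (- k))"
  by (simp add: d_c_def f.hom_power)

lemma g_C_eq: "g (v_c k) = C k"
  by (simp add: v_c_def d_c_def f.hom_power g.hom_power g_C)

lemma C_0 [simp]: "C 0 = 1" by (simp add: C_eq)

lemma C_comm: "C k * x = x * C k"
proof -
  have "y ^ n * x = x * y ^ n" if "\<And>x. y * x = x * y" for y :: 'r and n x
    using power_commuting_commutes[of y x n] that by simp
  then show ?thesis using C_central by (simp add: C_eq)
qed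

lemma C_add_1: "C (k + 1) = C k * C 1"
proof (cases "k \<ge> 0")
  case True
  then show ?thesis by (simp add: C_eq nat_add_distrib power_commutes)
next
  case False
  then have *: "nat (- k) = Suc (nat (- (k + 1)))" by simp
  have "f (gen (DC Neg)) * f (gen (DC Pos)) = 1"
    using C_inverse C_central[of Pos "f (gen (DC Neg))"] by simp
  then have "C k * C 1 = f (gen (DC Neg)) ^ nat (- (k + 1))"
    using False unfolding C_eq * power_Suc2 by (simp add: mult.assoc)
  then show ?thesis using False by (auto simp: C_eq)
qed

lemma C_add: "C (k + l) = C k * C l"
proof (induction l rule: int_induct[of _ 0])
  case (step1 l)
  then show ?case using C_add_1[of "k + l"] C_add_1[of l] by (simp add: add.assoc mult.assoc)
next
  case (step2 l)
  have "C (k + (l - 1)) * C 1 = C k * C (l - 1) * C 1"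
    using step2 C_add_1[of "k + (l - 1)"] C_add_1[of "l - 1"] by (simp add: mult.assoc)
  then have "C (k + (l - 1)) * (C 1 * C (- 1)) = C k * C (l - 1) * (C 1 * C (- 1))"
    by (simp flip: mult.assoc)
  moreover have "C 1 * C (- 1) = 1" by (simp add: C_eq C_inverse)
  ultimately show ?case by simp
qed simp

text \<open>Multiplication by \<open>q\<^bsup>kc/2\<^esup>\<close>, an action for the same reason as \<open>act\<close>.\<close>

definition cact :: "int \<Rightarrow> 'r \<Rightarrow> 'r" (infixr "\<triangleright>" 75) where
  "k \<triangleright> x = C k * x"

lemma cact_simps:
  "(k \<triangleright> x) * y = k \<triangleright> (x * y)" "x * (k \<triangleright> y) = k \<triangleright> (x * y)"
  "k \<triangleright> l \<triangleright> x = (k + l) \<triangleright> x" "0 \<triangleright> x = x" "k \<triangleright> 0 = 0"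
  "k \<triangleright> (x + y) = k \<triangleright> x + k \<triangleright> y" "k \<triangleright> (x - y) = k \<triangleright> x - k \<triangleright> y"
  "k \<triangleright> (- x) = - (k \<triangleright> x)" "k \<triangleright> (a \<odot> x) = a \<odot> (k \<triangleright> x)"
proof -
  show "x * (k \<triangleright> y) = k \<triangleright> (x * y)"
    using C_comm[of k x] by (simp add: cact_def flip: mult.assoc)
  show "k \<triangleright> (a \<odot> x) = a \<odot> (k \<triangleright> x)"
    by (simp add: cact_def act_simps)
qed (simp_all add: cact_def C_add algebra_simps)

lemma cact_cancel: "k \<triangleright> x = k \<triangleright> y \<longleftrightarrow> x = y"
proof
  assume "k \<triangleright> x = k \<triangleright> y"
  then have "(- k) \<triangleright> k \<triangleright> x = (- k) \<triangleright> k \<triangleright> y" by simp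
  then show "x = y" by (simp add: cact_simps)
qed simp

lemma f_simps: "f (scal a * x) = a \<odot> f x" "f (d_c k * y) = k \<triangleright> f y"
  by (simp_all add: f.hom_mult f_scal act_def cact_def)

lemma Y_eq: "Y s i r = (- qq) powi r \<odot> r \<triangleright> X s i r"
  by (simp add: g_X d_tau_def f.hom_mult f_scal act_def cact_def mult.assoc)

lemma X_eq: "X s i r = (- qq) powi (- r) \<odot> (- r) \<triangleright> Y s i r"
  by (simp add: Y_eq act_simps cact_simps flip: power_int_add)

section \<open>The Cartan generating series\<close>

text \<open>\<open>Phi s i n\<close> is \<open>\<psi>\<^sub>i\<^sup>s(sn)\<close> without its factor \<open>q\<^bsup>sh_i\<^esup>\<close>, and \<open>eta\<close> is the logarithm of the generating series of
  the \<open>Q\<^sub>i\<^sup>(\<^sup>n\<^sup>)\<close> or the \<open>P\<^sub>i\<^sup>(\<^sup>n\<^sup>)\<close>.\<close>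

definition Phi :: "sign \<Rightarrow> 'i \<Rightarrow> nat \<Rightarrow> 'r" where
  "Phi s i n = f (fexp (pos_series
     (\<lambda>n. scal (of_int (sg s) * (qq - inverse qq)) * d_h i (sg s * int n))) $ n)"

definition eta :: "sign \<Rightarrow> 'i \<Rightarrow> 'r fps" where
  "eta s i = Abs_fps (\<lambda>n. f (h_series s i $ n))"

lemma eta_nth: "eta s i $ n = (if n = 0 then 0 else (1 / qint (int n)) \<odot> H s i n)"
  by (simp add: eta_def h_series_def pos_series_def f.hom_zero f_simps)

lemma psi_eq: "f (d_psi s i $ n) = K (\<lambda>j. sg s * coroot i j) * Phi s i n"
  by (simp add: d_psi_def Phi_def f.hom_mult)

lemma Phi_0: "Phi s i 0 = 1"
  by (simp add: Phi_def fexp_def f.hom_mult f_scal sc.hom_one f.hom_one)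

lemma is_exp_Phi:
  "is_exp (Abs_fps (\<lambda>n. (of_int (sg s) * (qq - inverse qq)) \<odot> H s i n)) (Abs_fps (Phi s i))"
proof -
  define h where "h = Abs_fps (\<lambda>n. if n = 0 then 0 else (of_int (sg s) * (qq - inverse qq)) \<odot> H s i n)"
  have "Abs_fps (\<lambda>m. f (pos_series
      (\<lambda>n. scal (of_int (sg s) * (qq - inverse qq)) * d_h i (sg s * int n)) $ m)) = h"
    unfolding fps_eq_iff h_def pos_series_def by (simp add: f_simps f.hom_zero)
  then have Phi: "Abs_fps (Phi s i) = expo h"
    unfolding Phi_def hom_fexp[OF f_hom f_scal] by (simp add: fps_nth_inverse)
  have "is_exp h (expo h)"
    by (rule is_exp_expo) (auto simp: h_def act_simps H_H)
  then show ?thesis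
    unfolding Phi by (rule is_exp_cong) (simp add: h_def)
qed

lemma PQ_signed: "is_exp (Abs_fps (\<lambda>n. shape_sg a * eta s i $ n))
    (Abs_fps (\<lambda>n. shape_sg a ^ n * PQ s a i n))"
  using g_PQ[of a s i] by (simp add: eta_def)

lemma vb_eq: "PQb s i n =
    (\<Sum>m\<le>n. (((- qq) powi sg s) ^ m * qint (int m)) \<odot> (PQ s Col i (n - m) * PQ s Row i m))"
proof (cases s)
  case Neg
  have "(- qq :: 'k poly fract) powi (- int m) = ((- qq) powi (- 1)) ^ m" for m
    by (simp only: power_int_minus power_int_1_right power_int_of_nat power_inverse)
  then show ?thesis using Neg
    by (simp add: v_Pb_def g.hom_sum g_scal act_def mult.assoc g.hom_mult)
qed (simp add: v_Qb_def g.hom_sum g_scal act_def mult.assoc g.hom_mult)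

lemma eta_commute: "eta s i $ m * eta s j $ n = eta s j $ n * eta s i $ m"
  by (simp add: eta_nth act_simps H_H mult.commute)

lemma shape_sg_sq: "shape_sg a ^ n * shape_sg a ^ n = (1 :: 'a::ring_1)"
  by (cases a; cases "even n") simp_all

lemma shape_sg_comm: "shape_sg a ^ n * x = x * (shape_sg a ^ n :: 'a::ring_1)"
  by (cases a; cases "even n") simp_all

text \<open>The elements \<open>Q\<^sub>i\<^bsup>[1^n]\<^esup>\<close> and \<open>P\<^sub>i\<^bsup>[1^n]\<^esup>\<close> are rescaled Fourier modes of \<open>\<psi>\<^sub>i\<^sup>\<plusminus>\<close>: with \<open>t = (-q)\<^sup>\<plusminus>\<^sup>1\<close> and
  \<open>u = -q\<^sup>\<plusminus>\<^sup>2\<close> one has \<open>\<plusminus>(q - q\<^sup>-\<^sup>1) t\<^sup>m [m] = u\<^sup>m - (-1)\<^sup>m\<close>, so their generating series is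
  \<open>exp(\<eta>(uz) - \<eta>(-z)) - 1\<close> up to the factor \<open>\<plusminus>(q - q\<^sup>-\<^sup>1)\<close>, and the exponent equals that of \<open>Phi(tz)\<close>.\<close>

lemma Phi_vb:
  assumes "n > 0"
  shows "(of_int (sg s) * (qq - inverse qq)) \<odot> PQb s i n = ((- qq) powi sg s) ^ n \<odot> Phi s i n"
proof -
  define t u :: "'k poly fract" where "t = (- qq) powi sg s" and "u = - (qq powi (2 * sg s))"
  let ?e = "of_int (sg s) * (qq - inverse qq) :: 'k poly fract"
  have tu: "?e * (t ^ m * qint (int m)) = u ^ m - (- 1) ^ m" for m
  proof -
    define Q :: "'k poly fract" where "Q = qq ^ m"
    have "?e * (t ^ m * qint (int m)) = of_int (sg s) * (t ^ m * (Q - inverse Q))"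
      using qq_sub_inverse_neq_0[where ?'k='k]
      by (simp add: qint_def power_int_minus Q_def del: qq_sub_inverse_neq_0)
    also have "\<dots> = u ^ m - (- 1) ^ m"
    proof (cases s)
      case Pos
      have "t ^ m = (- 1) ^ m * Q" "u ^ m = (- 1) ^ m * (Q * Q)"
        by (simp_all add: Pos t_def u_def Q_def power_minus[of qq] power_minus[of "qq * qq"] power2_eq_square
            power_mult_distrib)
      then show ?thesis by (simp add: Pos Q_def right_diff_distrib)
    next
      case Neg
      have "t ^ m = (- 1) ^ m * inverse Q" "u ^ m = (- 1) ^ m * (inverse Q * inverse Q)"
        by (simp_all add: Neg t_def u_def Q_def power_minus[of "inverse qq"] power_int_minus
            power_minus[of "inverse qq * inverse qq"] power2_eq_square power_mult_distrib power_inverse)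
      then show ?thesis by (simp add: Neg Q_def right_diff_distrib)
    qed
    finally show ?thesis .
  qed
  have central: "sc a * x = x * sc a" for a x by (rule sc_central)
  have row: "is_exp (fps_scale (sc v) (eta s i)) (fps_scale (sc v) (Abs_fps (PQ s Row i)))" for v
    using is_exp_fps_scale[of "sc v", OF central PQ_signed[of Row s i]] by (simp add: fps_nth_inverse)
  have "is_exp (fps_scale (sc (- 1)) (Abs_fps (\<lambda>n. - eta s i $ n)))
      (fps_scale (sc (- 1)) (Abs_fps (\<lambda>n. (- 1) ^ n * PQ s Col i n)))"
    using is_exp_fps_scale[of "sc (- 1)", OF central PQ_signed[of Col s i]] by simp
  moreover have "fps_scale (sc (- 1)) (Abs_fps (\<lambda>n. (- 1) ^ n * PQ s Col i n)) = Abs_fps (PQ s Col i)"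
    using shape_sg_sq[of Col, where ?'a='r] by (simp add: fps_eq_iff sc.hom_simps flip: mult.assoc)
  ultimately have col: "is_exp (fps_scale (sc (- 1)) (Abs_fps (\<lambda>n. - eta s i $ n))) (Abs_fps (PQ s Col i))"
    by simp
  have prod: "is_exp (Abs_fps (\<lambda>n. (v ^ n - (- 1) ^ n) \<odot> eta s i $ n))
      (Abs_fps (PQ s Col i) * fps_scale (sc v) (Abs_fps (PQ s Row i)))" for v
  proof -
    have "eta s i $ m * PQ s Col i n = PQ s Col i n * eta s i $ m" for m n
    proof -
      have "eta s i $ m * fps_scale (sc (- 1)) (Abs_fps (\<lambda>n. - eta s i $ n)) $ n
        = fps_scale (sc (- 1)) (Abs_fps (\<lambda>n. - eta s i $ n)) $ n * eta s i $ m" for n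
        using eta_commute[of s i m i n] by (simp add: act_simps flip: act_def sc.hom_power)
      then show ?thesis using is_exp_commute[OF col, of "eta s i $ m"] by simp
    qed
    then have "theta (fps_scale (sc v) (eta s i)) * Abs_fps (PQ s Col i)
      = Abs_fps (PQ s Col i) * theta (fps_scale (sc v) (eta s i))"
      by (intro fps_mult_commute)
        (simp add: act_simps of_nat_left_commute mult.assoc flip: act_def sc.hom_power)
    from is_exp_mult[OF col row[of v] this] show ?thesis
      by (rule is_exp_cong) (simp add: act_diff_left act_def sc.hom_simps left_diff_distrib)
  qed
  have "(Abs_fps (PQ s Col i) * fps_scale (sc u) (Abs_fps (PQ s Row i))) = fps_scale (sc t) (Abs_fps (Phi s i))"
  proof (rule is_exp_unique[OF prod[of u] is_exp_fps_scale[of "sc t", OF central is_exp_Phi[of s i]]])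
    fix n :: nat assume n: "n > 0"
    then have "(u ^ n - (- 1) ^ n) * (1 / qint (int n)) = t ^ n * ?e"
      unfolding tu[symmetric] by simp
    then show "Abs_fps (\<lambda>n. (u ^ n - (- 1) ^ n) \<odot> eta s i $ n) $ n =
      fps_scale (sc t) (Abs_fps (\<lambda>n. ?e \<odot> H s i n)) $ n"
      using n by (simp add: eta_nth act_simps mult.commute[of "t ^ n"] flip: act_def sc.hom_power)
  qed
  moreover have "(Abs_fps (PQ s Col i) * fps_scale (sc (- 1)) (Abs_fps (PQ s Row i))) = 1"
    by (rule is_exp_unique[OF prod is_exp_zero]) (simp add: act_simps)
  moreover have "?e \<odot> PQb s i n = (Abs_fps (PQ s Col i) * fps_scale (sc u) (Abs_fps (PQ s Row i))) $ n
      - (Abs_fps (PQ s Col i) * fps_scale (sc (- 1)) (Abs_fps (PQ s Row i))) $ n"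
  proof -
    have "(Abs_fps (PQ s Col i) * fps_scale (sc v) (Abs_fps (PQ s Row i))) $ n
      = (\<Sum>m\<le>n. v ^ m \<odot> (PQ s Col i (n - m) * PQ s Row i m))" for v
    proof -
      have "(Abs_fps (PQ s Col i) * fps_scale (sc v) (Abs_fps (PQ s Row i))) $ n
        = (\<Sum>m=0..n. PQ s Col i m * (v ^ (n - m) \<odot> PQ s Row i (n - m)))"
        by (simp add: fps_mult_nth act_def sc.hom_simps)
      also have "\<dots> = (\<Sum>m\<le>n. PQ s Col i (n - m) * (v ^ m \<odot> PQ s Row i m))"
        by (rule sum.reindex_bij_witness[of _ "\<lambda>m. n - m" "\<lambda>m. n - m"]) auto
      finally show ?thesis by (simp add: act_simps)
    qed
    then show ?thesis
      by (simp only: vb_eq act_sum act_simps tu act_diff_left sum_subtractf t_def[symmetric])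
  qed
  ultimately show ?thesis using assms
    by (simp add: act_def sc.hom_simps t_def)
qed

end

lemma eval_root_zero [simp]: "eval_root adj (\<lambda>_. 0) i = 0"
  and eval_root_add: "eval_root adj (\<lambda>j. h j + h' j) i = eval_root adj h i + eval_root adj h' i"
  and eval_root_uminus: "eval_root adj (\<lambda>j. - h j) i = - eval_root adj h i"
  by (simp_all add: eval_root_def sum.distrib distrib_right sum_negf)

lemma eval_root_coroot: "eval_root adj (coroot j) i = cartan adj j i"
proof -
  have "coroot j k * cartan adj k i = (if k = j then cartan adj j i else 0)" for k
    by (simp add: coroot_def)
  then show ?thesis by (simp add: eval_root_def)
qed

lemma sum_permutes_2:
  "(\<Sum>\<sigma> | \<sigma> permutes {1, 2 :: nat}. F (\<sigma> 1) (\<sigma> 2)) = F 1 2 + (F 2 1 :: 'a::comm_monoid_add)"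
proof -
  have "{\<sigma>. \<sigma> permutes {1, 2 :: nat}} = {id, transpose 1 2}"
    using permutes_doubleton_iff[of _ 1 "2 :: nat"] by blast
  moreover have "id \<noteq> transpose 1 (2 :: nat)" by (auto simp: fun_eq_iff transpose_def)
  ultimately show ?thesis by (simp add: transpose_def)
qed

context two_realizations
begin

lemma sc_act: "sc a * x = a \<odot> x"
  by (simp add: act_def)

lemma C_act: "C k * x = k \<triangleright> x"
  by (simp add: cact_def)

lemmas f_eval = f.hom_mult f.hom_add f.hom_diff f.hom_minus f_scal sc_act C_act
lemmas g_eval = g.hom_mult g.hom_add g.hom_diff g.hom_minus g_scal g_C_eq sc_act C_act

section \<open>Rescaling of the currents\<close>

text \<open>Multiplication by \<open>\<tau>\<^sup>r\<close>. A relation homogeneous in the modes is rescaled as a whole.\<close>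

definition tact :: "int \<Rightarrow> 'r \<Rightarrow> 'r" where
  "tact r x = (- qq) powi r \<odot> r \<triangleright> x"

lemma Y_tact: "Y s i r = tact r (X s i r)"
  by (simp add: Y_eq tact_def)

lemma tact_simps:
  "tact r x * y = tact r (x * y)" "x * tact r y = tact r (x * y)"
  "tact r (tact l x) = tact (r + l) x" "tact r 0 = 0"
  "tact r (x + y) = tact r x + tact r y" "tact r (x - y) = tact r x - tact r y"
  "tact r (- x) = - tact r x" "tact r (a \<odot> x) = a \<odot> tact r x"
  by (simp_all add: tact_def act_simps cact_simps power_int_add mult.commute)

lemma tact_cancel: "tact r x = tact r y \<longleftrightarrow> x = y"
  by (simp add: tact_def act_cancel cact_cancel)

section \<open>Quadratic and Serre relations\<close>

text \<open>The relations of degree two between currents of equal sign, for equal and for adjacent indices at once.\<close>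

definition quad :: "sign \<Rightarrow> 'i \<Rightarrow> 'i \<Rightarrow> int \<Rightarrow> int \<Rightarrow> bool" where
  "quad s i j m n \<longleftrightarrow> (let p = qq powi (sg s * cart i j) in
     X s i m * X s j (n - 1) + X s j n * X s i (m - 1) =
     p \<odot> (X s i (m - 1) * X s j n + X s j (n - 1) * X s i m))"

lemma quad_drinfeld:
  assumes "p = qq powi (sg s * cart i j)"
  shows "f (lin2 1 (scal p) (\<lambda>k l. xc s i k * xc s j l) k l) =
      f (lin2 (scal p) 1 (\<lambda>k l. xc s j l * xc s i k) k l) \<longleftrightarrow> quad s i j (1 - k) (1 - l)"
proof -
  have "a - b = c - d \<longleftrightarrow> a + d = b + c" for a b c d :: 'r
    by (auto simp: algebra_simps)
  then show ?thesis
    by (simp add: quad_def lin2_def xc_def f_eval assms[symmetric] act_simps f.hom_one)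
qed

lemma quad_vertex_Pos:
  assumes "p = qq powi cart i j"
  shows "g (v_E i m * v_E j (n - 1) + v_E j n * v_E i (m - 1)) =
    g (scal p * (v_E i (m - 1) * v_E j n + v_E j (n - 1) * v_E i m)) \<longleftrightarrow> quad Pos i j m n"
proof -
  have Y: "g (v_E i r) = tact r (X Pos i r)" for i r
    using Y_tact[of Pos] by simp
  have "quad Pos i j m n \<longleftrightarrow> tact (m + (n - 1)) (X Pos i m * X Pos j (n - 1) + X Pos j n * X Pos i (m - 1)) =
    tact (m + (n - 1)) (p \<odot> (X Pos i (m - 1) * X Pos j n + X Pos j (n - 1) * X Pos i m))"
    unfolding tact_cancel by (simp add: quad_def assms)
  then show ?thesis
    by (simp add: g_eval Y tact_simps act_simps algebra_simps)
qed

lemma quad_vertex_Neg: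
  assumes "p = qq powi cart i j"
  shows "g (v_F i (m - 1) * v_F j n + v_F j (n - 1) * v_F i m) =
    g (scal p * (v_F j n * v_F i (m - 1) + v_F i m * v_F j (n - 1))) \<longleftrightarrow> quad Neg i j m n"
proof -
  have Y: "g (v_F i r) = tact r (X Neg i r)" for i r
    using Y_tact[of Neg] by simp
  have p: "qq powi (- cart i j) = inverse p" "p \<noteq> 0" using assms by (simp_all add: power_int_minus)
  have "quad Neg i j m n \<longleftrightarrow> p \<odot> (X Neg i m * X Neg j (n - 1) + X Neg j n * X Neg i (m - 1)) =
    X Neg i (m - 1) * X Neg j n + X Neg j (n - 1) * X Neg i m"
    using p by (simp add: quad_def act_eq_iff)
  also have "\<dots> \<longleftrightarrow> tact (m + (n - 1)) (X Neg i (m - 1) * X Neg j n + X Neg j (n - 1) * X Neg i m) =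
    tact (m + (n - 1)) (p \<odot> (X Neg i m * X Neg j (n - 1) + X Neg j n * X Neg i (m - 1)))"
    unfolding tact_cancel by auto
  finally show ?thesis
    by (simp add: g_eval Y tact_simps act_simps algebra_simps)
qed

text \<open>The relations between currents of equal sign for orthogonal and for adjacent indices. Both are instances of
  the Drinfeld relation with quantum binomials, for \<open>N = 1\<close> and \<open>N = 2\<close>.\<close>

definition far :: "sign \<Rightarrow> 'i \<Rightarrow> 'i \<Rightarrow> int \<Rightarrow> int \<Rightarrow> bool" where
  "far s i j m n \<longleftrightarrow> X s i m * X s j n = X s j n * X s i m"

definition serre :: "sign \<Rightarrow> 'i \<Rightarrow> 'i \<Rightarrow> int \<Rightarrow> int \<Rightarrow> int \<Rightarrow> bool" where
  "serre s i j n m m' \<longleftrightarrow>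
    X s j n * X s i m * X s i m' + X s i m * X s i m' * X s j n +
      (X s j n * X s i m' * X s i m + X s i m' * X s i m * X s j n) =
    qint 2 \<odot> (X s i m * X s j n * X s i m') + qint 2 \<odot> (X s i m' * X s j n * X s i m)"

lemma qbinomial_simps:
  "qbinomial 1 0 = (1 :: 'k poly fract)" "qbinomial 1 1 = (1 :: 'k poly fract)"
  "qbinomial 2 0 = (1 :: 'k poly fract)" "qbinomial 2 2 = (1 :: 'k poly fract)"
  "qbinomial 2 1 = (qint 2 :: 'k poly fract)"
proof -
  have f: "qfactorial 0 = (1 :: 'k poly fract)" "qfactorial 1 = (1 :: 'k poly fract)"
    "qfactorial 2 = (qint 2 :: 'k poly fract)"
    by (simp_all add: qfactorial_def numeral_2_eq_2)
  show "qbinomial 1 0 = (1 :: 'k poly fract)" "qbinomial 1 1 = (1 :: 'k poly fract)"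
    "qbinomial 2 0 = (1 :: 'k poly fract)" "qbinomial 2 2 = (1 :: 'k poly fract)"
    "qbinomial 2 1 = (qint 2 :: 'k poly fract)"
    using f by (simp_all add: qbinomial_def)
qed

lemma far_drinfeld:
  "f (\<Sum>\<sigma> | \<sigma> permutes {1..1}. \<Sum>s\<le>1.
      scal ((-1) ^ s * qbinomial 1 s) *
      (prod_list (map (\<lambda>p. xc t i (m (\<sigma> p))) [1..<Suc s]) * xc t j l *
       prod_list (map (\<lambda>p. xc t i (m (\<sigma> p))) [Suc s..<Suc 1]))) = f 0 \<longleftrightarrow>
   far t i j (- m 1) (- l)"
proof -
  have 11: "{\<sigma>. \<sigma> permutes {1..1 :: nat}} = {id}" by simp
  have 01: "{..1 :: nat} = {0, 1}" by auto
  have upt: "[1..<Suc 0] = []" "[1..<Suc 1] = [1]" "[Suc 0..<Suc 1] = [1]" "[Suc 1..<Suc 1] = []"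
    "[1..<2] = [1 :: nat]" "[Suc 0..<2] = [1]"
    by (simp_all add: upt_rec)
  have "f (\<Sum>\<sigma> | \<sigma> permutes {1..1}. \<Sum>s\<le>1.
      scal ((-1) ^ s * qbinomial 1 s) *
      (prod_list (map (\<lambda>p. xc t i (m (\<sigma> p))) [1..<Suc s]) * xc t j l *
       prod_list (map (\<lambda>p. xc t i (m (\<sigma> p))) [Suc s..<Suc 1]))) =
      X t j (- l) * X t i (- m 1) - X t i (- m 1) * X t j (- l)"
    unfolding 11 01
    by (simp add: upt qbinomial_simps xc_def f_eval act_simps f.hom_one f.hom_sum
        del: One_nat_def upt_Suc)
  then show ?thesis
    by (auto simp: far_def f.hom_zero)
qed

lemma serre_drinfeld:
  "f (\<Sum>\<sigma> | \<sigma> permutes {1..2}. \<Sum>s\<le>2.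
      scal ((-1) ^ s * qbinomial 2 s) *
      (prod_list (map (\<lambda>p. xc t i (m (\<sigma> p))) [1..<Suc s]) * xc t j l *
       prod_list (map (\<lambda>p. xc t i (m (\<sigma> p))) [Suc s..<Suc 2]))) = f 0 \<longleftrightarrow>
   serre t i j (- l) (- m 1) (- m 2)"
proof -
  have 12: "{1..2 :: nat} = {1, 2}" and 012: "{..2 :: nat} = {0, 1, 2}" by auto
  have upt: "[1..<Suc 0] = []" "[1..<Suc 1] = [1]" "[1..<Suc 2] = [1, 2]"
    "[Suc 0..<Suc 2] = [1, 2]" "[Suc 1..<Suc 2] = [2]" "[Suc 2..<Suc 2] = []"
    "[1..<3] = [1, 2 :: nat]" "[Suc 1..<3] = [2]" "[Suc 0..<3] = [1, 2]" "[1..<2] = [1 :: nat]" "[2..<3] = [2 :: nat]"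
    by (simp_all add: upt_rec)
  define F where "F a b = X t j (- l) * X t i (- m a) * X t i (- m b)
      - qint 2 \<odot> (X t i (- m a) * X t j (- l) * X t i (- m b))
      + X t i (- m a) * X t i (- m b) * X t j (- l)" for a b
  have "f (\<Sum>\<sigma> | \<sigma> permutes {1..2}. \<Sum>s\<le>2.
      scal ((-1) ^ s * qbinomial 2 s) *
      (prod_list (map (\<lambda>p. xc t i (m (\<sigma> p))) [1..<Suc s]) * xc t j l *
       prod_list (map (\<lambda>p. xc t i (m (\<sigma> p))) [Suc s..<Suc 2]))) =
      (\<Sum>\<sigma> | \<sigma> permutes {1, 2}. F (\<sigma> 1) (\<sigma> 2))"
    unfolding 12 012 f.hom_sum
    by (rule sum.cong[OF refl])
      (simp add: upt F_def qbinomial_simps xc_def f.hom_simps f_scal sc_act act_simps mult.assoc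
        flip: One_nat_def del: upt_Suc numeral_2_eq_2 Suc_1)
  also have "\<dots> = F 1 2 + F 2 1" by (rule sum_permutes_2)
  finally show ?thesis
    by (simp add: f.hom_zero serre_def F_def) (auto simp: algebra_simps)
qed

lemma far_vertex:
  "g (gen (vx s i m) * gen (vx s j n)) = g (gen (vx s j n) * gen (vx s i m)) \<longleftrightarrow> far s i j m n"
proof -
  have "far s i j m n \<longleftrightarrow> tact (m + n) (X s i m * X s j n) = tact (m + n) (X s j n * X s i m)"
    unfolding tact_cancel far_def ..
  then show ?thesis by (simp add: g.hom_mult Y_tact tact_simps add.commute)
qed

lemma serre_vertex:
  "g (\<Sum>\<sigma> | \<sigma> permutes {1, 2 :: nat}.
        gen (vx s j n) * gen (vx s i (m (\<sigma> 1))) * gen (vx s i (m (\<sigma> 2))) +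
        gen (vx s i (m (\<sigma> 1))) * gen (vx s i (m (\<sigma> 2))) * gen (vx s j n)) =
   g (\<Sum>\<sigma> | \<sigma> permutes {1, 2 :: nat}.
        scal (qint 2) * gen (vx s i (m (\<sigma> 1))) * gen (vx s j n) * gen (vx s i (m (\<sigma> 2)))) \<longleftrightarrow>
   serre s i j n (m 1) (m 2)"
proof -
  have "serre s i j n (m 1) (m 2) \<longleftrightarrow>
    tact (n + m 1 + m 2) (X s j n * X s i (m 1) * X s i (m 2) + X s i (m 1) * X s i (m 2) * X s j n +
      (X s j n * X s i (m 2) * X s i (m 1) + X s i (m 2) * X s i (m 1) * X s j n)) =
    tact (n + m 1 + m 2) (qint 2 \<odot> (X s i (m 1) * X s j n * X s i (m 2)) +
      qint 2 \<odot> (X s i (m 2) * X s j n * X s i (m 1)))"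
    unfolding tact_cancel serre_def ..
  moreover have "g (\<Sum>\<sigma> | \<sigma> permutes {1, 2 :: nat}.
        gen (vx s j n) * gen (vx s i (m (\<sigma> 1))) * gen (vx s i (m (\<sigma> 2))) +
        gen (vx s i (m (\<sigma> 1))) * gen (vx s i (m (\<sigma> 2))) * gen (vx s j n)) =
    tact (n + m 1 + m 2) (X s j n * X s i (m 1) * X s i (m 2) + X s i (m 1) * X s i (m 2) * X s j n +
      (X s j n * X s i (m 2) * X s i (m 1) + X s i (m 2) * X s i (m 1) * X s j n))"
    unfolding g.hom_sum
    by (subst sum_permutes_2[where F = "\<lambda>a b. g (gen (vx s j n) * gen (vx s i (m a)) * gen (vx s i (m b)) +
        gen (vx s i (m a)) * gen (vx s i (m b)) * gen (vx s j n))"])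
      (simp add: g.hom_add g.hom_mult Y_tact tact_simps add_ac)
  moreover have "g (\<Sum>\<sigma> | \<sigma> permutes {1, 2 :: nat}.
        scal (qint 2) * gen (vx s i (m (\<sigma> 1))) * gen (vx s j n) * gen (vx s i (m (\<sigma> 2)))) =
    tact (n + m 1 + m 2) (qint 2 \<odot> (X s i (m 1) * X s j n * X s i (m 2)) +
      qint 2 \<odot> (X s i (m 2) * X s j n * X s i (m 1)))"
    unfolding g.hom_sum
    by (subst sum_permutes_2[where F = "\<lambda>a b. g (scal (qint 2) * gen (vx s i (m a)) * gen (vx s j n) *
        gen (vx s i (m b)))"])
      (simp add: g_eval Y_tact tact_simps add_ac mult.assoc act_simps)
  ultimately show ?thesis by simp
qed

section \<open>The grading element\<close>

text \<open>The degrees of the root currents and of the Cartan elements with respect to \<open>q\<^sup>d\<close>.\<close>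

definition grade_X :: "sign \<Rightarrow> 'i \<Rightarrow> int \<Rightarrow> bool" where
  "grade_X s i r \<longleftrightarrow> D Pos * X s i r = qq powi r \<odot> (X s i r * D Pos)"

definition grade_H :: "sign \<Rightarrow> 'i \<Rightarrow> nat \<Rightarrow> bool" where
  "grade_H s i n \<longleftrightarrow> D Pos * H s i n = qq powi (sg s * int n) \<odot> (H s i n * D Pos)"

lemma D_conj: "D Pos * x * D Neg = a \<odot> x \<longleftrightarrow> D Pos * x = a \<odot> (x * D Pos)"
proof
  assume "D Pos * x * D Neg = a \<odot> x"
  then have "D Pos * x * D Neg * D Pos = (a \<odot> x) * D Pos" by simp
  then show "D Pos * x = a \<odot> (x * D Pos)"
    by (simp add: mult.assoc D_inverse act_simps)
qed (simp add: mult.assoc act_simps D_inverse)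

lemma grade_X_drinfeld:
  "f (d_d Pos * gen (DX s i r) * d_d Neg) = f (scal (qq powi r) * gen (DX s i r)) \<longleftrightarrow> grade_X s i r"
  by (simp add: f_eval D_conj grade_X_def)

lemma grade_X_vertex:
  "g (v_d Pos * gen (vx s i r) * v_d Neg) = g (scal (qq powi r) * gen (vx s i r)) \<longleftrightarrow> grade_X s i r"
  by (simp add: g_eval g_D D_conj Y_tact tact_simps tact_cancel grade_X_def
      flip: tact_simps(8))

lemma grade_H_drinfeld:
  "f (d_d Pos * d_h i (sg s * int n) * d_d Neg) =
    f (scal (qq powi (sg s * int n)) * d_h i (sg s * int n)) \<longleftrightarrow> grade_H s i n"
  by (simp add: f_eval D_conj grade_H_def)

lemma grade_H_vertex:
  "(\<forall>n. g (v_d Pos * gen (vpq s p i n) * v_d Neg) =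
    g (scal (qq powi (sg s * int n)) * gen (vpq s p i n))) \<longleftrightarrow> (\<forall>n>0. grade_H s i n)"
proof -
  let ?t = "qq powi sg s :: 'k poly fract"
  have t: "qq powi (sg s * int n) = ?t ^ n" for n
    by (simp add: power_int_mult)
  have sg: "shape_sg p ^ n * x = shape_sg p ^ n * y \<longleftrightarrow> x = y" for n and x y :: 'r
    by (cases p; cases "even n") simp_all
  have sg1: "D Pos * (shape_sg p ^ n * x) = shape_sg p ^ n * (D Pos * x)" for n x
    by (cases p; cases "even n") simp_all
  have sg2: "a \<odot> (shape_sg p ^ n * x) = shape_sg p ^ n * (a \<odot> x)" for n x a
    by (cases p; cases "even n") (simp_all add: act_simps)
  have sg3: "a \<odot> (shape_sg p * x) = shape_sg p * (a \<odot> x)" "D Pos * (shape_sg p * x) = shape_sg p * (D Pos * x)"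
     "shape_sg p * x = shape_sg p * y \<longleftrightarrow> x = y" for x a and y :: 'r
    by (cases p; simp add: act_simps)+
  have "g (v_d Pos * gen (vpq s p i n) * v_d Neg) = g (scal (qq powi (sg s * int n)) * gen (vpq s p i n))
      \<longleftrightarrow> D Pos * PQ s p i n = ?t ^ n \<odot> (PQ s p i n * D Pos)" for n
    by (simp add: g_eval g_D D_conj t)
  moreover have "D Pos * PQ s p i n = ?t ^ n \<odot> (PQ s p i n * D Pos) \<longleftrightarrow>
      D Pos * (shape_sg p ^ n * PQ s p i n) = ?t ^ n \<odot> (shape_sg p ^ n * PQ s p i n * D Pos)" for n
    by (simp only: mult.assoc sg1 sg2 sg)
  ultimately have "(\<forall>n. g (v_d Pos * gen (vpq s p i n) * v_d Neg) =
      g (scal (qq powi (sg s * int n)) * gen (vpq s p i n))) \<longleftrightarrow>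
    (\<forall>n. D Pos * (shape_sg p ^ n * PQ s p i n) = ?t ^ n \<odot> (shape_sg p ^ n * PQ s p i n * D Pos))"
    by simp
  also have "\<dots> \<longleftrightarrow> (\<forall>n>0. D Pos * (shape_sg p * eta s i $ n) = ?t ^ n \<odot> (shape_sg p * eta s i $ n * D Pos))"
    using is_exp_skew_commute[OF PQ_signed[of p s i], of "D Pos" ?t] by simp
  also have "\<dots> \<longleftrightarrow> (\<forall>n>0. grade_H s i n)"
  proof -
    have "D Pos * (shape_sg p * eta s i $ n) = ?t ^ n \<odot> (shape_sg p * eta s i $ n * D Pos)
        \<longleftrightarrow> grade_H s i n" if n: "n > 0" for n
    proof -
      let ?c = "1 / qint (int n) :: 'k poly fract"
      have "D Pos * (shape_sg p * eta s i $ n) = ?t ^ n \<odot> (shape_sg p * eta s i $ n * D Pos)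
        \<longleftrightarrow> D Pos * eta s i $ n = ?t ^ n \<odot> (eta s i $ n * D Pos)"
        by (simp only: mult.assoc sg3)
      also have "\<dots> \<longleftrightarrow> ?c \<odot> (D Pos * H s i n) = ?t ^ n \<odot> ?c \<odot> (H s i n * D Pos)"
        using n by (simp only: eta_nth act_simps(1,2) if_False neq0_conv[symmetric] simp_thms)
      also have "?t ^ n \<odot> ?c \<odot> (H s i n * D Pos) = ?c \<odot> ?t ^ n \<odot> (H s i n * D Pos)"
        by (simp only: act_simps(3) mult.commute[of "?t ^ n"])
      also have "?c \<odot> (D Pos * H s i n) = ?c \<odot> ?t ^ n \<odot> (H s i n * D Pos) \<longleftrightarrow> grade_H s i n"
        unfolding grade_H_def t using n by (intro act_cancel) simp
      finally show ?thesis .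
    qed
    then show ?thesis by blast
  qed
  finally show ?thesis .
qed

section \<open>Weights of the currents\<close>

text \<open>The commutation of \<open>q\<^sup>h\<close> with a root vector.\<close>

definition weight :: "('i \<Rightarrow> int) \<Rightarrow> sign \<Rightarrow> 'i \<Rightarrow> int \<Rightarrow> bool" where
  "weight h s i r \<longleftrightarrow> K h * X s i r = qq powi (sg s * eval_root adj h i) \<odot> (X s i r * K h)"

lemma K_uminus: "K (\<lambda>j. - h j) * K h = 1" "K h * K (\<lambda>j. - h j) = 1"
  by (simp_all add: K_add K_zero)

lemma K_cancel: "K h * x = K h * y \<longleftrightarrow> x = y"
  by (metis K_uminus(1) mult.assoc mult_1)

lemma K_conj: "K h * x * K (\<lambda>j. - h j) = a \<odot> x \<longleftrightarrow> K h * x = a \<odot> (x * K h)"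
proof
  assume "K h * x * K (\<lambda>j. - h j) = a \<odot> x"
  then have "K h * x * K (\<lambda>j. - h j) * K h = (a \<odot> x) * K h" by simp
  then show "K h * x = a \<odot> (x * K h)" by (simp add: mult.assoc K_uminus act_simps)
qed (simp add: mult.assoc act_simps K_uminus)

lemma weight_vertex:
  "g (v_q h * gen (vx s i r) * v_q (\<lambda>j. - h j)) =
    g (scal (qq powi (sg s * eval_root adj h i)) * gen (vx s i r)) \<longleftrightarrow> weight h s i r"
  by (simp add: g_eval g_K K_conj Y_tact tact_simps tact_cancel weight_def
      flip: tact_simps(8))

lemma weight_zero: "weight (\<lambda>_. 0) s i r"
  by (simp add: weight_def K_zero act_simps)

lemma weight_add:
  assumes "weight h s i r" "weight h' s i r"
  shows "weight (\<lambda>j. h j + h' j) s i r"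
proof -
  have "K h * (K h' * X s i r) = (qq powi (sg s * eval_root adj h' i) * qq powi (sg s * eval_root adj h i)) \<odot>
      (X s i r * (K h * K h'))"
    using assms by (simp add: weight_def act_simps) (simp add: act_simps flip: mult.assoc)
  then show ?thesis
    by (simp add: weight_def eval_root_add distrib_left power_int_add mult.commute K_add flip: mult.assoc)
qed

lemma weight_uminus:
  assumes "weight h s i r"
  shows "weight (\<lambda>j. - h j) s i r"
proof -
  let ?a = "qq powi (sg s * eval_root adj h i) :: 'k poly fract"
  have "K (\<lambda>j. - h j) * (K h * X s i r) * K (\<lambda>j. - h j) =
      ?a \<odot> (K (\<lambda>j. - h j) * X s i r * (K h * K (\<lambda>j. - h j)))"
    using assms by (simp add: weight_def act_simps mult.assoc)
  then have "X s i r * K (\<lambda>j. - h j) = ?a \<odot> (K (\<lambda>j. - h j) * X s i r)"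
    by (simp add: K_uminus flip: mult.assoc)
  then show ?thesis
    by (simp add: weight_def eval_root_uminus power_int_minus act_simps)
qed

text \<open>The Drinfeld relations only give this for coroots, which is enough since they span the coweights.\<close>

lemma weight_all:
  assumes coroots: "\<And>j. weight (coroot j) s i r"
  shows "weight h s i r"
proof -
  have multiple: "weight (\<lambda>k. n * coroot j k) s i r" for n j
  proof (induction n rule: int_induct[of _ 0])
    case base
    then show ?case by (simp add: weight_zero)
  next
    case (step1 n)
    then show ?case using weight_add[OF step1(2) coroots[of j]] by (simp add: distrib_right)
  next
    case (step2 n)
    then show ?case using weight_add[OF step2(2) weight_uminus[OF coroots[of j]]]
      by (simp add: left_diff_distrib)
  qed
  have "finite S \<Longrightarrow> weight (\<lambda>k. if k \<in> S then h k else 0) s i r" for S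
  proof (induction S rule: finite_induct)
    case (insert j S)
    have "(\<lambda>k. if k \<in> insert j S then h k else 0) =
        (\<lambda>k. h j * coroot j k + (if k \<in> S then h k else 0))"
      using insert(2) by (auto simp: coroot_def fun_eq_iff)
    then show ?case using weight_add[OF multiple insert(3), of "h j" j] by simp
  qed (simp add: weight_zero)
  from this[of UNIV] show ?thesis by simp
qed

section \<open>Cartan currents against root currents\<close>

text \<open>The Fourier modes of \<open>\<psi>\<^sub>i\<^sup>s\<close>, indexed so that \<open>psi_mode s i m\<close> has degree \<open>m\<close>.\<close>

definition psi_mode :: "sign \<Rightarrow> 'i \<Rightarrow> int \<Rightarrow> 'r" where
  "psi_mode s i m = (if sg s * m \<ge> 0 then K (\<lambda>j. sg s * coroot i j) * Phi s i (nat \<bar>m\<bar>) else 0)"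

lemma psic_eq: "f (psic s i k) = psi_mode s i (- k)"
  by (simp add: psic_def psi_mode_def psi_eq f.hom_zero)

text \<open>The relation between \<open>Phi\<close> (of sign \<open>t\<close>) and a root current (of sign \<open>s\<close>) to which the Drinfeld and the vertex
  relations both reduce once the factors \<open>q\<^sup>h\<close> are removed.\<close>

definition ladder :: "sign \<Rightarrow> sign \<Rightarrow> 'i \<Rightarrow> 'i \<Rightarrow> nat \<Rightarrow> int \<Rightarrow> bool" where
  "ladder t s i j n b \<longleftrightarrow> (let p = qq powi (sg t * sg s * cart i j) in
     sg s \<triangleright> (Phi t j (n + 1) * X s i b - X s i b * Phi t j (n + 1)) =
     p \<odot> (Phi t j n * X s i (b + sg t)) - inverse p \<odot> (X s i (b + sg t) * Phi t j n))"

text \<open>The coefficient of \<open>z\<^sup>k w\<^sup>l\<close> in the Drinfeld relation between \<open>\<psi>\<^sub>j\<^sup>t(z)\<close> and \<open>x\<^sub>i\<^sup>s(w)\<close>.\<close>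

definition drinfeld_ladder :: "sign \<Rightarrow> sign \<Rightarrow> 'i \<Rightarrow> 'i \<Rightarrow> int \<Rightarrow> int \<Rightarrow> bool" where
  "drinfeld_ladder t s i j k l \<longleftrightarrow>
    f (lin2 (d_c (sg s * sg t)) (scal (qq powi (sg s * cart i j)))
            (\<lambda>k l. psic t j k * xc s i l) k l) =
    f (lin2 (scal (qq powi (sg s * cart i j)) * d_c (sg s * sg t)) 1
            (\<lambda>k l. xc s i l * psic t j k) k l)"

lemma drinfeld_ladder_eq:
  assumes "p = qq powi (sg s * cart i j)"
  shows "drinfeld_ladder t s i j k l \<longleftrightarrow>
    (sg s * sg t) \<triangleright> (psi_mode t j (1 - k) * X s i (- l)) - p \<odot> (psi_mode t j (- k) * X s i (1 - l)) =
    p \<odot> (sg s * sg t) \<triangleright> (X s i (- l) * psi_mode t j (1 - k)) - X s i (1 - l) * psi_mode t j (- k)"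
  by (simp add: drinfeld_ladder_def lin2_def f_eval psic_eq xc_def f.hom_one act_simps
      flip: assms)

text \<open>The extreme mode involves only \<open>\<psi>\<^sub>j\<^sup>+(0) = q\<^bsup>h_j\<^esup>\<close>; this is where the weights come from.\<close>

lemma drinfeld_ladder_boundary:
  "drinfeld_ladder Pos s i j 1 l \<longleftrightarrow> weight (coroot j) s i (- l)"
proof -
  have "drinfeld_ladder Pos s i j 1 l \<longleftrightarrow>
    sg s \<triangleright> (K (coroot j) * X s i (- l)) = sg s \<triangleright> (qq powi (sg s * cart i j) \<odot> (X s i (- l) * K (coroot j)))"
    by (simp add: drinfeld_ladder_eq[OF refl] psi_mode_def Phi_0 act_simps cact_simps)
  then show ?thesis
    by (simp add: cact_cancel weight_def eval_root_coroot cart_sym[of i j])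
qed

lemma weight_coroot:
  assumes "\<And>h. weight h s i r"
  shows "X s i r * (K (\<lambda>k. sg t * coroot j k) * x) =
    qq powi (- (sg t * sg s * cart i j)) \<odot> (K (\<lambda>k. sg t * coroot j k) * (X s i r * x))"
proof -
  let ?h = "\<lambda>k. sg t * coroot j k"
  have "eval_root adj ?h i = sg t * cart i j"
    by (cases t) (simp_all add: eval_root_uminus eval_root_coroot cart_sym[of i j])
  then have "K ?h * X s i r = qq powi (sg t * sg s * cart i j) \<odot> (X s i r * K ?h)"
    using assms[of ?h] by (simp add: weight_def mult.assoc mult.left_commute)
  then have "qq powi (- (sg t * sg s * cart i j)) \<odot> (K ?h * X s i r) = X s i r * K ?h"
    by (simp add: act_simps flip: power_int_add)
  then have "(qq powi (- (sg t * sg s * cart i j)) \<odot> (K ?h * X s i r)) * x = X s i r * K ?h * x"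
    by simp
  then show ?thesis by (simp add: act_simps mult.assoc)
qed

lemma drinfeld_ladder_Pos:
  assumes w: "\<And>h r. weight h s i r"
  shows "drinfeld_ladder Pos s i j (- int n) l \<longleftrightarrow> ladder Pos s i j n (- l)"
proof -
  define p :: "'k poly fract" where "p = qq powi (sg s * cart i j)"
  have p: "p \<noteq> 0" "qq powi (- (sg s * cart i j)) = inverse p"
    by (simp_all add: p_def power_int_minus)
  note com = weight_coroot[where t = Pos, OF w, unfolded sg.simps mult_1, unfolded p]
  have n: "nat (1 + int n) = Suc n" by simp
  have "drinfeld_ladder Pos s i j (- int n) l \<longleftrightarrow>
    K (coroot j) * (sg s \<triangleright> (Phi Pos j (n + 1) * X s i (- l)) - p \<odot> (Phi Pos j n * X s i (1 - l))) =
    K (coroot j) * (sg s \<triangleright> (X s i (- l) * Phi Pos j (n + 1)) - inverse p \<odot> (X s i (1 - l) * Phi Pos j n))"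
    unfolding drinfeld_ladder_eq[OF p_def]
    by (simp add: psi_mode_def n com act_simps cact_simps p right_diff_distrib mult.assoc)
  also have "\<dots> \<longleftrightarrow> ladder Pos s i j n (- l)"
    unfolding K_cancel by (auto simp: ladder_def Let_def cact_simps algebra_simps simp flip: p_def)
  finally show ?thesis .
qed

lemma drinfeld_ladder_Neg:
  assumes w: "\<And>h r. weight h s i r"
  shows "drinfeld_ladder Neg s i j (int n + 1) l \<longleftrightarrow> ladder Neg s i j n (1 - l)"
proof -
  define p :: "'k poly fract" where "p = qq powi (sg s * cart i j)"
  have p: "p \<noteq> 0" "qq powi (- (sg s * cart i j)) = inverse p"
    by (simp_all add: p_def power_int_minus)
  let ?K = "K (\<lambda>k. - coroot j k)"
  have com: "X s i r * (?K * x) = p \<odot> (?K * (X s i r * x))" for r x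
    using weight_coroot[where t = Neg, OF w] by (simp add: p_def)
  have n: "nat (1 + int n) = Suc n" by simp
  have "drinfeld_ladder Neg s i j (int n + 1) l \<longleftrightarrow>
    ?K * ((- sg s) \<triangleright> (Phi Neg j n * X s i (- l)) - p \<odot> (Phi Neg j (n + 1) * X s i (1 - l))) =
    ?K * ((p * p) \<odot> (- sg s) \<triangleright> (X s i (- l) * Phi Neg j n) - p \<odot> (X s i (1 - l) * Phi Neg j (n + 1)))"
    unfolding drinfeld_ladder_eq[OF p_def]
    by (simp add: psi_mode_def n com act_simps cact_simps right_diff_distrib mult.assoc)
  also have "\<dots> \<longleftrightarrow> p \<odot> (Phi Neg j (n + 1) * X s i (1 - l) - X s i (1 - l) * Phi Neg j (n + 1)) =
    (- sg s) \<triangleright> (Phi Neg j n * X s i (- l) - (p * p) \<odot> (X s i (- l) * Phi Neg j n))"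
    unfolding K_cancel by (auto simp: act_simps cact_simps algebra_simps)
  also have "\<dots> \<longleftrightarrow> sg s \<triangleright> inverse p \<odot> p \<odot> (Phi Neg j (n + 1) * X s i (1 - l) - X s i (1 - l) * Phi Neg j (n + 1)) =
    sg s \<triangleright> inverse p \<odot> (- sg s) \<triangleright> (Phi Neg j n * X s i (- l) - (p * p) \<odot> (X s i (- l) * Phi Neg j n))"
    unfolding cact_cancel using p(1) by (subst act_cancel) simp_all
  also have "\<dots> \<longleftrightarrow> ladder Neg s i j n (1 - l)"
  proof -
    have pp: "inverse p * (p * p) = p" using p(1) by simp
    show ?thesis using p(1) by (simp add: ladder_def Let_def act_simps cact_simps p(2) pp)
  qed
  finally show ?thesis .
qed

lemma drinfeld_ladder_all:
  assumes w: "\<And>h r. weight h s i r" and l: "\<And>n b. ladder t s i j n b"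
  shows "drinfeld_ladder t s i j k l"
proof (cases t)
  case Pos
  consider "k > 1" | "k = 1" | n where "k = - int n"
    by (metis int_one_le_iff_zero_less linorder_neqE_linordered_idom nonpos_int_cases not_le zle_iff_zadd zero_le_one zless_add1_eq add_0)
  then show ?thesis
  proof cases
    case 1
    then show ?thesis by (simp add: Pos drinfeld_ladder_eq[OF refl] psi_mode_def act_simps cact_simps)
  qed (use Pos w l drinfeld_ladder_boundary drinfeld_ladder_Pos[OF w] in auto)
next
  case Neg
  consider "k < 0" | "k = 0" | n where "k = int n + 1"
    by (metis add.commute linorder_neqE_linordered_idom zless_iff_Suc_zadd of_nat_Suc add_0)
  then show ?thesis
  proof cases
    case 1
    then show ?thesis by (simp add: Neg drinfeld_ladder_eq[OF refl] psi_mode_def act_simps cact_simps)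
  next
    case 2
    then show ?thesis
      using weight_coroot[where t = Neg, OF w, of "1 - l" j 1]
      by (simp add: Neg drinfeld_ladder_eq[OF refl] psi_mode_def act_simps cact_simps Phi_0)
  next
    case 3
    then show ?thesis using Neg l drinfeld_ladder_Neg[OF w] by simp
  qed
qed

lemma tact_shift: "tact (b + sg t) x = (- qq) powi sg t \<odot> sg t \<triangleright> tact b x"
  by (simp add: tact_def act_simps cact_simps power_int_add mult.commute add.commute)

lemma vb_eq_Phi:
  assumes "n > 0"
  shows "PQb t j n =
    (inverse (of_int (sg t) * (qq - inverse qq)) * ((- qq) powi sg t) ^ n) \<odot> Phi t j n"
proof -
  have "of_int (sg t) * (qq - inverse qq) \<noteq> (0 :: 'k poly fract)"
    using qq_sub_inverse_neq_0[where ?'k='k] by (cases t) (simp_all del: qq_sub_inverse_neq_0)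
  then show ?thesis using Phi_vb[OF assms, of t j] by (simp add: act_eq_iff act_simps)
qed

lemma ladder_vertex:
  assumes n: "n > 0" and p: "p = qq powi (sg t * sg s * cart i j)" and "c = sg s + sg t"
  shows "c \<triangleright> (PQb t j (n + 1) * Y s i b - Y s i b * PQb t j (n + 1)) =
     p \<odot> (PQb t j n * Y s i (b + sg t)) - inverse p \<odot> (Y s i (b + sg t) * PQb t j n) \<longleftrightarrow>
     ladder t s i j n b"
proof -
  define e :: "'k poly fract" where "e = inverse (of_int (sg t) * (qq - inverse qq)) * ((- qq) powi sg t) ^ (n + 1)"
  have e: "e \<noteq> 0" using qq_sub_inverse_neq_0[where ?'k='k]
    by (cases t) (simp_all add: e_def del: qq_sub_inverse_neq_0)
  have 1: "PQb t j (n + 1) = e \<odot> Phi t j (n + 1)"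
    unfolding e_def by (rule vb_eq_Phi) simp
  have 2: "(- qq) powi sg t \<odot> PQb t j n = e \<odot> Phi t j n"
    unfolding e_def vb_eq_Phi[OF n] by (simp add: act_simps mult_ac)
  have 3: "x * Y s i (b + sg t) = sg t \<triangleright> tact b (((- qq) powi sg t \<odot> x) * X s i (b + sg t))"
     "Y s i (b + sg t) * x = sg t \<triangleright> tact b (X s i (b + sg t) * ((- qq) powi sg t \<odot> x))" for x
    unfolding Y_tact by (simp_all add: tact_simps tact_shift act_simps cact_simps)
  have "c \<triangleright> (PQb t j (n + 1) * Y s i b - Y s i b * PQb t j (n + 1)) =
    e \<odot> sg t \<triangleright> tact b (sg s \<triangleright> (Phi t j (n + 1) * X s i b - X s i b * Phi t j (n + 1)))"
    unfolding 1 Y_tact assms(3)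
    by (simp add: tact_simps act_simps cact_simps) (simp add: tact_def act_simps cact_simps add_ac)
  moreover have "p \<odot> (PQb t j n * Y s i (b + sg t)) - inverse p \<odot> (Y s i (b + sg t) * PQb t j n) =
    e \<odot> sg t \<triangleright> tact b (p \<odot> (Phi t j n * X s i (b + sg t)) - inverse p \<odot> (X s i (b + sg t) * Phi t j n))"
    unfolding 3 2
    by (simp add: tact_simps act_simps cact_simps mult.commute)
  ultimately show ?thesis using e
    by (simp add: act_cancel cact_cancel tact_cancel ladder_def Let_def p)
qed

lemma ladder_vertex_0:
  assumes "p = of_int (sg s) * qint (cart i j)" and "c = sg s + sg t"
  shows "c \<triangleright> (PQb t j 1 * Y s i b - Y s i b * PQb t j 1) = p \<odot> Y s i (b + sg t) \<longleftrightarrow>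
     ladder t s i j 0 b"
proof -
  define e :: "'k poly fract" where "e = inverse (of_int (sg t) * (qq - inverse qq)) * ((- qq) powi sg t) ^ 1"
  have nz: "of_int (sg t) * (qq - inverse qq) \<noteq> (0 :: 'k poly fract)"
    using qq_sub_inverse_neq_0[where ?'k='k] by (cases t) (simp_all del: qq_sub_inverse_neq_0)
  then have e: "e \<noteq> 0" by (simp add: e_def)
  have 1: "PQb t j 1 = e \<odot> Phi t j 1"
    unfolding e_def by (rule vb_eq_Phi) simp
  have "c \<triangleright> (PQb t j 1 * Y s i b - Y s i b * PQb t j 1) =
    e \<odot> sg t \<triangleright> tact b (sg s \<triangleright> (Phi t j 1 * X s i b - X s i b * Phi t j 1))"
    unfolding 1 Y_tact assms(2)
    by (simp add: tact_simps act_simps cact_simps) (simp add: tact_def act_simps cact_simps add_ac)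
  moreover define u where "u = (qq powi (sg t * sg s * cart i j) - inverse (qq powi (sg t * sg s * cart i j)) :: 'k poly fract)"
  have "p \<odot> Y s i (b + sg t) = e \<odot> sg t \<triangleright> tact b (u \<odot> X s i (b + sg t))"
  proof -
    define P d :: "'k poly fract" where "P = qq powi cart i j" and "d = qq - inverse qq"
    have d: "d \<noteq> 0" unfolding d_def by (rule qq_sub_inverse_neq_0)
    have "qint (cart i j) = (P - inverse P) / d"
      by (simp add: qint_def P_def d_def power_int_minus)
    moreover have "u = of_int (sg t) * (of_int (sg s) * (P - inverse P))"
      by (cases s; cases t) (simp_all add: u_def P_def power_int_minus)
    ultimately have "u = of_int (sg t) * d * p"
      using d by (simp add: assms(1))
    then have "u = of_int (sg t) * (qq - inverse qq) * p" by (simp only: d_def)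
    moreover define E :: "'k poly fract" where "E = of_int (sg t) * (qq - inverse qq)"
    ultimately have "e * u = inverse E * (- qq) powi sg t * (E * p)"
      by (simp only: e_def power_one_right)
    moreover have "E \<noteq> 0" unfolding E_def by (rule nz)
    ultimately have "e * u = p * (- qq) powi sg t" by simp
    then show ?thesis
      unfolding Y_tact tact_shift by (simp add: tact_simps act_simps cact_simps)
  qed
  ultimately show ?thesis using e
    by (simp add: act_cancel cact_cancel tact_cancel ladder_def Let_def Phi_0 u_def act_diff_left)
qed

text \<open>For orthogonal indices the ladder relates \<open>[Phi\<^sub>n\<^sub>+\<^sub>1, X]\<close> to \<open>[Phi\<^sub>n, X]\<close>, so all of them vanish with the
  first, which is trivial as \<open>Phi\<^sub>0 = 1\<close>.\<close>

lemma ladder_far: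
  assumes "cart i j = 0"
  shows "(\<forall>n b. ladder t s i j n b) \<longleftrightarrow> (\<forall>n>0. \<forall>b. PQb t j n * Y s i b = Y s i b * PQb t j n)"
proof -
  have com: "PQb t j n * Y s i b = Y s i b * PQb t j n \<longleftrightarrow> Phi t j n * X s i b = X s i b * Phi t j n"
    if n: "n > 0" for n b
  proof -
    define e :: "'k poly fract" where "e = inverse (of_int (sg t) * (qq - inverse qq)) * ((- qq) powi sg t) ^ n"
    have "e \<noteq> 0" using qq_sub_inverse_neq_0[where ?'k='k]
      by (cases t) (simp_all add: e_def del: qq_sub_inverse_neq_0)
    then show ?thesis
      unfolding vb_eq_Phi[OF n] Y_tact e_def[symmetric]
      by (simp add: tact_simps act_simps act_cancel tact_cancel)
  qed
  have lad: "ladder t s i j n b \<longleftrightarrow>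
    sg s \<triangleright> (Phi t j (n + 1) * X s i b - X s i b * Phi t j (n + 1)) =
    Phi t j n * X s i (b + sg t) - X s i (b + sg t) * Phi t j n" for n b
    by (simp add: ladder_def assms act_simps)
  have "(\<forall>n b. ladder t s i j n b) \<longleftrightarrow> (\<forall>n b. Phi t j n * X s i b = X s i b * Phi t j n)"
  proof
    assume l: "\<forall>n b. ladder t s i j n b"
    have "\<forall>b. Phi t j n * X s i b = X s i b * Phi t j n" for n
    proof (induction n)
      case (Suc n)
      show ?case
      proof
        fix b
        have "sg s \<triangleright> (Phi t j (n + 1) * X s i b - X s i b * Phi t j (n + 1)) = sg s \<triangleright> 0"
          using l Suc by (simp add: lad cact_simps(5))
        then show "Phi t j (Suc n) * X s i b = X s i b * Phi t j (Suc n)"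
          unfolding cact_cancel by simp
      qed
    qed (simp add: Phi_0)
    then show "\<forall>n b. Phi t j n * X s i b = X s i b * Phi t j n" by blast
  qed (simp add: lad cact_simps)
  also have "\<dots> \<longleftrightarrow> (\<forall>n>0. \<forall>b. PQb t j n * Y s i b = Y s i b * PQb t j n)"
    using com Phi_0 by (metis mult_1 mult_1_right neq0_conv)
  finally show ?thesis .
qed

section \<open>The commutator of opposite root currents\<close>

text \<open>The Drinfeld relation between \<open>e\<^bsub>i,a\<^esub>\<close> and \<open>f\<^bsub>j,b\<^esub>\<close>.\<close>

definition opposite :: "'i \<Rightarrow> 'i \<Rightarrow> int \<Rightarrow> int \<Rightarrow> bool" where
  "opposite i j a b \<longleftrightarrow> X Pos i a * X Neg j b - X Neg j b * X Pos i a =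
    (if i = j then (1 / (qq - inverse qq)) \<odot>
      ((a - b) \<triangleright> psi_mode Pos i (a + b) - (b - a) \<triangleright> psi_mode Neg i (a + b)) else 0)"

lemma opposite_drinfeld:
  "f (commutator (xc Pos i k) (xc Neg j l)) =
   f (if i = j then
            scal (1 / (qq - inverse qq)) *
              (d_c (-2 * k) * d_c (k + l) * psic Pos i (k + l)
               - d_c (-2 * l) * d_c (k + l) * psic Neg i (k + l))
          else 0) \<longleftrightarrow> opposite i j (- k) (- l)"
  by (simp add: commutator_def opposite_def xc_def f_eval psic_eq f.hom_zero mult.assoc cact_simps)

lemma YY: "g (commutator (v_E i a) (v_F j b)) =
    tact (a + b) (X Pos i a * X Neg j b - X Neg j b * X Pos i a)"
  using Y_tact[of Pos i a] Y_tact[of Neg j b]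
  by (simp add: commutator_def g_eval tact_simps add.commute)

lemma opposite_eq:
  "opposite i i a b \<longleftrightarrow> tact (a + b) (X Pos i a * X Neg i b - X Neg i b * X Pos i a) =
    ((- qq) powi (a + b) * (1 / (qq - inverse qq))) \<odot>
      ((2 * a) \<triangleright> psi_mode Pos i (a + b) - (2 * b) \<triangleright> psi_mode Neg i (a + b))"
proof -
  have "opposite i i a b \<longleftrightarrow> tact (a + b) (X Pos i a * X Neg i b - X Neg i b * X Pos i a) =
    tact (a + b) ((1 / (qq - inverse qq)) \<odot>
      ((a - b) \<triangleright> psi_mode Pos i (a + b) - (b - a) \<triangleright> psi_mode Neg i (a + b)))"
    by (simp add: tact_cancel opposite_def)
  then show ?thesis
    by (simp add: tact_def act_simps cact_simps)
qed

lemma opposite_pos: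
  assumes "a + b > 0"
  shows "g (commutator (v_E i a) (v_F i b)) =
    g (v_c (2 * a) * v_q (coroot i) * v_Qb i (nat (a + b))) \<longleftrightarrow> opposite i i a b"
proof -
  have "PQb Pos i (nat (a + b)) = ((- qq) powi (a + b) * (1 / (qq - inverse qq))) \<odot> Phi Pos i (nat (a + b))"
    using assms by (subst vb_eq_Phi) (simp_all add: power_int_def divide_inverse mult.commute)
  then show ?thesis
    using assms unfolding opposite_eq YY
    by (simp add: g_eval g_K psi_mode_def act_simps cact_simps mult.assoc)
qed

lemma opposite_neg:
  assumes "a + b < 0"
  shows "g (commutator (v_E i a) (v_F i b)) =
    g (v_c (2 * b) * v_q (\<lambda>j. - coroot i j) * v_Pb i (nat (- a - b))) \<longleftrightarrow> opposite i i a b"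
proof -
  have n: "nat \<bar>a + b\<bar> = nat (- a - b)" using assms by simp
  have pow: "((- qq) powi (- 1)) ^ nat (- a - b) = (- qq :: 'k poly fract) powi (a + b)"
    using assms by (simp add: power_int_def power_inverse)
  have "PQb Neg i (nat (- a - b)) = - (((- qq) powi (a + b) * (1 / (qq - inverse qq))) \<odot> Phi Neg i (nat (- a - b)))"
  proof -
    define d :: "'k poly fract" where "d = qq - inverse qq"
    have "PQb Neg i (nat (- a - b)) =
        (inverse (- d) * (- qq) powi (a + b)) \<odot> Phi Neg i (nat (- a - b))"
    proof -
      have "of_int (sg Neg) * (qq - inverse qq) = - d" by (simp add: d_def)
      moreover have "nat (- a - b) > 0" using assms by simp
      ultimately show ?thesis by (simp only: vb_eq_Phi sg.simps pow)
    qed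
    then show ?thesis unfolding d_def[symmetric] by (simp add: divide_inverse mult.commute act_simps)
  qed
  then show ?thesis
    using assms unfolding opposite_eq YY
    by (simp add: g_eval g_K psi_mode_def act_simps cact_simps mult.assoc n)
qed

lemma opposite_zero:
  assumes "a + b = 0"
  shows "g (commutator (v_E i a) (v_F i b)) =
    g (scal (1 / (qq - inverse qq)) *
        (v_c (2 * a) * v_q (coroot i) - v_c (- 2 * a) * v_q (\<lambda>j. - coroot i j))) \<longleftrightarrow> opposite i i a b"
proof -
  have b: "b = - a" using assms by simp
  show ?thesis
    unfolding opposite_eq YY b
    by (simp add: g_eval g_K psi_mode_def act_simps cact_simps Phi_0)
qed

lemma opposite_neq:
  assumes "i \<noteq> j"
  shows "g (commutator (v_E i a) (v_F j b)) = g 0 \<longleftrightarrow> opposite i j a b"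
  using assms tact_cancel[of "a + b" _ 0] unfolding YY tact_simps(4) by (simp add: opposite_def g.hom_zero)

section \<open>The Heisenberg relations\<close>

text \<open>\<open>charge k\<close> is \<open>q\<^bsup>kc\<^esup> - q\<^bsup>-kc\<^esup>\<close>.\<close>

definition charge :: "nat \<Rightarrow> 'r" where
  "charge k = C (2 * int k) - C (- 2 * int k)"

lemma act_charge_central: "(a \<odot> charge k) * x = x * (a \<odot> charge k)"
  using C_comm by (simp add: act_simps charge_def algebra_simps)

text \<open>The bracket of the logarithms \<open>h\<^bsub>j,k\<^esub> / [k]\<close> and \<open>h\<^bsub>i,-k\<^esub> / [k]\<close> when \<open>\<langle>i,j\<rangle> = a\<close>.\<close>

definition bracket :: "int \<Rightarrow> 'r fps" where
  "bracket a = Abs_fps (\<lambda>k. (qint (a * int k) / (qint (int k) * of_nat k *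
     (qq powi int k - qq powi (- int k)))) \<odot> charge k)"

text \<open>The bracket of \<open>h\<^bsub>j,k\<^esub>\<close> with \<open>h\<^bsub>i,-l\<^esub>\<close>, written for the rescaled elements \<open>eta\<close>.\<close>

definition heisenberg :: "'i \<Rightarrow> 'i \<Rightarrow> bool" where
  "heisenberg i j \<longleftrightarrow> (\<forall>k>0. \<forall>l>0. eta Pos j $ k * eta Neg i $ l =
     eta Neg i $ l * eta Pos j $ k + (if k = l then bracket (cart i j) $ k else 0))"

lemma bracket_central: "bracket a $ k * x = x * bracket a $ k"
  by (simp add: bracket_def act_charge_central)

lemma is_exp_central:
  assumes "is_exp a A" "\<And>n x. a $ n * x = x * (a $ n :: 'r)"
  shows "A $ n * x = x * A $ n"
  using is_exp_commute[OF assms(1), of x] assms(2) by metis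

text \<open>Replacing rows by columns negates the logarithm of the signed generating series. So for shapes \<open>p\<close> and
  \<open>p'\<close> with product \<open>e\<close> of signs, the exchange coefficients \<open>c\<^sub>k\<close> satisfy
  \<open>\<Sum> e\<^sup>k c\<^sub>k z\<^sup>k = exp(e \<cdot> bracket)\<close>.\<close>

lemma heisenberg_vertex:
  fixes c :: "nat \<Rightarrow> 'r" and p p' :: shape
  defines "e \<equiv> shape_sg p * shape_sg p' :: 'r"
  assumes c: "is_exp (Abs_fps (\<lambda>k. e * bracket (cart i j) $ k)) (Abs_fps (\<lambda>k. e ^ k * c k))"
  shows "(\<forall>m n. PQ Pos p j n * PQ Neg p' i m =
      (\<Sum>k\<le>min m n. c k * PQ Neg p' i (m - k) * PQ Pos p j (n - k))) \<longleftrightarrow> heisenberg i j"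
proof -
  let ?s = "shape_sg p :: 'r" and ?s' = "shape_sg p' :: 'r"
  have sgs: "?s = 1 \<or> ?s = - 1" "?s' = 1 \<or> ?s' = - 1" "e = 1 \<or> e = - 1"
    by (cases p; cases p'; simp add: e_def)+
  have central: "e * bracket (cart i j) $ k * x = x * (e * bracket (cart i j) $ k)" for k x
    using sgs(3) bracket_central[of "cart i j" k x] by auto
  have G_central: "e ^ k * c k * x = x * (e ^ k * c k)" for k x
    using is_exp_central[OF c, of k x] central by simp
  have pow: "?s ^ n * ?s' ^ m * x = (e ^ k * ?s' ^ (m - k) * ?s ^ (n - k)) * x"
    if "k \<le> min m n" for k m n x
    using that
    by (cases p; cases p'; cases "even k"; cases "even m"; cases "even n"; simp add: e_def)
  have "(\<forall>m n. ?s ^ n * PQ Pos p j n * (?s' ^ m * PQ Neg p' i m) =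
      (\<Sum>k\<le>min m n. e ^ k * c k * (?s' ^ (m - k) * PQ Neg p' i (m - k) * (?s ^ (n - k) * PQ Pos p j (n - k)))))
    \<longleftrightarrow> (\<forall>k>0. \<forall>l>0. ?s * eta Pos j $ k * (?s' * eta Neg i $ l) =
      ?s' * eta Neg i $ l * (?s * eta Pos j $ k) + (if k = l then e * bracket (cart i j) $ k else 0))"
    using is_exp_heisenberg[OF PQ_signed[of p' Neg i] PQ_signed[of p Pos j] c] G_central central by simp
  also have "\<dots> \<longleftrightarrow> heisenberg i j"
  proof -
    have "?s * x * (?s' * y) = ?s' * y' * (?s * x') + (if k = l then e * z else 0) \<longleftrightarrow>
        x * y = y' * x' + (if k = l then z else 0)" for x y x' y' z and k l :: nat
      by (cases p; cases p'; simp add: e_def; auto simp: algebra_simps neg_eq_iff_add_eq_0)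
    then show ?thesis by (simp add: heisenberg_def)
  qed
  also have "(\<forall>m n. ?s ^ n * PQ Pos p j n * (?s' ^ m * PQ Neg p' i m) =
      (\<Sum>k\<le>min m n. e ^ k * c k * (?s' ^ (m - k) * PQ Neg p' i (m - k) * (?s ^ (n - k) * PQ Pos p j (n - k)))))
    \<longleftrightarrow> (\<forall>m n. PQ Pos p j n * PQ Neg p' i m =
      (\<Sum>k\<le>min m n. c k * PQ Neg p' i (m - k) * PQ Pos p j (n - k)))"
  proof -
    have 1: "?s ^ n * x * (?s' ^ m * y) = ?s ^ n * ?s' ^ m * (x * y)" for n m x y
      using shape_sg_comm[of p' m x] by (simp add: mult.assoc) (simp flip: mult.assoc)
    have 2: "e ^ k * c k * (?s' ^ (m - k) * x * (?s ^ (n - k) * y)) = ?s ^ n * ?s' ^ m * (c k * x * y)"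
      if "k \<le> min m n" for k m n x y
    proof -
      have "e ^ k * c k * (?s' ^ a * x * (?s ^ b * y)) = (e ^ k * ?s' ^ a * ?s ^ b) * (c k * x * y)" for a b
        by (cases p; cases p'; cases "even a"; cases "even b"; simp add: mult.assoc)
      then show ?thesis using pow[OF that] by simp
    qed
    have 3: "?s ^ n * ?s' ^ m * x = ?s ^ n * ?s' ^ m * y \<longleftrightarrow> x = y" for n m x y
      by (cases p; cases p'; cases "even m"; cases "even n"; simp)
    have "(\<Sum>k\<le>min m n. e ^ k * c k * (?s' ^ (m - k) * PQ Neg p' i (m - k) * (?s ^ (n - k) * PQ Pos p j (n - k)))) =
      ?s ^ n * ?s' ^ m * (\<Sum>k\<le>min m n. c k * PQ Neg p' i (m - k) * PQ Pos p j (n - k))" for m n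
      unfolding sum_distrib_left by (rule sum.cong) (auto intro: 2)
    then show ?thesis unfolding 1 by (simp only: 3)
  qed
  finally show ?thesis .
qed

lemma g_p_c: "g (p_c n) = (1 / (qq powi int n - qq powi (- int n))) \<odot> charge n"
  by (simp add: p_c_def charge_def g_eval)

lemma g_p_2c: "g (p_2c n) = (qq powi int n + qq powi (- int n)) \<odot> g (p_c n)"
  by (simp add: p_2c_def g_eval)

text \<open>This covers the coefficients \<open>Sym\<^sup>k\<close> and \<open>\<Lambda>\<^sup>k\<close>, whose exponents are multiples of \<open>charge n\<close>.\<close>

lemma is_exp_g_fexp:
  assumes "\<And>n x. g (a n) * x = x * g (a n)"
  shows "is_exp (Abs_fps (\<lambda>n. g (a n))) (Abs_fps (\<lambda>k. g (fexp (pos_series a) $ k)))"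
proof -
  define h where "h = Abs_fps (\<lambda>m. g (pos_series a $ m))"
  have "Abs_fps (\<lambda>k. g (fexp (pos_series a) $ k)) = expo h"
    unfolding hom_fexp[OF g_hom g_scal] h_def by (simp add: fps_nth_inverse)
  moreover have "is_exp h (expo h)"
    by (rule is_exp_expo) (simp_all add: h_def pos_series_def g.hom_zero assms)
  ultimately show ?thesis
    by simp (rule is_exp_cong, assumption, simp add: h_def pos_series_def)
qed

lemma is_exp_Sym:
  assumes "\<And>n. g (p n) = a n \<odot> charge n"
  shows "is_exp (Abs_fps (\<lambda>n. (inverse (of_nat n) * a n) \<odot> charge n)) (Abs_fps (\<lambda>k. g (Sym_coeff p k)))"
proof -
  have *: "g (scal (inverse (of_nat n)) * p n) = (inverse (of_nat n) * a n) \<odot> charge n" for n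
    by (simp add: g_eval assms act_simps mult.commute[of "a n"])
  show ?thesis
    using is_exp_g_fexp[of "\<lambda>n. scal (inverse (of_nat n)) * p n"]
    unfolding * Sym_coeff_def by (simp add: act_charge_central)
qed

lemma is_exp_Ext:
  assumes "\<And>n. g (p n) = a n \<odot> charge n"
  shows "is_exp (Abs_fps (\<lambda>n. - ((inverse (of_nat n) * a n) \<odot> charge n)))
    (Abs_fps (\<lambda>k. (- 1) ^ k * g (Ext_coeff p k)))"
proof -
  have *: "g (scal ((-1) ^ (n - 1) * inverse (of_nat n)) * p n) =
      ((-1) ^ (n - 1) * inverse (of_nat n) * a n) \<odot> charge n" for n
    by (simp add: g_eval assms act_simps mult.commute[of "a n"])
  have "is_exp (Abs_fps (\<lambda>n. ((-1) ^ (n - 1) * inverse (of_nat n) * a n) \<odot> charge n))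
      (Abs_fps (\<lambda>k. g (Ext_coeff p k)))"
    using is_exp_g_fexp[of "\<lambda>n. scal ((-1) ^ (n - 1) * inverse (of_nat n)) * p n"]
    unfolding * Ext_coeff_def by (simp add: act_charge_central)
  from is_exp_fps_scale[OF _ this, of "- 1"]
  have "is_exp (fps_scale (- 1) (Abs_fps (\<lambda>n. ((-1) ^ (n - 1) * inverse (of_nat n) * a n) \<odot> charge n)))
    (fps_scale (- 1) (Abs_fps (\<lambda>k. g (Ext_coeff p k))))" by simp
  moreover have "fps_scale (- 1) (Abs_fps (\<lambda>k. g (Ext_coeff p k))) = Abs_fps (\<lambda>k. (- 1) ^ k * g (Ext_coeff p k))"
    by (simp add: fps_eq_iff)
  ultimately have *: "is_exp (fps_scale (- 1)
      (Abs_fps (\<lambda>n. ((-1) ^ (n - 1) * inverse (of_nat n) * a n) \<odot> charge n)))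
      (Abs_fps (\<lambda>k. (- 1) ^ k * g (Ext_coeff p k)))" by simp
  have "(- 1) ^ n * (((-1) ^ (n - 1) * inverse (of_nat n) * a n) \<odot> x) = - ((inverse (of_nat n) * a n) \<odot> x)"
    if "n > 0" for n x
    using that by (cases n; cases "even n") (simp_all add: act_simps)
  then show ?thesis by (intro is_exp_cong[OF *]) simp
qed

lemma signed_series_cong:
  assumes "is_exp a (Abs_fps A)" "\<And>n. n > 0 \<Longrightarrow> a $ n = b n" "\<And>n. A n = B n"
  shows "is_exp (Abs_fps b) (Abs_fps (B :: nat \<Rightarrow> 'r))"
proof -
  have "A = B" using assms(3) by (simp add: fun_eq_iff)
  with assms(1) show ?thesis by (auto intro: is_exp_cong simp: assms(2))
qed

lemma bracket_2:
  assumes "n > 0"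
  shows "bracket 2 $ n = (inverse (of_nat n) * ((qq powi int n + qq powi (- int n)) /
    (qq powi int n - qq powi (- int n)))) \<odot> charge n"
proof -
  define U V :: "'k poly fract" where "U = qq powi int n" and "V = qq powi (- int n)"
  have q2: "qq powi (2 * int n) = U * U" "qq powi (- (2 * int n)) = V * V"
  proof -
    have *: "2 * int n = int n + int n" "- (int n + int n) = - int n + - int n" by simp_all
    have "qq powi (k + k) = qq powi k * (qq powi k :: 'k poly fract)" for k
      by (rule power_int_add) simp
    then show "qq powi (2 * int n) = U * U" "qq powi (- (2 * int n)) = V * V"
      unfolding * U_def V_def by blast+
  qed
  have "(U + V) * (U - V) = U * U - V * V" by (simp add: algebra_simps)
  then have "qint (2 * int n) = (U + V) * qint (int n)"
    unfolding qint_def q2 U_def[symmetric] V_def[symmetric] by simp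
  moreover have "qint (int n) \<noteq> (0 :: 'k poly fract)" using assms by simp
  ultimately have "qint (2 * int n) / (qint (int n) * of_nat n * y) = inverse (of_nat n) * ((U + V) / y)"
    for y by (simp add: divide_inverse)
  then show ?thesis
    unfolding bracket_def fps_nth_Abs_fps U_def[symmetric] V_def[symmetric] by (simp only:)
qed

lemma bracket_minus_1:
  assumes "n > 0"
  shows "bracket (- 1) $ n = - ((inverse (of_nat n) * (1 / (qq powi int n - qq powi (- int n)))) \<odot> charge n)"
proof -
  have "qint (- 1 * int n) / (qint (int n) * of_nat n * y) = - (inverse (of_nat n) * (1 / y))"
    for y :: "'k poly fract"
    using assms by (simp add: qint_minus divide_inverse)
  then show ?thesis
    unfolding bracket_def fps_nth_Abs_fps by (simp only: act_simps)
qed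

lemma is_exp_same:
  "is_exp (Abs_fps (\<lambda>k. shape_sg p * shape_sg p' * bracket 2 $ k))
     (Abs_fps (\<lambda>k. (shape_sg p * shape_sg p') ^ k *
       g (if p = p' then Sym_coeff p_2c k else Ext_coeff p_2c k)))"
proof -
  have *: "g (p_2c n) = ((qq powi int n + qq powi (- int n)) /
    (qq powi int n - qq powi (- int n))) \<odot> charge n" for n
    by (simp add: g_p_2c g_p_c act_simps divide_inverse)
  show ?thesis
  proof (cases "p = p'")
    case True
    then have "shape_sg p * shape_sg p' = (1 :: 'r)" by (cases p) simp_all
    then show ?thesis
      by (intro signed_series_cong[OF is_exp_Sym[OF *]]) (simp_all add: True bracket_2)
  next
    case False
    then have "shape_sg p * shape_sg p' = (- 1 :: 'r)" by (cases p; cases p') simp_all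
    then show ?thesis
      by (intro signed_series_cong[OF is_exp_Ext[OF *]]) (simp_all add: False bracket_2)
  qed
qed

lemma is_exp_adj:
  "is_exp (Abs_fps (\<lambda>k. shape_sg p * shape_sg p' * bracket (- 1) $ k))
     (Abs_fps (\<lambda>k. (shape_sg p * shape_sg p') ^ k *
       g ((-1) ^ k * (if p = p' then Ext_coeff p_c k else Sym_coeff p_c k))))"
proof -
  have m1: "g ((-1) ^ k * x) = (- 1) ^ k * g x" "(- 1) ^ k * ((- 1) ^ k * g x) = g x" for k x
    by (cases "even k"; simp add: g.hom_minus)+
  show ?thesis
  proof (cases "p = p'")
    case True
    then have "shape_sg p * shape_sg p' = (1 :: 'r)" by (cases p) simp_all
    then show ?thesis
      by (intro signed_series_cong[OF is_exp_Ext[OF g_p_c]]) (simp_all add: True bracket_minus_1 m1)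
  next
    case False
    then have "shape_sg p * shape_sg p' = (- 1 :: 'r)" by (cases p; cases p') simp_all
    then show ?thesis
      by (intro signed_series_cong[OF is_exp_Sym[OF g_p_c]]) (simp_all add: False bracket_minus_1 m1)
  qed
qed

lemma heisenberg_vertex_same:
  "(\<forall>m n. g (v_Q p i n * v_P p' i m) = g (\<Sum>k\<le>min m n. (if p = p' then Sym_coeff p_2c k else Ext_coeff p_2c k) *
        v_P p' i (m - k) * v_Q p i (n - k))) \<longleftrightarrow> heisenberg i i"
  using heisenberg_vertex[of p p' i i "\<lambda>k. g (if p = p' then Sym_coeff p_2c k else Ext_coeff p_2c k)"]
    is_exp_same[of p p']
  by (simp add: g.hom_sum g.hom_mult)

lemma heisenberg_vertex_adj:
  assumes "cart i j = - 1"
  shows "(\<forall>m n. g (v_Q p j n * v_P p' i m) =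
    g (\<Sum>k\<le>min m n. (-1) ^ k * (if p = p' then Ext_coeff p_c k else Sym_coeff p_c k) *
        v_P p' i (m - k) * v_Q p j (n - k))) \<longleftrightarrow> heisenberg i j"
  using heisenberg_vertex[of p p' i j "\<lambda>k. g ((-1) ^ k * (if p = p' then Ext_coeff p_c k else Sym_coeff p_c k))"]
    is_exp_adj[of p p'] assms
  by (simp add: g.hom_sum g.hom_mult)

lemma heisenberg_vertex_far:
  assumes "cart i j = 0"
  shows "(\<forall>m n. g (v_Q p j n * v_P p' i m) = g (v_P p' i m * v_Q p j n)) \<longleftrightarrow> heisenberg i j"
proof -
  have "is_exp (Abs_fps (\<lambda>k. shape_sg p * shape_sg p' * bracket 0 $ k)) (1 :: 'r fps)"
    by (rule is_exp_cong[OF is_exp_zero]) (simp add: bracket_def act_simps)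
  moreover have "Abs_fps (\<lambda>k. (shape_sg p * shape_sg p') ^ k * (if k = 0 then 1 else 0)) = (1 :: 'r fps)"
    by (simp add: fps_eq_iff)
  ultimately show ?thesis
    using heisenberg_vertex[of p p' i j "\<lambda>k. if k = 0 then 1 else 0"] assms
    by (simp add: g.hom_mult if_distrib[of "\<lambda>x. x * _"] cong: if_cong)
qed

section \<open>The Heisenberg relations in Drinfeld form\<close>

lemma act_C_power: "(a \<odot> C k) ^ n = a ^ n \<odot> C (k * int n)"
proof (induction n)
  case (Suc n)
  have "C k * C (k * int n) = C (k * int (Suc n))"
    by (simp add: distrib_left flip: C_add)
  then show ?case using Suc by (simp add: act_simps mult.commute[of a])
qed (simp add: act_simps)

text \<open>The structure function of the Drinfeld relation between \<open>\<psi>\<^sup>-\<close> and \<open>\<psi>\<^sup>+\<close> as an exponential: each linear factor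
  contributes a logarithm series.\<close>

lemma is_exp_struct:
  "is_exp (Abs_fps (\<lambda>n. (inverse (of_nat n) * (qq powi (a * int n) - qq powi (- (a * int n)))) \<odot> charge n))
    (f.hom_fps (d_struct a))"
proof -
  let ?p = "qq powi a :: 'k poly fract" and ?m = "qq powi (- a) :: 'k poly fract"
  define L where "L u k = Abs_fps (\<lambda>n. (inverse (of_nat n) * u ^ n) \<odot> C (k * int n))" for u and k :: int
  have L: "of_nat n * L u k $ n = (u \<odot> C k) ^ n" if "n > 0" for n u k
  proof -
    have *: "inverse (of_nat n) * u ^ n * of_nat n = u ^ n" using that by (simp add: field_simps)
    show ?thesis by (simp only: L_def fps_nth_Abs_fps of_nat_act act_simps act_C_power *)
  qed
  have central: "L u k $ n * x = x * L u k $ n" for u k n x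
    by (simp add: L_def act_simps C_comm)
  have minus: "is_exp (- L u k) (1 - fps_const (u \<odot> C k) * fps_X)" for u k
    by (rule is_exp_one_minus) (simp add: L)
  have plus: "is_exp (L u k) (geom (u \<odot> C k))" for u k
    by (rule is_exp_geom) (simp add: L)
  have th: "theta (L u k) * F = F * theta (L u k)" "theta (- L u k) * F = F * theta (- L u k)" for u k F
    by (rule fps_mult_commute, simp add: of_nat_left_commute mult.assoc central)+
  have "is_exp (- L ?p (- 2) + - L ?m 2 + L ?m (- 2) + L ?p 2)
    ((1 - fps_const (?p \<odot> C (- 2)) * fps_X) * (1 - fps_const (?m \<odot> C 2) * fps_X) *
     geom (?m \<odot> C (- 2)) * geom (?p \<odot> C 2))"
    by (intro is_exp_mult minus plus th)
  also have "(1 - fps_const (?p \<odot> C (- 2)) * fps_X) * (1 - fps_const (?m \<odot> C 2) * fps_X) *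
     geom (?m \<odot> C (- 2)) * geom (?p \<odot> C 2) = f.hom_fps (d_struct a)"
    by (simp add: d_struct_def f.hom_fps_mult f.hom_fps_factor f.hom_fps_geom f_eval)
  finally show ?thesis
  proof (rule is_exp_cong)
    fix n :: nat
    have "qq powi (a * int n) = ?p ^ n" "qq powi (- (a * int n)) = ?m ^ n"
      by (simp_all add: power_int_mult power_int_minus power_inverse)
    then show "(- L ?p (- 2) + - L ?m 2 + L ?m (- 2) + L ?p 2) $ n =
      Abs_fps (\<lambda>n. (inverse (of_nat n) * (qq powi (a * int n) - qq powi (- (a * int n)))) \<odot> charge n) $ n"
      by (simp add: L_def charge_def act_simps act_diff_left right_diff_distrib)
  qed
qed

lemma K_Phi: "K h * Phi s i n = Phi s i n * K h"
proof -
  have "K h * ((of_int (sg s) * (qq - inverse qq)) \<odot> H s i m) =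
    (of_int (sg s) * (qq - inverse qq)) \<odot> H s i m * K h" if "m > 0" for m
    using K_H[OF that, of h i s] by (simp add: act_simps)
  then show ?thesis using is_exp_commute[OF is_exp_Phi[of s i], of "K h"] by simp
qed

lemma K_K: "K h * K h' = K h' * K h"
  by (simp add: K_add add.commute)

lemma psi_psi:
  "f (d_psi s i $ m) * f (d_psi t j $ n) =
    K (\<lambda>k. sg s * coroot i k) * (K (\<lambda>k. sg t * coroot j k) * (Phi s i m * Phi t j n))"
proof -
  have "Phi s i m * (K h * x) = K h * (Phi s i m * x)" for h x
    by (simp only: K_Phi flip: mult.assoc)
  then show ?thesis unfolding psi_eq by (simp only: mult.assoc)
qed

text \<open>The factors \<open>q\<^sup>h\<close> cancel from the Drinfeld relation; comparing exponents then gives the bracket up to the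
  nonzero scalar \<open>(q - q\<^sup>-\<^sup>1)\<^sup>2 [k] [l]\<close>.\<close>

lemma heisenberg_drinfeld:
  "(\<forall>k l. f (d_psi Neg i $ k * d_psi Pos j $ l) =
     f (\<Sum>n\<le>min k l. d_struct (cart i j) $ n * (d_psi Pos j $ (l - n) * d_psi Neg i $ (k - n))))
   \<longleftrightarrow> heisenberg i j"
proof -
  let ?a = "cart i j" and ?e = "\<lambda>s. of_int (sg s) * (qq - inverse qq) :: 'k poly fract"
  let ?c = "\<lambda>n. (inverse (of_nat n) * (qq powi (?a * int n) - qq powi (- (?a * int n)))) \<odot> charge n"
  let ?G = "\<lambda>n. f (d_struct ?a $ n)"
  let ?K = "K (\<lambda>k. sg Neg * coroot i k)" and ?K' = "K (\<lambda>k. sg Pos * coroot j k)"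
  note G = is_exp_struct[of ?a]
  have G_central: "?G n * x = x * ?G n" for n x
    using is_exp_central[OF G, of n x] by (simp add: act_charge_central f.hom_fps_def)
  have "f (d_psi Neg i $ k * d_psi Pos j $ l) =
     f (\<Sum>n\<le>min k l. d_struct (cart i j) $ n * (d_psi Pos j $ (l - n) * d_psi Neg i $ (k - n))) \<longleftrightarrow>
     Phi Neg i k * Phi Pos j l = (\<Sum>n\<le>min l k. ?G n * (Phi Pos j (l - n) * Phi Neg i (k - n)))" for k l
  proof -
    have "?G n * (f (d_psi Pos j $ (l - n)) * f (d_psi Neg i $ (k - n))) =
      ?K * (?K' * (?G n * (Phi Pos j (l - n) * Phi Neg i (k - n))))" for n
    proof -
      have "?G n * (?K' * (?K * x)) = ?K * (?K' * (?G n * x))" for x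
      proof -
        have 1: "?G n * (K h * y) = K h * (?G n * y)" for h y
          by (simp only: G_central[of n "K h"] flip: mult.assoc)
        have 2: "?K' * (?K * y) = ?K * (?K' * y)" for y
          by (simp only: K_K[of _ "\<lambda>k. sg Neg * coroot i k"] flip: mult.assoc)
        show ?thesis by (simp only: 1 2)
      qed
      then show ?thesis unfolding psi_psi .
    qed
    then have "f (\<Sum>n\<le>min k l. d_struct (cart i j) $ n * (d_psi Pos j $ (l - n) * d_psi Neg i $ (k - n))) =
      ?K * (?K' * (\<Sum>n\<le>min l k. ?G n * (Phi Pos j (l - n) * Phi Neg i (k - n))))"
      by (simp add: f.hom_sum f.hom_mult sum_distrib_left min.commute)
    then show ?thesis by (simp only: f.hom_mult psi_psi K_cancel)
  qed
  then have "(\<forall>k l. f (d_psi Neg i $ k * d_psi Pos j $ l) =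
     f (\<Sum>n\<le>min k l. d_struct (cart i j) $ n * (d_psi Pos j $ (l - n) * d_psi Neg i $ (k - n)))) \<longleftrightarrow>
    (\<forall>m n. Phi Neg i n * Phi Pos j m = (\<Sum>k\<le>min m n. ?G k * (Phi Pos j (m - k) * Phi Neg i (n - k))))"
    by blast
  also have "\<dots> \<longleftrightarrow> (\<forall>k>0. \<forall>l>0. (?e Neg \<odot> H Neg i k) * (?e Pos \<odot> H Pos j l) =
      (?e Pos \<odot> H Pos j l) * (?e Neg \<odot> H Neg i k) + (if k = l then ?c k else 0))"
    using is_exp_heisenberg[OF is_exp_Phi[of Pos j] is_exp_Phi[of Neg i] G]
    by (simp add: G_central f.hom_fps_def act_charge_central)
  also have "\<dots> \<longleftrightarrow> heisenberg i j"
  proof -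
    have "(?e Neg \<odot> H Neg i k) * (?e Pos \<odot> H Pos j l) =
      (?e Pos \<odot> H Pos j l) * (?e Neg \<odot> H Neg i k) + (if k = l then ?c k else 0) \<longleftrightarrow>
      eta Pos j $ l * eta Neg i $ k =
      eta Neg i $ k * eta Pos j $ l + (if l = k then bracket ?a $ l else 0)"
      if kl: "k > 0" "l > 0" for k l
    proof -
      define d u :: "'k poly fract" where "d = qq - inverse qq" and "u = inverse (qint (int k) * qint (int l))"
      have d: "d \<noteq> 0" unfolding d_def by (rule qq_sub_inverse_neq_0)
      have u: "u \<noteq> 0" using kl by (simp add: u_def)
      have "(?e Neg \<odot> H Neg i k) * (?e Pos \<odot> H Pos j l) =
        (?e Pos \<odot> H Pos j l) * (?e Neg \<odot> H Neg i k) + (if k = l then ?c k else 0) \<longleftrightarrow>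
        (d * d) \<odot> (H Pos j l * H Neg i k) = (d * d) \<odot> (H Neg i k * H Pos j l) + (if k = l then ?c k else 0)"
      proof -
        have "(?e Neg \<odot> H Neg i k) * (?e Pos \<odot> H Pos j l) = - ((d * d) \<odot> (H Neg i k * H Pos j l))"
          "(?e Pos \<odot> H Pos j l) * (?e Neg \<odot> H Neg i k) = - ((d * d) \<odot> (H Pos j l * H Neg i k))"
          unfolding sg.simps of_int_minus of_int_1 mult_minus1 mult_1 d_def[symmetric]
          by (simp_all add: act_simps)
        then show ?thesis by (auto simp: algebra_simps)
      qed
      also have "\<dots> \<longleftrightarrow> (u / (d * d)) \<odot> (d * d) \<odot> (H Pos j l * H Neg i k) =
        (u / (d * d)) \<odot> ((d * d) \<odot> (H Neg i k * H Pos j l) + (if k = l then ?c k else 0))"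
        by (subst act_cancel) (use d u in simp_all)
      also have "\<dots> \<longleftrightarrow> u \<odot> (H Pos j l * H Neg i k) =
        u \<odot> (H Neg i k * H Pos j l) + (if l = k then bracket ?a $ l else 0)"
      proof -
        have br: "(u / (d * d)) \<odot> ?c k = bracket ?a $ l" if "k = l"
        proof -
          have q: "qint n * d = qq powi n - qq powi (- n)" for n
            using d by (simp add: qint_def d_def)
          have "inverse (Q * Q) / (d * d) * (inverse N * (R * d)) = R / (Q * N * (Q * d))"
            if "Q \<noteq> 0" "N \<noteq> 0" for Q N R
            using d that by (simp add: divide_inverse mult_ac)
          from this[of "qint (int k)" "of_nat k"] show ?thesis
            using kl unfolding bracket_def fps_nth_Abs_fps q[symmetric] u_def \<open>k = l\<close>[symmetric] act_simps(3)
            by simp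
        qed
        have r: "(u / (d * d)) \<odot> (d * d) \<odot> x = u \<odot> x" for x
          using d by (simp add: act_simps)
        show ?thesis
        proof (cases "k = l")
          case True
          show ?thesis unfolding act_simps(7) r br[OF True] if_P[OF True] if_P[OF True[symmetric]] ..
        next
          case False
          then show ?thesis unfolding act_simps(7) r by (simp add: act_simps(6))
        qed
      qed
      finally show ?thesis
        using kl by (simp add: eta_nth act_simps u_def divide_inverse mult.commute)
    qed
    then show ?thesis unfolding heisenberg_def by blast
  qed
  finally show ?thesis .
qed

section \<open>Comparison of the two sets of relations\<close>

text \<open>The relations that both presentations impose beyond the elementary ones.\<close>

definition core_relations :: bool where
  "core_relations \<longleftrightarrow>
    (\<forall>h s i r. weight h s i r) \<and>
    (\<forall>h. D Pos * K h = K h * D Pos) \<and>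
    (\<forall>s i r. grade_X s i r) \<and>
    (\<forall>s i n. n > 0 \<longrightarrow> grade_H s i n) \<and>
    (\<forall>i j. heisenberg i j) \<and>
    (\<forall>t s i j n b. ladder t s i j n b) \<and>
    (\<forall>i j a b. opposite i j a b) \<and>
    (\<forall>s i j m n. cart i j \<noteq> 0 \<longrightarrow> quad s i j m n) \<and>
    (\<forall>s i j m n. cart i j = 0 \<longrightarrow> far s i j m n) \<and>
    (\<forall>s i j n m m'. cart i j = - 1 \<longrightarrow> serre s i j n m m')"

lemma coreD:
  assumes core_relations
  shows "weight h s i r" "D Pos * K h = K h * D Pos" "grade_X s i r" "n > 0 \<Longrightarrow> grade_H s i n"
    "heisenberg i j" "ladder t s i j n b" "opposite i j a b" "cart i j \<noteq> 0 \<Longrightarrow> quad s i j k l"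
    "cart i j = 0 \<Longrightarrow> far s i j k l" "cart i j = - 1 \<Longrightarrow> serre s i j k l l'"
  using assms by (simp_all add: core_relations_def)

lemma int_sign_cases:
  assumes "m \<noteq> 0"
  obtains s n where "m = sg s * int n" "n > 0"
proof (cases "m > 0")
  case True
  then show ?thesis using that[of Pos "nat m"] by simp
next
  case False
  then show ?thesis using that[of Neg "nat (- m)"] assms by simp
qed

lemma core_if_drinfeld:
  assumes rel: "\<And>l r. drinfeld_rel adj l r \<Longrightarrow> f l = f r"
  shows core_relations
proof -
  have dl: "drinfeld_ladder t s i j k l" for t s i j k l
    unfolding drinfeld_ladder_def by (rule rel[OF D6])
  have w: "weight h s i r" for h s i r
    by (rule weight_all) (use dl drinfeld_ladder_boundary[of s i _ "- r"] in simp)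
  moreover have "D Pos * K h = K h * D Pos" for h
    using rel[OF D5_q[of adj h]] by (simp add: f.hom_commutator f.hom_zero) (simp add: commutator_def)
  moreover have "grade_X s i r" for s i r
    using rel[OF D5_e[of adj i r]] rel[OF D5_f[of adj i r]]
    unfolding grade_X_drinfeld by (cases s) simp_all
  moreover have "grade_H s i n" if "n > 0" for s i n
    using rel[OF D5_h[of "sg s * int n" adj i]] that sg_cases[of s] unfolding grade_H_drinfeld by auto
  moreover have "heisenberg i j" for i j
    unfolding heisenberg_drinfeld[symmetric] by (intro allI) (rule rel[OF D4])
  moreover have "ladder t s i j n b" for t s i j n b
    using dl drinfeld_ladder_Pos[OF w, of s i j n "- b"] drinfeld_ladder_Neg[OF w, of s i j n "1 - b"]
    by (cases t) simp_all
  moreover have "opposite i j a b" for i j a b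
    using rel[OF D7[of adj i "- a" j "- b"]] unfolding opposite_drinfeld by simp
  moreover have "quad s i j m n" if "cart i j \<noteq> 0" for s i j m n
  proof (cases "i = j")
    case True
    then show ?thesis
      using rel[OF D8[of adj s i "1 - m" "1 - n"]] quad_drinfeld[of "qq powi (2 * sg s)" s i i "1 - m" "1 - n"]
      by (simp add: mult.commute)
  next
    case False
    then have c: "cart i j = - 1" using that cart_cases[of i j] by simp
    then show ?thesis
      using rel[OF D9[OF c, of s "1 - m" "1 - n"]] quad_drinfeld[of "qq powi (- sg s)" s i j "1 - m" "1 - n"]
      by simp
  qed
  moreover have "far s i j m n" if "cart i j = 0" for s i j m n
    using far_drinfeld[THEN iffD1, OF rel[OF D10[of adj i j 1 s "\<lambda>_. - m" "- n"]]] that by simp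
  moreover have "serre s i j n m m'" if "cart i j = - 1" for s i j n m m'
    using serre_drinfeld[THEN iffD1,
        OF rel[OF D10[of adj i j 2 s "\<lambda>k. if k = 1 then - m else - m'" "- n"]]] that by simp
  ultimately show ?thesis by (simp add: core_relations_def)
qed

lemma Phi_Phi: "Phi s i m * Phi s j n = Phi s j n * Phi s i m"
proof -
  let ?a = "\<lambda>i. Abs_fps (\<lambda>n. (of_int (sg s) * (qq - inverse qq)) \<odot> H s i n)"
  have a: "?a i $ m * ?a j $ n = ?a j $ n * ?a i $ m" if "m > 0" "n > 0" for m n i j
    using that by (simp add: act_simps H_H)
  have "?a i $ m * Phi s j n = Phi s j n * ?a i $ m" if "m > 0" for m n
    using is_exp_commute[OF is_exp_Phi[of s j], of "?a i $ m"] a that by simp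
  then show ?thesis
    using is_exp_commute[OF is_exp_Phi[of s i], of "Phi s j n"] by simp
qed

lemma drinfeld_if_core:
  assumes core_relations and "drinfeld_rel adj l r"
  shows "f l = f r"
  using assms(2)
proof cases
  case (D1 s x)
  then show ?thesis by (simp add: f.hom_mult C_central)
next
  case (D2_h m h i)
  then obtain s n where "m = sg s * int n" "n > 0" using int_sign_cases by blast
  then show ?thesis using D2_h K_H[of n h i s] by (simp add: commutator_def f.hom_simps)
next
  case (D3 s i k j l)
  have "psi_mode s i k * psi_mode s j l = psi_mode s j l * psi_mode s i k" for k l
  proof -
    have "Phi s i m * (K h * x) = K h * (Phi s i m * x)" for h x i m
      by (simp only: K_Phi flip: mult.assoc)
    moreover have "K h * (K h' * x) = K h' * (K h * x)" for h h' x
      by (simp only: K_K[of h h'] flip: mult.assoc)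
    ultimately show ?thesis
      by (simp add: psi_mode_def mult.assoc Phi_Phi[of s i _ j])
  qed
  then show ?thesis using D3 by (simp add: f.hom_mult psic_eq)
next
  case (D4 i k j l)
  then show ?thesis using coreD(5)[OF assms(1)] heisenberg_drinfeld[of i j] by blast
next
  case (D5_h m i)
  then obtain s n where "m = sg s * int n" "n > 0" using int_sign_cases by blast
  then show ?thesis using D5_h coreD(4)[OF assms(1), of n s i] grade_H_drinfeld[of i s n] by simp
next
  case (D6 s t i j k l)
  show ?thesis
    unfolding D6 drinfeld_ladder_def[symmetric]
    by (rule drinfeld_ladder_all) (rule coreD[OF assms(1)])+
next
  case (D7 i k j l)
  show ?thesis
    unfolding D7 opposite_drinfeld by (rule coreD[OF assms(1)])
next
  case (D8 s i k l)
  have "quad s i i (1 - k) (1 - l)" by (rule coreD[OF assms(1)]) simp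
  then show ?thesis using D8 quad_drinfeld[of "qq powi (2 * sg s)" s i i k l] by (simp add: mult.commute)
next
  case (D9 i j s k l)
  have "quad s i j (1 - k) (1 - l)" by (rule coreD[OF assms(1)]) (use D9 in simp)
  then show ?thesis using D9 quad_drinfeld[of "qq powi (- sg s)" s i j k l] by simp
next
  case (D10 i j N t m l)
  then consider "cart i j = 0" "N = 1" | "cart i j = - 1" "N = 2" using cart_cases[of i j] by auto
  then show ?thesis
  proof cases
    case 1
    show ?thesis unfolding D10(1,2) 1(2) far_drinfeld by (rule coreD[OF assms(1)]) (rule 1)
  next
    case 2
    show ?thesis unfolding D10(1,2) 2(2) serre_drinfeld by (rule coreD[OF assms(1)]) (rule 2)
  qed
qed (use coreD(2,3)[OF assms(1)] grade_X_drinfeld[of Pos] grade_X_drinfeld[of Neg] K_zero K_add D_inverse C_inverse in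
  \<open>auto simp: f.hom_simps commutator_def\<close>)

lemma ladder_QE:
  assumes "a > 0" "p = qq powi cart i j"
  shows "g (v_c 2 * commutator (v_Qb j (a + 1)) (v_E i b)) =
    p \<odot> (g (v_Qb j a) * g (v_E i (b + 1))) - inverse p \<odot> (g (v_E i (b + 1)) * g (v_Qb j a)) \<longleftrightarrow>
    ladder Pos Pos i j a b"
  using ladder_vertex[where t = Pos and s = Pos and i = i and j = j, OF assms(1) refl refl, of b] assms(2)
  by (simp add: g_eval commutator_def)

lemma ladder_QF:
  assumes "a > 0" "p = qq powi - cart i j"
  shows "g (commutator (v_Qb j (a + 1)) (v_F i b)) =
    p \<odot> (g (v_Qb j a) * g (v_F i (b + 1))) - inverse p \<odot> (g (v_F i (b + 1)) * g (v_Qb j a)) \<longleftrightarrow>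
    ladder Pos Neg i j a b"
  using ladder_vertex[where t = Pos and s = Neg and i = i and j = j, OF assms(1) refl refl, of b] assms(2)
  by (simp add: g_eval commutator_def cact_simps)

lemma ladder_PE:
  assumes "a > 0" "p = qq powi - cart i j"
  shows "g (commutator (v_Pb j (a + 1)) (v_E i (b + 1))) =
    p \<odot> (g (v_Pb j a) * g (v_E i b)) - inverse p \<odot> (g (v_E i b) * g (v_Pb j a)) \<longleftrightarrow>
    ladder Neg Pos i j a (b + 1)"
  using ladder_vertex[where t = Neg and s = Pos and i = i and j = j, OF assms(1) refl refl, of "b + 1"] assms(2)
  by (simp add: g_eval commutator_def cact_simps)

lemma ladder_PF:
  assumes "a > 0" "p = qq powi cart i j"
  shows "g (v_c (- 2) * commutator (v_Pb j (a + 1)) (v_F i (b + 1))) =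
    p \<odot> (g (v_Pb j a) * g (v_F i b)) - inverse p \<odot> (g (v_F i b) * g (v_Pb j a)) \<longleftrightarrow>
    ladder Neg Neg i j a (b + 1)"
  using ladder_vertex[where t = Neg and s = Neg and i = i and j = j, OF assms(1) refl refl, of "b + 1"] assms(2)
  by (simp add: g_eval commutator_def)

lemma ladder_1:
  assumes "p = qint (cart i j)"
  shows "g (v_c 2 * commutator (v_Qb j 1) (v_E i b)) = p \<odot> g (v_E i (b + 1)) \<longleftrightarrow> ladder Pos Pos i j 0 b"
    "g (commutator (v_Qb j 1) (v_F i b)) = - p \<odot> g (v_F i (b + 1)) \<longleftrightarrow> ladder Pos Neg i j 0 b"
    "g (commutator (v_Pb j 1) (v_E i (b + 1))) = p \<odot> g (v_E i b) \<longleftrightarrow> ladder Neg Pos i j 0 (b + 1)"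
    "g (v_c (- 2) * commutator (v_Pb j 1) (v_F i (b + 1))) = - p \<odot> g (v_F i b) \<longleftrightarrow>
      ladder Neg Neg i j 0 (b + 1)"
  using ladder_vertex_0[where t = Pos and s = Pos and i = i and j = j, OF refl refl, of b]
    ladder_vertex_0[where t = Pos and s = Neg and i = i and j = j, OF refl refl, of b]
    ladder_vertex_0[where t = Neg and s = Pos and i = i and j = j, OF refl refl, of "b + 1"]
    ladder_vertex_0[where t = Neg and s = Neg and i = i and j = j, OF refl refl, of "b + 1"] assms
  by (simp_all add: g_eval commutator_def cact_simps del: One_nat_def)

lemma qint_minus_1 [simp]: "qint (- 1) = (- 1 :: 'k poly fract)"
  by (simp add: qint_minus)

lemma core_if_vertex:
  assumes rel: "\<And>l r. vertex_rel adj l r \<Longrightarrow> g l = g r"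
  shows core_relations
proof -
  have w: "weight h s i r" for h s i r
    using rel[OF V2_E[of adj h i r]] rel[OF V2_F[of adj h i r]]
      weight_vertex[of h Pos i r] weight_vertex[of h Neg i r] by (cases s) simp_all
  moreover have "D Pos * K h = K h * D Pos" for h
    using rel[OF V5_q[of adj h]] by (simp add: g.hom_commutator g.hom_zero g_D g_K) (simp add: commutator_def)
  moreover have "grade_X s i r" for s i r
    using rel[OF V5_E[of adj i r]] rel[OF V5_F[of adj i r]]
      grade_X_vertex[of Pos i r] grade_X_vertex[of Neg i r] by (cases s) simp_all
  moreover have "grade_H s i n" if "n > 0" for s i n
    using rel[OF V5_Q[of adj Row i]] rel[OF V5_P[of adj Row i]]
      grade_H_vertex[of Pos Row i] grade_H_vertex[of Neg Row i] that by (cases s) simp_all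
  moreover have "heisenberg i j" for i j
  proof -
    consider "i = j" | "cart i j = - 1" | "cart i j = 0" using cart_cases[of i j] by blast
    then show ?thesis
    proof cases
      case 1
      show ?thesis unfolding 1 heisenberg_vertex_same[of Row j Row, symmetric]
        by (intro allI) (rule rel[OF V4_same])
    next
      case 2
      show ?thesis unfolding heisenberg_vertex_adj[OF 2, of Row Row, symmetric]
        by (intro allI) (rule rel[OF V4_adj[OF 2]])
    next
      case 3
      show ?thesis unfolding heisenberg_vertex_far[OF 3, of Row Row, symmetric]
        by (intro allI) (rule rel[OF V4_far[OF 3]])
    qed
  qed
  moreover have "ladder t s i j n b" for t s i j n b
  proof -
    consider "i = j" | "cart i j = - 1" | "cart i j = 0" using cart_cases[of i j] by blast
    then show ?thesis
    proof cases
      case 1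
      show ?thesis
      proof (cases "n = 0")
        case True
        show ?thesis
          using ladder_1[where i = i and j = i, OF refl, of b] ladder_1[where i = i and j = i, OF refl, of "b - 1"]
            rel[OF V6_QE1[of adj i b]] rel[OF V6_QF1[of adj i b]]
            rel[OF V6_PE1[of adj i "b - 1"]] rel[OF V6_PF1[of adj i "b - 1"]]
          unfolding 1 True by (cases t; cases s) (simp_all add: g_eval act_simps del: One_nat_def)
      next
        case False
        then have n: "n > 0" by simp
        show ?thesis
          using ladder_QE[where i = i and j = i, OF n refl, of b] ladder_QF[where i = i and j = i, OF n refl, of b]
            ladder_PE[where i = i and j = i, OF n refl, of "b - 1"] ladder_PF[where i = i and j = i, OF n refl, of "b - 1"]
            rel[OF V6_QE[OF n, of adj i b]] rel[OF V6_QF[OF n, of adj i b]]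
            rel[OF V6_PE[OF n, of adj i "b - 1"]] rel[OF V6_PF[OF n, of adj i "b - 1"]]
          unfolding 1 by (cases t; cases s) (simp_all add: g_eval power_int_minus act_simps)
      qed
    next
      case 2
      show ?thesis
      proof (cases "n = 0")
        case True
        show ?thesis
          using ladder_1[where i = i and j = j, OF refl, of b] ladder_1[where i = i and j = j, OF refl, of "b - 1"]
            rel[OF V6_QE1_adj[OF 2, of b]] rel[OF V6_QF1_adj[OF 2, of b]]
            rel[OF V6_PE1_adj[OF 2, of "b - 1"]] rel[OF V6_PF1_adj[OF 2, of "b - 1"]]
          unfolding True by (cases t; cases s) (simp_all add: 2 g_eval act_simps del: One_nat_def)
      next
        case False
        then have n: "n > 0" by simp
        show ?thesis
          using ladder_QE[where i = i and j = j, OF n refl, of b] ladder_QF[where i = i and j = j, OF n refl, of b]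
            ladder_PE[where i = i and j = j, OF n refl, of "b - 1"] ladder_PF[where i = i and j = j, OF n refl, of "b - 1"]
            rel[OF V6_QE_adj[OF 2 n, of b]] rel[OF V6_QF_adj[OF 2 n, of b]]
            rel[OF V6_PE_adj[OF 2 n, of "b - 1"]] rel[OF V6_PF_adj[OF 2 n, of "b - 1"]]
          by (cases t; cases s) (simp_all add: 2 g_eval power_int_minus act_simps)
      qed
    next
      case 3
      have "PQb t j n * Y s i b = Y s i b * PQb t j n" if n: "n > 0" for n b
        using rel[OF V6_QE_far[OF 3 n, of b]] rel[OF V6_QF_far[OF 3 n, of b]]
          rel[OF V6_PE_far[OF 3 n, of b]] rel[OF V6_PF_far[OF 3 n, of b]]
        by (cases t; cases s) (simp_all add: g_eval g.hom_zero commutator_def)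
      then show ?thesis using ladder_far[OF 3, of t s] by blast
    qed
  qed
  moreover have "opposite i j a b" for i j a b
  proof (cases "i = j")
    case True
    consider "a + b > 0" | "a + b < 0" | "a + b = 0" by linarith
    then show ?thesis
    proof cases
      case 1
      show ?thesis unfolding True by (rule opposite_pos[THEN iffD1, OF 1 rel[OF V7_pos[OF 1]]])
    next
      case 2
      show ?thesis unfolding True by (rule opposite_neg[THEN iffD1, OF 2 rel[OF V7_neg[OF 2]]])
    next
      case 3
      show ?thesis unfolding True by (rule opposite_zero[THEN iffD1, OF 3 rel[OF V7_zero[OF 3]]])
    qed
  next
    case False
    show ?thesis by (rule opposite_neq[THEN iffD1, OF False rel[OF V7_neq[OF False]]])
  qed
  moreover have "quad s i j m n" if "cart i j \<noteq> 0" for s i j m n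
  proof (cases "i = j")
    case True
    show ?thesis
      using rel[OF V8_E[of adj i m n]] quad_vertex_Pos[where i = i and j = i, OF refl, of m n]
        rel[OF V8_F[of adj i n m]] quad_vertex_Neg[where i = i and j = i, OF refl, of m n]
      unfolding True by (cases s) (simp_all add: add.commute)
  next
    case False
    then have c: "cart i j = - 1" using that cart_cases[of i j] by simp
    then show ?thesis
      using rel[OF V9_E[OF c, of m n]] quad_vertex_Pos[where i = i and j = j, OF refl, of m n]
        rel[OF V9_F[OF c, of m n]] quad_vertex_Neg[where i = i and j = j, OF refl, of m n]
      by (cases s) (simp_all add: power_int_minus add.commute)
  qed
  moreover have "far s i j m n" if "cart i j = 0" for s i j m n
    using rel[OF V9_E_far[OF that, of m n]] rel[OF V9_F_far[OF that, of m n]]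
      far_vertex[of Pos i m j n] far_vertex[of Neg i m j n] by (cases s) simp_all
  moreover have "serre s i j n m m'" if "cart i j = - 1" for s i j n m m'
    using rel[OF V10_E[OF that, of n "\<lambda>k. if k = 1 then m else m'"]]
      rel[OF V10_F[OF that, of n "\<lambda>k. if k = 1 then m else m'"]]
      serre_vertex[of Pos j n i "\<lambda>k. if k = 1 then m else m'"]
      serre_vertex[of Neg j n i "\<lambda>k. if k = 1 then m else m'"]
    by (cases s) simp_all
  ultimately show ?thesis by (simp add: core_relations_def)
qed

lemma commute_PQ_iff:
  "(\<forall>n. y * PQ s p i n = PQ s p i n * y) \<longleftrightarrow> (\<forall>n>0. y * H s i n = H s i n * y)"
proof -
  have "y * (shape_sg p ^ n * x) = shape_sg p ^ n * x * y \<longleftrightarrow> y * x = x * y" for n x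
    by (cases p; cases "even n"; simp)
  moreover have "y * (shape_sg p * eta s i $ n) = shape_sg p * eta s i $ n * y \<longleftrightarrow> y * H s i n = H s i n * y"
    if "n > 0" for n
  proof -
    have "1 / qint (int n) \<noteq> (0 :: 'k poly fract)" using that by simp
    then show ?thesis using that by (cases p) (simp_all add: eta_nth act_simps(1,2) act_cancel)
  qed
  ultimately show ?thesis
    using is_exp_commute[OF PQ_signed[of p s i], of y] by simp
qed

lemma K_PQ: "K h * PQ s p i n = PQ s p i n * K h"
  using commute_PQ_iff[of "K h" s p i] K_H by blast

lemma PQ_PQ: "PQ s p i m * PQ s p' j n = PQ s p' j n * PQ s p i m"
proof -
  have "H s i l * PQ s p' j n = PQ s p' j n * H s i l" if "l > 0" for l
    using commute_PQ_iff[of "H s i l" s p' j] H_H that by blast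
  then show ?thesis using commute_PQ_iff[of "PQ s p' j n" s p i] by simp
qed

lemma PQ_0: "PQ s p i 0 = 1"
  using is_expD(1)[OF PQ_signed[of p s i]] by simp

lemma PQ_Row_Col:
  "g ((Abs_fps (\<lambda>n. gen (vpq s Row i n)) * Abs_fps (\<lambda>n. (-1) ^ n * gen (vpq s Col i n))) $ n) = g (1 $ n)"
proof -
  let ?R = "Abs_fps (\<lambda>n. PQ s Row i n)" and ?C = "Abs_fps (\<lambda>n. (- 1) ^ n * PQ s Col i n)"
  let ?m = "Abs_fps (\<lambda>n. - eta s i $ n)"
  have R: "is_exp (eta s i) ?R" using PQ_signed[of Row s i] by (simp add: fps_nth_inverse)
  have C: "is_exp ?m ?C" using PQ_signed[of Col s i] by simp
  have "- eta s i $ m * PQ s Row i n = PQ s Row i n * - eta s i $ m" for m n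
  proof (cases "m = 0")
    case False
    then have "H s i m * PQ s Row i n = PQ s Row i n * H s i m"
      using commute_PQ_iff[of "H s i m" s Row i] H_H[of m _ i s i] by blast
    then show ?thesis using False by (simp add: eta_nth act_simps)
  qed (simp add: eta_nth)
  then have "theta ?m * ?R = ?R * theta ?m"
    by (intro fps_mult_commute) (simp add: of_nat_left_commute mult.assoc)
  from is_exp_mult[OF R C this] have "?R * ?C = 1"
    by (rule is_exp_unique[OF _ is_exp_zero]) simp
  moreover have "g ((Abs_fps (\<lambda>n. gen (vpq s Row i n)) * Abs_fps (\<lambda>n. (-1) ^ n * gen (vpq s Col i n))) $ n) =
    (?R * ?C) $ n"
    by (simp add: fps_mult_nth g.hom_sum g.hom_mult g.hom_power g.hom_minus g.hom_one)
  ultimately show ?thesis by (simp add: g.hom_one g.hom_zero)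
qed

lemma vertex_if_core:
  assumes core: core_relations and "vertex_rel adj l r"
  shows "g l = g r"
proof -
  note core = coreD[OF core]
  note lad = ladder_QE[OF _ refl, THEN iffD2, OF _ core(6)] ladder_QF[OF _ refl, THEN iffD2, OF _ core(6)]
    ladder_PE[OF _ refl, THEN iffD2, OF _ core(6)] ladder_PF[OF _ refl, THEN iffD2, OF _ core(6)]
  note lad1 = ladder_1[OF refl, THEN iffD2, OF core(6)]
  show ?thesis
    using assms(2)
  proof cases
    case (V2_E h i r)
    then show ?thesis using weight_vertex[of h Pos i r] core(1) by simp
  next
    case (V2_F h i r)
    then show ?thesis using weight_vertex[of h Neg i r] core(1) by simp
  next
    case (V4_same p i n p' m)
    then show ?thesis using heisenberg_vertex_same[THEN iffD2, OF core(5)] by blast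
  next
    case (V4_adj i j p n p' m)
    then show ?thesis using heisenberg_vertex_adj[THEN iffD2, OF _ core(5)] by blast
  next
    case (V4_far i j p n p' m)
    then show ?thesis using heisenberg_vertex_far[THEN iffD2, OF _ core(5)] by blast
  next
    case (V5_Q p i m)
    then show ?thesis using grade_H_vertex[of Pos p i] core(4) by simp
  next
    case (V5_P p i m)
    then show ?thesis using grade_H_vertex[of Neg p i] core(4) by simp
  next
    case (V5_E i r)
    then show ?thesis using grade_X_vertex[of Pos i r] core(3) by simp
  next
    case (V5_F i r)
    then show ?thesis using grade_X_vertex[of Neg i r] core(3) by simp
  next
    case (V6_QE a i b)
    then show ?thesis using lad(1)[of a i i b] by (simp add: g_eval power_int_minus act_simps)
  next
    case (V6_QF a i b)
    then show ?thesis using lad(2)[of a i i b] by (simp add: g_eval power_int_minus act_simps)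
  next
    case (V6_PE a i b)
    then show ?thesis using lad(3)[of a i i b] by (simp add: g_eval power_int_minus act_simps)
  next
    case (V6_PF a i b)
    then show ?thesis using lad(4)[of a i i b] by (simp add: g_eval power_int_minus act_simps)
  next
    case (V6_QE1 i b)
    then show ?thesis using lad1(1)[of i i b] by (simp add: g_eval act_simps del: One_nat_def)
  next
    case (V6_QF1 i b)
    then show ?thesis using lad1(2)[of i i b] by (simp add: g_eval act_simps del: One_nat_def)
  next
    case (V6_PE1 i b)
    then show ?thesis using lad1(3)[of i i b] by (simp add: g_eval act_simps del: One_nat_def)
  next
    case (V6_PF1 i b)
    then show ?thesis using lad1(4)[of i i b] by (simp add: g_eval act_simps del: One_nat_def)
  next
    case (V6_QE_adj i j a b)
    then show ?thesis using lad(1)[of a j i b] by (simp add: g_eval power_int_minus act_simps)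
  next
    case (V6_QF_adj i j a b)
    then show ?thesis using lad(2)[of a j i b] by (simp add: g_eval power_int_minus act_simps)
  next
    case (V6_PE_adj i j a b)
    then show ?thesis using lad(3)[of a j i b] by (simp add: g_eval power_int_minus act_simps)
  next
    case (V6_PF_adj i j a b)
    then show ?thesis using lad(4)[of a j i b] by (simp add: g_eval power_int_minus act_simps)
  next
    case (V6_QE1_adj i j b)
    then show ?thesis using lad1(1)[of j i b] by (simp add: g_eval act_simps del: One_nat_def)
  next
    case (V6_QF1_adj i j b)
    then show ?thesis using lad1(2)[of j i b] by (simp add: g_eval act_simps del: One_nat_def)
  next
    case (V6_PE1_adj i j b)
    then show ?thesis using lad1(3)[of j i b] by (simp add: g_eval act_simps del: One_nat_def)
  next
    case (V6_PF1_adj i j b)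
    then show ?thesis using lad1(4)[of j i b] by (simp add: g_eval act_simps del: One_nat_def)
  next
    case (V6_QE_far i j a b)
    then show ?thesis using ladder_far[of i j Pos Pos] core(6)
      by (simp add: g_eval commutator_def g.hom_zero)
  next
    case (V6_QF_far i j a b)
    then show ?thesis using ladder_far[of i j Pos Neg] core(6)
      by (simp add: g_eval commutator_def g.hom_zero)
  next
    case (V6_PE_far i j a b)
    then show ?thesis using ladder_far[of i j Neg Pos] core(6)
      by (simp add: g_eval commutator_def g.hom_zero)
  next
    case (V6_PF_far i j a b)
    then show ?thesis using ladder_far[of i j Neg Neg] core(6)
      by (simp add: g_eval commutator_def g.hom_zero)
  next
    case (V7_pos a b i)
    show ?thesis unfolding V7_pos(1,2) by (rule opposite_pos[OF V7_pos(3), THEN iffD2, OF core(7)])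
  next
    case (V7_neg a b i)
    show ?thesis unfolding V7_neg(1,2) by (rule opposite_neg[OF V7_neg(3), THEN iffD2, OF core(7)])
  next
    case (V7_zero a b i)
    show ?thesis unfolding V7_zero(1,2) by (rule opposite_zero[OF V7_zero(3), THEN iffD2, OF core(7)])
  next
    case (V7_neq i j a b)
    show ?thesis unfolding V7_neq(1,2) by (rule opposite_neq[OF V7_neq(3), THEN iffD2, OF core(7)])
  next
    case (V8_E i m n)
    have "quad Pos i i m n" by (rule core(8)) simp
    then show ?thesis using quad_vertex_Pos[where i = i and j = i, OF refl, of m n] V8_E by simp
  next
    case (V8_F i n m)
    have "quad Neg i i m n" by (rule core(8)) simp
    then show ?thesis using quad_vertex_Neg[where i = i and j = i, OF refl, of m n] V8_F
      by (simp add: add.commute)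
  next
    case (V9_E i j m n)
    have "quad Pos i j m n" by (rule core(8)) (use V9_E in simp)
    then show ?thesis using quad_vertex_Pos[where i = i and j = j, OF refl, of m n] V9_E
      by (simp add: power_int_minus add.commute)
  next
    case (V9_F i j m n)
    have "quad Neg i j m n" by (rule core(8)) (use V9_F in simp)
    then show ?thesis using quad_vertex_Neg[where i = i and j = j, OF refl, of m n] V9_F
      by (simp add: power_int_minus)
  next
    case (V9_E_far i j m n)
    then show ?thesis using far_vertex[of Pos i m j n] core(9)[of i j] by simp
  next
    case (V9_F_far i j m n)
    then show ?thesis using far_vertex[of Neg i m j n] core(9)[of i j] by simp
  next
    case (V10_E i j n m)
    show ?thesis unfolding V10_E(1,2) using serre_vertex[of Pos j n i m] core(10)[OF V10_E(3)] by simp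
  next
    case (V10_F i j n m)
    show ?thesis unfolding V10_F(1,2) using serre_vertex[of Neg j n i m] core(10)[OF V10_F(3)] by simp
  next
    case (V0_P_inv i n)
    then show ?thesis using PQ_Row_Col[of Neg i n] by simp
  next
    case (V0_Q_inv i n)
    then show ?thesis using PQ_Row_Col[of Pos i n] by simp
  next
    case (V1 s x)
    then show ?thesis by (simp add: g.hom_mult g_C C_central)
  qed (use PQ_0[of Pos] PQ_0[of Neg] K_PQ[of _ Pos] K_PQ[of _ Neg] PQ_PQ[of Pos] PQ_PQ[of Neg] core(2) in
      \<open>simp_all add: g.hom_simps commutator_def g_K g_D g_C K_zero K_add D_inverse C_inverse\<close>)
qed

lemma drinfeld_iff_vertex:
  "(\<forall>l r. drinfeld_rel adj l r \<longrightarrow> f l = f r) \<longleftrightarrow> (\<forall>l r. vertex_rel adj l r \<longrightarrow> g l = g r)"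
  using core_if_drinfeld drinfeld_if_core core_if_vertex vertex_if_core by metis

end

section \<open>The counit\<close>

text \<open>The counit of the Drinfeld realization. It takes values in the scalars, viewed in an arbitrary free algebra.\<close>

definition counit :: "('i dr_gen, 'k::field_char_0) falg \<Rightarrow> ('h, 'k) falg" where
  "counit = falg_eval scal (\<lambda>x. case x of DX s i r \<Rightarrow> 0 | DK h \<Rightarrow> 1 | DH i m \<Rightarrow> 0 | DD s \<Rightarrow> 1 | DC s \<Rightarrow> 1)"

lemma unital_hom_counit: "unital_hom counit"
  unfolding counit_def by (rule unital_hom_falg_eval[OF unital_hom_scal scal_central])

interpretation counit: unital_hom counit by (rule unital_hom_counit)

lemma counit_scal: "counit (scal a) = scal a"
  unfolding counit_def by (rule falg_eval_scal[OF unital_hom_scal scal_central])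

lemma counit_gen: "counit (gen x) = (case x of DX s i r \<Rightarrow> 0 | DK h \<Rightarrow> 1 | DH i m \<Rightarrow> 0 | DD s \<Rightarrow> 1 | DC s \<Rightarrow> 1)"
  unfolding counit_def by (rule falg_eval_gen[OF unital_hom_scal scal_central])

lemma counit_simps:
  "counit (gen (DX s i r)) = 0" "counit (gen (DK h)) = 1" "counit (gen (DH i m)) = 0"
  "counit (gen (DD s)) = 1" "counit (gen (DC s)) = 1"
  "counit (d_h i k) = 0" "counit (xc s i l) = 0" "counit (d_c l) = 1"
  by (simp_all add: counit_gen d_h_def xc_def d_c_def counit.hom_power)

lemma counit_psi:
  "counit (d_psi s i $ n) = (if n = 0 then 1 else 0 :: ('h, 'k::field_char_0) falg)"
proof -
  have "Abs_fps (\<lambda>m. counit (pos_series (\<lambda>n. scal (of_int (sg s) * (qq - inverse qq)) *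
      d_h i (sg s * int n)) $ m)) = (0 :: ('h, 'k) falg fps)"
    by (simp add: fps_eq_iff pos_series_def counit.hom_zero counit.hom_mult counit_simps)
  then show ?thesis
    by (simp add: d_psi_def counit.hom_mult counit_simps
        free.hom_fexp[OF unital_hom_counit counit_scal] free.expo_zero)
qed

lemma counit_struct: "counit (d_struct a $ n) = (if n = 0 then 1 else 0)"
proof -
  let ?x = "scal (qq powi a)" and ?y = "scal (qq powi (- a))"
  have "counit.hom_fps (d_struct a) =
      (1 - fps_const ?x * fps_X) * ((1 - fps_const ?y * fps_X) * geom ?y) * geom ?x"
    by (simp add: d_struct_def counit.hom_fps_mult counit.hom_fps_factor counit.hom_fps_geom
        counit.hom_mult counit_scal counit_simps mult.assoc)
  then have "counit.hom_fps (d_struct a) = 1"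
    by (simp add: geom_inverse)
  then show ?thesis by (metis counit.hom_fps_nth fps_one_nth)
qed

lemma counit_drinfeld_rel:
  fixes adj :: "'i::finite \<Rightarrow> 'i \<Rightarrow> bool"
  assumes "drinfeld_rel adj l r"
  shows "counit l = (counit r :: ('h, 'k::field_char_0) falg)"
  using assms
proof cases
  case (D3 s i k j l)
  then show ?thesis by (simp add: psic_def counit.hom_simps counit_psi)
next
  case (D4 i k j l)
  have "(\<Sum>n\<le>min k l. counit ((d_struct (cartan adj i j) :: ('i dr_gen, 'k) falg fps) $ n) *
      (counit (d_psi Pos j $ (l - n)) * counit (d_psi Neg i $ (k - n)))) =
      (\<Sum>n\<le>min k l. if n = 0 then counit (d_psi Pos j $ l) * counit (d_psi Neg i $ k)
        else 0 :: ('h, 'k) falg)"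
    by (rule sum.cong) (auto simp: counit_struct)
  then show ?thesis
    unfolding D4 counit.hom_sum counit.hom_mult by (simp only:) (simp add: counit_psi)
next
  case (D6 s t i j k l)
  then show ?thesis by (simp add: lin2_def counit.hom_simps counit_simps)
next
  case (D7 i k j l)
  then show ?thesis
    by (auto simp: counit.hom_simps counit_simps commutator_def psic_def counit_psi)
next
  case (D10 i j N t m l)
  then show ?thesis by (simp add: counit.hom_sum counit.hom_mult counit.hom_zero counit_simps)
qed (simp_all add: counit.hom_simps counit_simps counit_scal commutator_def lin2_def)

section \<open>The mutually inverse maps between the two realizations\<close>

text \<open>The identification of the two realizations on generators, and its inverse, in which \<open>h\<^bsub>i,\<plusminus>n\<^esub>\<close> is \<open>[n]\<close> times a
  coefficient of the logarithm of \<open>\<Sum> Q\<^sub>i\<^sup>(\<^sup>n\<^sup>) z\<^sup>n\<close> or \<open>\<Sum> P\<^sub>i\<^sup>(\<^sup>n\<^sup>) z\<^sup>n\<close>. The maps are inverse to each other only modulo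
  the relations.\<close>

definition to_drinfeld :: "('i v_gen, 'k::field_char_0) falg \<Rightarrow> ('i dr_gen, 'k) falg" where
  "to_drinfeld = falg_eval scal (\<lambda>x. case x of
      VE i r \<Rightarrow> d_tau r * d_e i r
    | VF i r \<Rightarrow> d_tau r * d_f i r
    | VK h \<Rightarrow> d_q h
    | VD s \<Rightarrow> gen (DD s)
    | VC s \<Rightarrow> gen (DC s)
    | VP p i n \<Rightarrow> shape_sg p ^ n * fexp (fps_const (shape_sg p) * h_series Neg i) $ n
    | VQ p i n \<Rightarrow> shape_sg p ^ n * fexp (fps_const (shape_sg p) * h_series Pos i) $ n)"

definition to_vertex :: "('i dr_gen, 'k::field_char_0) falg \<Rightarrow> ('i v_gen, 'k) falg" where
  "to_vertex = falg_eval scal (\<lambda>x. case x of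
      DX s i r \<Rightarrow> scal ((- qq) powi (- r)) * (v_c (- r) * gen (vx s i r))
    | DK h \<Rightarrow> v_q h
    | DH i m \<Rightarrow> (let k = Rep_nonzero_int m in scal (qint \<bar>k\<bar>) *
        free.log_coeff (Abs_fps (\<lambda>n. gen (vpq (if k > 0 then Pos else Neg) Row i n))) (nat \<bar>k\<bar>))
    | DD s \<Rightarrow> v_d s
    | DC s \<Rightarrow> gen (VC s))"

lemma unital_hom_to_drinfeld: "unital_hom to_drinfeld"
  and unital_hom_to_vertex: "unital_hom to_vertex"
  unfolding to_drinfeld_def to_vertex_def
  by (rule unital_hom_falg_eval[OF unital_hom_scal scal_central])+

lemma to_drinfeld_scal: "to_drinfeld (scal a) = scal a"
  and to_vertex_scal: "to_vertex (scal a) = scal a"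
  unfolding to_drinfeld_def to_vertex_def
  by (rule falg_eval_scal[OF unital_hom_scal scal_central])+

lemmas to_drinfeld_gen = falg_eval_gen[OF unital_hom_scal scal_central,
    where v = "\<lambda>x. case x of
      VE i r \<Rightarrow> d_tau r * d_e i r
    | VF i r \<Rightarrow> d_tau r * d_f i r
    | VK h \<Rightarrow> d_q h
    | VD s \<Rightarrow> gen (DD s)
    | VC s \<Rightarrow> gen (DC s)
    | VP p i n \<Rightarrow> shape_sg p ^ n * fexp (fps_const (shape_sg p) * h_series Neg i) $ n
    | VQ p i n \<Rightarrow> shape_sg p ^ n * fexp (fps_const (shape_sg p) * h_series Pos i) $ n",
    folded to_drinfeld_def]

lemma to_drinfeld_simps:
  "to_drinfeld (gen (vx s i r)) = d_tau r * gen (DX s i r)"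
  "to_drinfeld (gen (VK h)) = gen (DK h)" "to_drinfeld (gen (VD s)) = gen (DD s)"
  "to_drinfeld (gen (VC s)) = gen (DC s)"
  "to_drinfeld (gen (vpq s p i n)) = shape_sg p ^ n * fexp (fps_const (shape_sg p) * h_series s i) $ n"
  by (cases s; simp add: to_drinfeld_gen)+

lemma to_vertex_simps:
  "to_vertex (gen (DX s i r)) = scal ((- qq) powi (- r)) * (v_c (- r) * gen (vx s i r))"
  "to_vertex (gen (DK h)) = gen (VK h)" "to_vertex (gen (DD s)) = gen (VD s)"
  "to_vertex (gen (DC s)) = gen (VC s)"
  unfolding to_vertex_def falg_eval_gen[OF unital_hom_scal scal_central] by simp_all

lemma to_vertex_h:
  assumes "n > 0"
  shows "to_vertex (d_h i (sg s * int n)) =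
    scal (qint (int n)) * free.log_coeff (Abs_fps (\<lambda>n. gen (vpq s Row i n))) n"
proof -
  have "Rep_nonzero_int (Abs_nonzero_int (sg s * int n)) = sg s * int n"
    by (rule Abs_nonzero_int_inverse) (use assms in \<open>cases s; simp\<close>)
  then show ?thesis
    unfolding to_vertex_def d_h_def falg_eval_gen[OF unital_hom_scal scal_central]
    using assms by (cases s) (simp_all add: Let_def)
qed

lemma unital_hom_shape_sg: "unital_hom f \<Longrightarrow> f (shape_sg p ^ n * x) = shape_sg p ^ n * f x"
  by (cases p; cases "even n") (simp_all add: unital_hom.hom_simps)

context two_realizations
begin

lemma f_fexp_eq_PQ: "f (fexp (fps_const (shape_sg p) * h_series s i) $ n) = shape_sg p ^ n * PQ s p i n"
proof -
  define h where "h = Abs_fps (\<lambda>n. shape_sg p * eta s i $ n)"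
  have "f (fexp (fps_const (shape_sg p) * h_series s i) $ n) = expo h $ n"
  proof -
    have "Abs_fps (\<lambda>m. f ((fps_const (shape_sg p) * h_series s i) $ m)) = h"
      using unital_hom_shape_sg[OF f_hom, of p 1] by (simp add: h_def eta_def fps_eq_iff)
    then show ?thesis by (simp add: hom_fexp[OF f_hom f_scal])
  qed
  moreover have "h $ m * h $ n = h $ n * h $ m" for m n
    using eta_commute[of s i m i n] by (cases p) (simp_all add: h_def)
  then have "is_exp h (expo h)"
    by (intro is_exp_expo) (simp_all add: h_def eta_nth)
  from is_exp_unique[OF this PQ_signed[of p s i]] have "expo h = Abs_fps (\<lambda>n. shape_sg p ^ n * PQ s p i n)"
    by (simp add: h_def)
  ultimately show ?thesis by simp
qed

lemma g_eq_f_to_drinfeld: "g x = f (to_drinfeld x)"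
proof (rule unital_hom_eqI[OF g_hom unital_hom_comp[OF f_hom unital_hom_to_drinfeld]])
  fix l :: "'i v_gen"
  have gen: "g (gen (vx s i r)) = f (to_drinfeld (gen (vx s i r)))"
    "g (gen (vpq s p i n)) = f (to_drinfeld (gen (vpq s p i n)))" for s i r p n
  proof -
    have "shape_sg p ^ n * (shape_sg p ^ n * x) = x" for x :: 'r
      by (cases p; cases "even n"; simp)
    then show "g (gen (vpq s p i n)) = f (to_drinfeld (gen (vpq s p i n)))"
      by (simp add: to_drinfeld_simps unital_hom_shape_sg[OF f_hom] f_fexp_eq_PQ)
  qed (simp add: to_drinfeld_simps g_X f.hom_mult)
  show "g (gen l) = f (to_drinfeld (gen l))"
  proof (cases l)
    case (VE i r)
    then show ?thesis using gen(1)[of Pos i r] by simp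
  next
    case (VF i r)
    then show ?thesis using gen(1)[of Neg i r] by simp
  next
    case (VP p i n)
    then show ?thesis using gen(2)[of Neg p i n] by simp
  next
    case (VQ p i n)
    then show ?thesis using gen(2)[of Pos p i n] by simp
  qed (simp_all add: to_drinfeld_simps g_K g_D g_C)
qed (simp add: to_drinfeld_scal f_scal g_scal)

lemma f_eq_g_to_vertex: "f y = g (to_vertex y)"
proof (rule unital_hom_eqI[OF f_hom unital_hom_comp[OF g_hom unital_hom_to_vertex]])
  fix l :: "'i dr_gen"
  show "f (gen l) = g (to_vertex (gen l))"
  proof (cases l)
    case (DX s i r)
    then show ?thesis using X_eq[of s i r] by (simp add: to_vertex_simps g_eval)
  next
    case (DH i m)
    obtain k where k: "m = Abs_nonzero_int k" "k \<noteq> 0"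
      by (metis Rep_nonzero_int Rep_nonzero_int_inverse mem_Collect_eq)
    then obtain s n where sn: "k = sg s * int n" "n > 0" using int_sign_cases by blast
    have "is_exp (eta s i) (Abs_fps (PQ s Row i))"
      using PQ_signed[of Row s i] by (simp add: fps_nth_inverse)
    then have "g (to_vertex (d_h i k)) = qint (int n) \<odot> eta s i $ n"
      using sn by (simp add: to_vertex_h g_eval hom_log_coeff[OF g_hom g_scal] log_coeff_unique)
    also have "\<dots> = f (d_h i k)" using sn by (simp add: eta_nth act_simps)
    finally show ?thesis by (simp add: DH k d_h_def)
  qed (simp_all add: to_vertex_simps g_K g_D g_C)
qed (simp add: to_vertex_scal f_scal g_scal)

end

lemma simply_laced_adj:
  assumes "simply_laced_finite_type adj"
  shows "\<not> adj i i" "adj i j \<Longrightarrow> adj j i"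
  using assms by (auto simp: simply_laced_finite_type_def)

lemma h_series_nth: "h_series s i $ n = (if n = 0 then 0 else scal (1 / qint (int n)) * d_h i (sg s * int n))"
  by (simp add: h_series_def pos_series_def)

text \<open>A homomorphism that kills the Drinfeld relations gives a pair of compatible realizations. The commutation
  of the \<open>\<psi>\<^sub>i\<^sup>\<plusminus>\<close> passes to the exponents \<open>h\<^bsub>i,\<plusminus>n\<^esub>\<close> by lemma \<open>commute_expoD\<close>.\<close>

lemma two_realizations_drinfeld:
  fixes adj :: "'i::finite \<Rightarrow> 'i \<Rightarrow> bool"
    and f :: "('i dr_gen, 'k::field_char_0) falg \<Rightarrow> 'r::ring_1"
  assumes adj: "simply_laced_finite_type adj" and sc: "scalar_algebra sc"
    and f: "unital_hom f" "\<And>a. f (scal a) = sc a"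
    and rel: "\<And>l r. drinfeld_rel adj l r \<Longrightarrow> f l = f r"
    and central: "\<And>s x. f (gen (DC s)) * x = x * f (gen (DC s))"
  shows "two_realizations sc adj f (\<lambda>x. f (to_drinfeld x))"
proof -
  interpret scalar_algebra sc by (fact sc)
  interpret f: unital_hom f by (fact f)
  let ?K = "\<lambda>h. f (gen (DK h))" and ?H = "\<lambda>s i n. f (d_h i (sg s * int n))"
  have K_0: "?K (\<lambda>_. 0) = 1" using rel[OF D2_zero] by (simp add: f.hom_one)
  have K_add: "?K h * ?K h' = ?K (\<lambda>j. h j + h' j)" for h h'
    using rel[OF D2_add[of adj h h']] by (simp add: f.hom_mult)
  have K_H: "?K h * ?H s i n = ?H s i n * ?K h" if "n > 0" for h s i n
  proof -
    have "sg s * int n \<noteq> 0" using that by (cases s) simp_all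
    then show ?thesis using rel[OF D2_h[of "sg s * int n" adj h i]]
      by (simp add: f.hom_commutator f.hom_zero) (simp add: commutator_def)
  qed
  have H_H: "?H s i m * ?H s j n = ?H s j n * ?H s i m" if mn: "m > 0" "n > 0" for s i j m n
  proof -
    define e :: "'k poly fract" where "e = of_int (sg s) * (qq - inverse qq)"
    have e: "e \<noteq> 0" using qq_sub_inverse_neq_0[where ?'k='k]
      by (cases s) (simp_all add: e_def del: qq_sub_inverse_neq_0)
    define h where "h i = Abs_fps (\<lambda>n. if n = 0 then 0 else e \<odot> ?H s i n)" for i
    have h0: "h i $ 0 = 0" for i by (simp add: h_def)
    define k where "k i = (\<lambda>j. sg s * coroot i j)" for i :: 'i
    have psi: "f (d_psi s i $ n) = ?K (k i) * expo (h i) $ n" for i n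
    proof -
      have "Abs_fps (\<lambda>m. f (pos_series (\<lambda>n. scal (of_int (sg s) * (qq - inverse qq)) *
          d_h i (sg s * int n)) $ m)) = h i"
        by (simp add: h_def fps_eq_iff pos_series_def f.hom_zero f.hom_mult f e_def act_def)
      then show ?thesis
        by (simp add: d_psi_def f.hom_mult hom_fexp[OF f] k_def)
    qed
    have K_expo: "?K h' * expo (h i) $ n = expo (h i) $ n * ?K h'" for h' i n
      by (rule commute_expoI) (simp add: h_def act_simps K_H)
    \<comment> \<open>The factors \<open>q\<^sup>h\<close> are invertible and commute with the exponentials, so they cancel from the relation.\<close>
    have K_inv: "?K (\<lambda>j. - h j) * (?K h * x) = x" for h x
      by (simp add: K_add K_0 flip: mult.assoc)
    have KK: "?K h * (?K h' * x) = ?K h' * (?K h * x)" for h h' x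
      by (simp add: K_add add.commute flip: mult.assoc)
    have "expo (h i) $ m * expo (h j) $ n = expo (h j) $ n * expo (h i) $ m" for i j m n
    proof -
      have "f (d_psi s i $ m) * f (d_psi s j $ n) = f (d_psi s j $ n) * f (d_psi s i $ m)"
      proof -
        have "psic s i (- sg s * int m) = (d_psi s i $ m :: ('i dr_gen, 'k) falg)" for i m
          by (cases s) (simp_all add: psic_def)
        then show ?thesis
          using rel[OF D3[of adj s i "- sg s * int m" j "- sg s * int n"]] by (simp add: f.hom_mult)
      qed
      moreover have "?K (k i) * expo (h i) $ m * (?K (k j) * expo (h j) $ n) =
          ?K (k i) * (?K (k j) * (expo (h i) $ m * expo (h j) $ n))" for i j m n
      proof -
        have "expo (h i) $ m * (?K h' * x) = ?K h' * (expo (h i) $ m * x)" for h' x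
          by (simp only: K_expo flip: mult.assoc)
        then show ?thesis by (simp only: mult.assoc)
      qed
      ultimately have "?K (k i) * (?K (k j) * (expo (h i) $ m * expo (h j) $ n)) =
          ?K (k i) * (?K (k j) * (expo (h j) $ n * expo (h i) $ m))"
        unfolding psi using KK by metis
      then show ?thesis by (metis K_inv)
    qed
    then have "expo (h i) $ m * h j $ n = h j $ n * expo (h i) $ m" for i j m n
      using commute_expoD[OF h0] by blast
    then have "h j $ n * h i $ m = h i $ m * h j $ n" for i j m n
      using commute_expoD[OF h0, of "h j $ n" i m] by simp
    from this[of i m j n] mn have "(e * e) \<odot> (?H s i m * ?H s j n) = (e * e) \<odot> (?H s j n * ?H s i m)"
      by (simp add: h_def act_simps)
    then show ?thesis using e by (simp add: act_cancel)
  qed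
  show ?thesis
  proof (intro two_realizations.intro two_realizations_axioms.intro sc f central K_0 K_add K_H H_H)
    show "unital_hom (\<lambda>x. f (to_drinfeld x))"
      by (rule unital_hom_comp[OF f(1) unital_hom_to_drinfeld])
    fix s p i
    define h where "h = Abs_fps (\<lambda>n. shape_sg p * f (h_series s i $ n))"
    have "f (to_drinfeld (gen (vpq s p i n))) = shape_sg p ^ n * expo h $ n" for n
    proof -
      have "Abs_fps (\<lambda>m. f ((fps_const (shape_sg p) * h_series s i) $ m)) = h"
        using unital_hom_shape_sg[OF f(1), of p 1] by (simp add: h_def fps_eq_iff)
      then show ?thesis
        by (simp add: to_drinfeld_simps unital_hom_shape_sg[OF f(1)] hom_fexp[OF f])
    qed
    moreover have "shape_sg p ^ n * (shape_sg p ^ n * x) = x" for n and x :: 'r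
      by (cases p; cases "even n"; simp)
    ultimately have "Abs_fps (\<lambda>n. shape_sg p ^ n * f (to_drinfeld (gen (vpq s p i n)))) = expo h"
      by (simp add: fps_eq_iff)
    moreover have "is_exp h (expo h)"
    proof (rule is_exp_expo)
      have hs: "f (h_series s i $ n) = (if n = 0 then 0 else (1 / qint (int n)) \<odot> ?H s i n)" for n
        by (simp add: h_series_nth f.hom_zero f.hom_mult f act_def)
      show "h $ 0 = 0" by (simp add: h_def hs)
      have "f (h_series s i $ m) * f (h_series s i $ n) = f (h_series s i $ n) * f (h_series s i $ m)" for m n
        by (simp add: hs act_simps H_H mult.commute)
      then show "h $ m * h $ n = h $ n * h $ m" for m n
        by (cases p) (simp_all add: h_def)
    qed
    ultimately show "is_exp (Abs_fps (\<lambda>n. shape_sg p * f (h_series s i $ n)))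
        (Abs_fps (\<lambda>n. shape_sg p ^ n * f (to_drinfeld (gen (vpq s p i n)))))"
      by (simp add: h_def)
  qed (use simply_laced_adj[OF adj] rel[OF D2_d] rel[OF D2_d'] rel[OF D2_c] in
      \<open>simp_all add: to_drinfeld_scal to_drinfeld_simps f f.hom_mult f.hom_one\<close>)
qed

text \<open>Conversely, a homomorphism that kills the vertex relations gives such a pair, with \<open>h\<^bsub>i,\<plusminus>n\<^esub>\<close> read off from
  logarithms.\<close>

lemma two_realizations_vertex:
  fixes adj :: "'i::finite \<Rightarrow> 'i \<Rightarrow> bool"
    and g :: "('i v_gen, 'k::field_char_0) falg \<Rightarrow> 'r::ring_1"
  assumes adj: "simply_laced_finite_type adj" and sc: "scalar_algebra sc"
    and g: "unital_hom g" "\<And>a. g (scal a) = sc a"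
    and rel: "\<And>l r. vertex_rel adj l r \<Longrightarrow> g l = g r"
    and central: "\<And>s x. g (gen (VC s)) * x = x * g (gen (VC s))"
  shows "two_realizations sc adj (\<lambda>y. g (to_vertex y)) g"
proof -
  interpret scalar_algebra sc by (fact sc)
  interpret g: unital_hom g by (fact g)
  let ?R = "\<lambda>s i. Abs_fps (\<lambda>n. g (gen (vpq s Row i n)))"
  let ?H = "\<lambda>s i n. g (to_vertex (d_h i (sg s * int n)))"
  have R0: "?R s i $ 0 = 1" for s i
    using rel[OF V0_P[of adj Row i]] rel[OF V0_Q[of adj Row i]] by (cases s) (simp_all add: g.hom_one)
  note R = is_exp_log_coeff[OF R0]
  have H: "?H s i n = qint (int n) \<odot> log_coeff (?R s i) n" if "n > 0" for s i n
    using that by (simp add: to_vertex_h g.hom_mult g act_def hom_log_coeff[OF g])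
  have PQ_PQ: "g (gen (vpq s p i m)) * g (gen (vpq s p' j n)) = g (gen (vpq s p' j n)) * g (gen (vpq s p i m))"
    for s p p' i j m n
    using rel[OF V3_P[of adj p i m p' j n]] rel[OF V3_Q[of adj p i m p' j n]]
    by (cases s) (simp_all add: g.hom_mult)
  have log_commute: "y * log_coeff (?R s i) n = log_coeff (?R s i) n * y"
    if "\<And>n. y * g (gen (vpq s Row i n)) = g (gen (vpq s Row i n)) * y" for y s i n
  proof (cases "n = 0")
    case True
    then show ?thesis by (simp add: log_coeff.simps)
  next
    case False
    then show ?thesis using is_exp_commute[OF R[of s i], of y] that by simp
  qed
  have L_PQ: "log_coeff (?R s i) m * g (gen (vpq s p j n)) = g (gen (vpq s p j n)) * log_coeff (?R s i) m"
    for s i m p j n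
    using log_commute[of "g (gen (vpq s p j n))" s i m] PQ_PQ by simp
  have L_L: "log_coeff (?R s i) m * log_coeff (?R s j) n = log_coeff (?R s j) n * log_coeff (?R s i) m"
    for s i j m n
    using log_commute[of "log_coeff (?R s i) m" s j n] L_PQ by simp
  show ?thesis
  proof (intro two_realizations.intro two_realizations_axioms.intro sc g)
    show "unital_hom (\<lambda>y. g (to_vertex y))"
      by (rule unital_hom_comp[OF g(1) unital_hom_to_vertex])
    show "?H s i m * ?H s j n = ?H s j n * ?H s i m" if "m > 0" "n > 0" for s i j m n
      using that by (simp add: H act_simps L_L mult.commute)
    show "g (to_vertex (gen (DK h))) * ?H s i m = ?H s i m * g (to_vertex (gen (DK h)))"
      if "m > 0" for h s i m
    proof -
      have "g (gen (VK h)) * g (gen (vpq s Row i n)) = g (gen (vpq s Row i n)) * g (gen (VK h))" for n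
        using rel[OF V2_P[of adj h Row i n]] rel[OF V2_Q[of adj h Row i n]]
        by (cases s) (simp_all add: g.hom_mult)
      from log_commute[OF this] show ?thesis using that by (simp add: to_vertex_simps H act_simps)
    qed
    show "g (to_vertex (gen (DC s))) * x = x * g (to_vertex (gen (DC s)))" for s x
      unfolding to_vertex_simps by (rule central)
    show "g (gen (vx s i r)) = g (to_vertex (d_tau r)) * g (to_vertex (gen (DX s i r)))" for s i r
    proof -
      have C: "g (to_vertex (d_c k)) = g (v_c k)" for k
        unfolding d_c_def v_c_def
        by (simp add: unital_hom.hom_power[OF unital_hom_to_vertex] to_vertex_simps)
      have 1: "g (gen (VC Pos)) * g (gen (VC Neg)) = 1"
        using rel[OF V2_c] by (simp add: g.hom_mult g.hom_one)
      have "g (gen (VC Pos)) ^ n * g (gen (VC Neg)) ^ n = 1" for n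
        by (induction n) (simp_all add: 1 power_commutes[of "g (gen (VC Pos))"] mult.assoc,
            metis 1 mult.assoc mult_1_right power_commutes)
      moreover have "g (gen (VC Neg)) ^ n * g (gen (VC Pos)) ^ n = 1" for n
        using calculation[of n] power_commuting_commutes[of "g (gen (VC Neg))" "g (gen (VC Pos)) ^ n" n] central
        by metis
      ultimately have inv: "g (v_c r) * g (v_c (- r)) = 1"
        by (cases "r = 0"; cases "r \<ge> 0") (simp_all add: v_c_def g.hom_power g.hom_one)
      have "g (to_vertex (d_tau r)) * g (to_vertex (gen (DX s i r))) =
          ((- qq) powi r \<odot> g (v_c r)) * ((- qq) powi (- r) \<odot> (g (v_c (- r)) * g (gen (vx s i r))))"
        by (simp add: d_tau_def unital_hom.hom_mult[OF unital_hom_to_vertex] to_vertex_scal g.hom_mult g C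
            to_vertex_simps act_def)
      also have "\<dots> = ((- qq) powi (- r) * (- qq) powi r) \<odot> (g (v_c r) * g (v_c (- r)) * g (gen (vx s i r)))"
        by (simp only: act_simps mult.assoc)
      also have "(- qq) powi (- r) * (- qq) powi r = (1 :: 'k poly fract)"
        by (simp flip: power_int_add)
      finally show ?thesis by (simp add: inv act_simps)
    qed
    show "is_exp (Abs_fps (\<lambda>n. shape_sg p * g (to_vertex (h_series s i $ n))))
        (Abs_fps (\<lambda>n. shape_sg p ^ n * g (gen (vpq s p i n))))" for p s i
    proof -
      have h: "g (to_vertex (h_series s i $ n)) = log_coeff (?R s i) n" for n
        by (cases "n = 0")
          (simp_all add: h_series_nth unital_hom.hom_simps[OF unital_hom_to_vertex] g.hom_simps to_vertex_scal
            to_vertex_h g hom_log_coeff[OF g] log_coeff.simps[of _ 0] act_simps flip: act_def)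
      show ?thesis
      proof (cases p)
        case Row
        then show ?thesis using R[of s i] by (simp add: h)
      next
        case Col
        let ?C = "Abs_fps (\<lambda>n. (- 1) ^ n * g (gen (vpq s Col i n)))"
        have "(?R s i * ?C) $ n = 1 $ n" for n
        proof -
          have "(?R s i * ?C) $ n = g ((Abs_fps (\<lambda>n. gen (vpq s Row i n)) *
              Abs_fps (\<lambda>n. (-1) ^ n * gen (vpq s Col i n))) $ n)"
            by (simp add: fps_mult_nth g.hom_sum g.hom_mult g.hom_power g.hom_minus g.hom_one)
          also have "\<dots> = g (1 $ n)"
            using rel[OF V0_P_inv[of adj i n]] rel[OF V0_Q_inv[of adj i n]] by (cases s) simp_all
          finally show ?thesis by (simp add: g.hom_one g.hom_zero)
        qed
        then have RC: "?R s i * ?C = 1" by (simp add: fps_eq_iff)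
        have "?C $ m * ?R s i $ n = ?R s i $ n * ?C $ m" for m n
          by (cases "even m") (simp_all add: PQ_PQ[of s Col i m Row i n])
        then have "?C * ?R s i = ?R s i * ?C" by (rule fps_mult_commute)
        then have CR: "?C * ?R s i = 1" using RC by simp
        let ?L = "Abs_fps (log_coeff (?R s i))"
        have "theta ?L $ m * ?C $ n = ?C $ n * theta ?L $ m" for m n
          by (cases "even n") (simp_all add: L_PQ of_nat_left_commute mult.assoc)
        then have "theta ?L * ?C = ?C * theta ?L" by (rule fps_mult_commute)
        moreover have "?C $ 0 = 1"
          using rel[OF V0_P[of adj Col i]] rel[OF V0_Q[of adj Col i]] by (cases s) (simp_all add: g.hom_one)
        ultimately have "is_exp (- ?L) ?C"
          by (intro is_exp_inverse[OF R RC CR]) simp_all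
        then show ?thesis
          unfolding Col shape_sg.simps by (rule is_exp_cong) (simp add: h)
      qed
    qed
  qed (use simply_laced_adj[OF adj] rel[OF V2_d] rel[OF V2_d'] rel[OF V2_c] rel[OF V2_zero] rel[OF V2_add] in
      \<open>simp_all add: to_vertex_scal to_vertex_simps g g.hom_mult g.hom_one\<close>)
qed

section \<open>The isomorphism\<close>

theorem proposition1:
  fixes adj :: "'i::finite \<Rightarrow> 'i \<Rightarrow> bool"
  assumes "simply_laced_finite_type adj"
  shows "\<exists>\<phi> \<in> ring_iso (U_v adj) (U_Dr adj :: ('i dr_gen, 'k::field_char_0) falg set ring).
    (\<forall>a. \<phi> (vcl adj (scal a)) = dcl adj (scal a)) \<and>
    (\<forall>h. \<phi> (vcl adj (gen (VK h))) = dcl adj (gen (DK h))) \<and>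
    (\<forall>s. \<phi> (vcl adj (gen (VD s))) = dcl adj (gen (DD s))) \<and>
    (\<forall>s. \<phi> (vcl adj (gen (VC s))) = dcl adj (gen (DC s))) \<and>
    (\<forall>i r. \<phi> (vcl adj (gen (VE i r))) = dcl adj (d_tau r * d_e i r)) \<and>
    (\<forall>i r. \<phi> (vcl adj (gen (VF i r))) = dcl adj (d_tau r * d_f i r)) \<and>
    (\<forall>i n. \<phi> (vcl adj (gen (VQ Row i n))) = dcl adj (fexp (h_series Pos i) $ n)) \<and>
    (\<forall>i n. \<phi> (vcl adj ((-1) ^ n * gen (VQ Col i n))) = dcl adj (fexp (- h_series Pos i) $ n)) \<and>
    (\<forall>i n. \<phi> (vcl adj (gen (VP Row i n))) = dcl adj (fexp (h_series Neg i) $ n)) \<and>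
    (\<forall>i n. \<phi> (vcl adj ((-1) ^ n * gen (VP Col i n))) = dcl adj (fexp (- h_series Neg i) $ n))"
proof -
  define \<rho> where "\<rho> = to_quots (rel_ideal (drinfeld_rel adj)) (counit :: ('i dr_gen, 'k) falg \<Rightarrow> ('i dr_gen, 'k) falg)"
  define e where "e x = (counit (to_drinfeld x) :: ('i v_gen, 'k) falg)" for x :: "('i v_gen, 'k) falg"
  define \<sigma> where "\<sigma> = to_quots (rel_ideal (vertex_rel adj)) e"
  have e_hom: "unital_hom e"
    unfolding e_def by (rule unital_hom_comp[OF unital_hom_counit unital_hom_to_drinfeld])
  have \<rho>: "unital_hom \<rho>" and \<sigma>: "unital_hom \<sigma>"
    unfolding \<rho>_def \<sigma>_def by (rule unital_hom_to_quots unital_hom_counit e_hom)+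

  have \<rho>_rel: "\<rho> l = \<rho> r" if "drinfeld_rel adj l r" for l r
    unfolding \<rho>_def by (rule to_quots_eqI, rule rel_in_rel_ideal, fact that, rule counit_drinfeld_rel, fact that)
  have \<rho>_sc: "scalar_algebra (\<lambda>a. \<rho> (scal a))"
    unfolding scalar_algebra_def \<rho>_def
    by (auto intro!: unital_hom_comp[OF _ unital_hom_scal] unital_hom_to_quots unital_hom_counit
        to_quots_central simp: counit_scal scal_central two_sidedD(1)[OF two_sided_rel_ideal])
  have \<rho>_central: "\<rho> (gen (DC s)) * x = x * \<rho> (gen (DC s))" for s x
  proof -
    have "gen (DC s) * y - y * gen (DC s) \<in> rel_ideal (drinfeld_rel adj)" for y
      by (rule commutes_mod_rel_ideal, rule rel_in_rel_ideal, rule D1)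
    then show ?thesis unfolding \<rho>_def by (rule to_quots_central) (simp add: counit_simps)
  qed
  interpret d: two_realizations "\<lambda>a. \<rho> (scal a)" adj \<rho> "\<lambda>x. \<rho> (to_drinfeld x)"
    by (rule two_realizations_drinfeld[OF assms \<rho>_sc \<rho> refl \<rho>_rel \<rho>_central])

  \<comment> \<open>The counit kills the Drinfeld relations, hence its transport kills the vertex relations.\<close>
  interpret c: two_realizations scal adj "counit :: _ \<Rightarrow> ('i v_gen, 'k) falg" e
    unfolding e_def
    by (rule two_realizations_drinfeld[OF assms free.scalar_algebra_axioms unital_hom_counit counit_scal])
      (simp_all add: counit_drinfeld_rel counit_simps)
  have e_rel: "e l = e r" if "vertex_rel adj l r" for l r
    using c.drinfeld_iff_vertex counit_drinfeld_rel that by blast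

  have \<sigma>_rel: "\<sigma> l = \<sigma> r" if "vertex_rel adj l r" for l r
    unfolding \<sigma>_def by (rule to_quots_eqI, rule rel_in_rel_ideal, fact that, rule e_rel, fact that)
  have \<sigma>_sc: "scalar_algebra (\<lambda>a. \<sigma> (scal a))"
    unfolding scalar_algebra_def \<sigma>_def
    by (auto intro!: unital_hom_comp[OF _ unital_hom_scal] unital_hom_to_quots e_hom
        to_quots_central simp: e_def to_drinfeld_scal counit_scal scal_central two_sidedD(1)[OF two_sided_rel_ideal])
  have \<sigma>_central: "\<sigma> (gen (VC s)) * x = x * \<sigma> (gen (VC s))" for s x
  proof -
    have "gen (VC s) * y - y * gen (VC s) \<in> rel_ideal (vertex_rel adj)" for y
      by (rule commutes_mod_rel_ideal, rule rel_in_rel_ideal, rule V1)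
    then show ?thesis unfolding \<sigma>_def
      by (rule to_quots_central) (simp add: e_def to_drinfeld_simps counit_simps)
  qed
  interpret v: two_realizations "\<lambda>a. \<sigma> (scal a)" adj "\<lambda>y. \<sigma> (to_vertex y)" \<sigma>
    by (rule two_realizations_vertex[OF assms \<sigma>_sc \<sigma> refl \<sigma>_rel \<sigma>_central])

  have d_rel: "\<rho> (to_drinfeld l) = \<rho> (to_drinfeld r)" if "vertex_rel adj l r" for l r
    using d.drinfeld_iff_vertex \<rho>_rel that by blast
  have v_rel: "\<sigma> (to_vertex l) = \<sigma> (to_vertex r)" if "drinfeld_rel adj l r" for l r
    using v.drinfeld_iff_vertex \<sigma>_rel that by blast
  have ker: "to_drinfeld x \<in> rel_ideal (drinfeld_rel adj) \<longleftrightarrow> x \<in> rel_ideal (vertex_rel adj)"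
    for x :: "('i v_gen, 'k) falg"
  proof
    assume "to_drinfeld x \<in> rel_ideal (drinfeld_rel adj)"
    then have "\<sigma> (to_vertex (to_drinfeld x)) = 0"
      using rel_ideal_kernel[OF v.f_hom, of "drinfeld_rel adj" "to_drinfeld x"] v_rel by blast
    then have "\<sigma> x = 0" using v.g_eq_f_to_drinfeld by simp
    then show "x \<in> rel_ideal (vertex_rel adj)"
      unfolding \<sigma>_def by (rule to_quots_eq_0_D[OF two_sided_rel_ideal])
  next
    assume "x \<in> rel_ideal (vertex_rel adj)"
    then have "\<rho> (to_drinfeld x) = 0" 
      using rel_ideal_kernel[OF d.g_hom, of "vertex_rel adj" x] d_rel by blast
    then show "to_drinfeld x \<in> rel_ideal (drinfeld_rel adj)"
      unfolding \<rho>_def by (rule to_quots_eq_0_D[OF two_sided_rel_ideal])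
  qed
  have surj: "\<exists>x. y - to_drinfeld x \<in> rel_ideal (drinfeld_rel adj)"
    for y :: "('i dr_gen, 'k) falg"
  proof
    have "\<rho> (y - to_drinfeld (to_vertex y)) = 0"
      using d.f_eq_g_to_vertex[of y] by (simp add: unital_hom.hom_diff[OF \<rho>])
    then show "y - to_drinfeld (to_vertex y) \<in> rel_ideal (drinfeld_rel adj)"
      unfolding \<rho>_def by (rule to_quots_eq_0_D[OF two_sided_rel_ideal])
  qed
  obtain \<phi> where \<phi>: "\<phi> \<in> ring_iso (U_v adj) (U_Dr adj :: ('i dr_gen, 'k) falg set ring)"
    and \<phi>_cls: "\<phi> (vcl adj x) = dcl adj (to_drinfeld x)" for x
    using presented_iso[OF unital_hom_to_drinfeld ker surj] by blast
  have m1: "(- 1) ^ n * ((- 1) ^ n * x) = x" for n and x :: "('i dr_gen, 'k) falg"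
    by (cases "even n") simp_all
  have Col: "to_drinfeld ((-1) ^ n * gen (vpq s Col i n)) =
      (fexp (- h_series s i) $ n :: ('i dr_gen, 'k) falg)"
    for s n and i :: 'i
  proof -
    have "to_drinfeld (shape_sg Col ^ n * gen (vpq s Col i n)) =
        shape_sg Col ^ n * (to_drinfeld (gen (vpq s Col i n)) :: ('i dr_gen, 'k) falg)"
      by (rule unital_hom_shape_sg[OF unital_hom_to_drinfeld])
    moreover have "fps_const (- 1) * F = - F" for F :: "('i dr_gen, 'k) falg fps"
      by (simp add: fps_eq_iff)
    ultimately show ?thesis by (simp add: to_drinfeld_simps m1)
  qed
  have Row: "to_drinfeld (gen (vpq s Row i n)) = (fexp (h_series s i) $ n :: ('i dr_gen, 'k) falg)"
    for s n and i :: 'i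
    by (simp add: to_drinfeld_simps)
  show ?thesis
    by (rule bexI[OF _ \<phi>])
      (simp add: \<phi>_cls to_drinfeld_scal to_drinfeld_simps Col[of _ Pos, simplified] Col[of _ Neg, simplified]
        Row[of Pos, simplified] Row[of Neg, simplified] to_drinfeld_simps(1)[of Pos, simplified]
        to_drinfeld_simps(1)[of Neg, simplified])
qed

end
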